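(* Let $G$ be a graph with $\mathrm{mad}(G)<\frac{14}{5}$. Then for every set $\{x,y,z\}$ of three distinct vertices of $G$ that is non-blocked, $G$ is $(2,2,2)$-AT extendable with respect to $(x,y,z)$.
   Context: All graphs are finite and simple. $\mathrm{mad}(G)=\max_{H\subseteq G} 2|E(H)|/|V(H)|$ is the maximum average degree. For an orientation $D$ of a graph $G$, an Eulerian sub-digraph of $D$ is a spanning sub-digraph $F$ of $D$ with $d^+_F(v)=d^-_F(v)$ for every vertex $v$. Let $\mathrm{diff}(D)$ be the number of Eulerian sub-digraphs of $D$ with an even number of arcs minus the number with an odd number of arcs; $D$ is an AT-orientation if $\mathrm{diff}(D)\neq 0$. For $f:V(G)\to\mathbb{N}$, $G$ is $f$-AT if $G$ has an AT-orientation $D$ with $d^+_D(v)\le f(v)-1$ for every vertex $v$. Given distinct vertices $v_1,\dots,v_k$ and integers $a_i\in\{1,2\}$, define $f(v_i)=a_i$ for $i\in[k]$ and $f(v)=3$ for all other vertices; $G$ is $(a_1,\dots,a_k)$-AT extendable with respect to $(v_1,\dots,v_k)$ if $G$ is $f$-AT. A set $\{x,y,z\}$ of three distinct vertices of $G$ is blocked if either every proper $3$-coloring $\phi$ of $G$ satisfies $|\phi(\{x,y,z\})|=3$, or every proper $3$-coloring $\phi$ of $G$ satisfies $|\phi(\{x,y,z\})|=1$; it is non-blocked otherwise. (In particular, if $G$ has no proper 3-coloring, every triple is blocked.) *)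

theory Defs
  imports Complex_Main
begin

definition simple_graph :: "'a set \<Rightarrow> 'a set set \<Rightarrow> bool" where
  "simple_graph V E \<longleftrightarrow> finite V \<and>
     (\<forall>e\<in>E. \<exists>u v. e = {u, v} \<and> u \<noteq> v \<and> u \<in> V \<and> v \<in> V)"

definition subgraph :: "'a set \<Rightarrow> 'a set set \<Rightarrow> 'a set \<Rightarrow> 'a set set \<Rightarrow> bool" where
  "subgraph W F V E \<longleftrightarrow> W \<subseteq> V \<and> F \<subseteq> E \<and> (\<forall>e\<in>F. e \<subseteq> W)"

definition mad :: "'a set \<Rightarrow> 'a set set \<Rightarrow> real" where
  "mad V E = Max {2 * real (card F) / real (card W) | W F. subgraph W F V E \<and> W \<noteq> {}}"

definition orientation :: "'a set \<Rightarrow> 'a set set \<Rightarrow> ('a \<times> 'a) set \<Rightarrow> bool" where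
  "orientation V E D \<longleftrightarrow> (\<forall>(u,v)\<in>D. {u, v} \<in> E) \<and>
     (\<forall>u v. {u, v} \<in> E \<longrightarrow> ((u, v) \<in> D \<longleftrightarrow> (v, u) \<notin> D))"

definition outdeg :: "('a \<times> 'a) set \<Rightarrow> 'a \<Rightarrow> nat" where
  "outdeg D v = card {w. (v, w) \<in> D}"

definition indeg :: "('a \<times> 'a) set \<Rightarrow> 'a \<Rightarrow> nat" where
  "indeg D v = card {w. (w, v) \<in> D}"

definition eulerian_subs :: "'a set \<Rightarrow> ('a \<times> 'a) set \<Rightarrow> ('a \<times> 'a) set set" where
  "eulerian_subs V D = {F. F \<subseteq> D \<and> (\<forall>v\<in>V. outdeg F v = indeg F v)}"

definition diff :: "'a set \<Rightarrow> ('a \<times> 'a) set \<Rightarrow> int" where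
  "diff V D = int (card {F \<in> eulerian_subs V D. even (card F)})
            - int (card {F \<in> eulerian_subs V D. odd (card F)})"

definition AT_orientation :: "'a set \<Rightarrow> 'a set set \<Rightarrow> ('a \<times> 'a) set \<Rightarrow> bool" where
  "AT_orientation V E D \<longleftrightarrow> orientation V E D \<and> diff V D \<noteq> 0"

definition f_AT :: "'a set \<Rightarrow> 'a set set \<Rightarrow> ('a \<Rightarrow> nat) \<Rightarrow> bool" where
  "f_AT V E f \<longleftrightarrow> (\<exists>D. AT_orientation V E D \<and> (\<forall>v\<in>V. int (outdeg D v) \<le> int (f v) - 1))"

text \<open>(a_1,...,a_k)-AT extendable w.r.t. (v_1,...,v_k), given as a list of pairs (v_i, a_i).\<close>
definition AT_extendable :: "'a set \<Rightarrow> 'a set set \<Rightarrow> ('a \<times> nat) list \<Rightarrow> bool" where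
  "AT_extendable V E vas \<longleftrightarrow> distinct (map fst vas) \<and> set (map fst vas) \<subseteq> V \<and>
     (\<forall>a \<in> set (map snd vas). a \<in> {1, 2}) \<and>
     f_AT V E (\<lambda>v. case map_of vas v of Some a \<Rightarrow> a | None \<Rightarrow> 3)"

definition proper_3_coloring :: "'a set \<Rightarrow> 'a set set \<Rightarrow> ('a \<Rightarrow> nat) \<Rightarrow> bool" where
  "proper_3_coloring V E \<phi> \<longleftrightarrow> (\<forall>v\<in>V. \<phi> v \<in> {0, 1, 2}) \<and>
     (\<forall>u v. {u, v} \<in> E \<longrightarrow> u \<noteq> v \<longrightarrow> \<phi> u \<noteq> \<phi> v)"

definition blocked :: "'a set \<Rightarrow> 'a set set \<Rightarrow> 'a \<Rightarrow> 'a \<Rightarrow> 'a \<Rightarrow> bool" where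
  "blocked V E x y z \<longleftrightarrow>
     (\<forall>\<phi>. proper_3_coloring V E \<phi> \<longrightarrow> card (\<phi> ` {x, y, z}) = 3) \<or>
     (\<forall>\<phi>. proper_3_coloring V E \<phi> \<longrightarrow> card (\<phi> ` {x, y, z}) = 1)"

end

(* Write f = 3 - g with a deficiency g. Three operations reduce f-AT to smaller graphs: splitting V into two parts and
   orienting all edges between them one way; hence removing a vertex v with deg v < f v; and, for
   adjacent p, q with f p < f q, removing q at the expense of all its neighbours except p (the
   analogue of giving q a colour missing from the list of p).

   In a minimal counterexample sets with few boundary edges contain many of x, y, z; in particular
   there are no bridges. All degrees are at least f, and mad < 14/5 leaves room for excess
   (deg - f) at most 1 in total, and for at most 8 vertices if it is 1. If deg = f everywhere, one
   application of the third operation at a neighbour of x removes the whole graph one vertex at a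
   time. Otherwise there is a unique vertex h with deg h = f h + 1, and the process can only stop at h. What
   is left is then so restricted (often a triangle through h) that either a further operation
   applies, or the graph is one of three explicit graphs with 4 or 6 vertices, or {x, y, z} is
   blocked. *)

theory Submission
  imports Defs
begin

section \<open>Coefficients of the graph polynomial\<close>

text \<open>Orientations are handled through the Alon-Tarsi identity: \<open>diff\<close> equals,
  for the outdegree vector, a coefficient of the product of \<open>x_a - x_b\<close> over the arcs.
  Coefficients multiply over disjoint parts, and the third operation becomes an extremal choice of a
  monomial. The induction cannot follow one fixed triple, since the operations charge neighbours;
  the hypothesis covers every set of at most three deficient vertices in every smaller induced
  subgraph. Non-blockedness concerns exactly three, so a total deficiency of 2 is always solvable,
  and this drives all cut arguments. A genuinely new triple is formed only once, with
  \<open>h\<close> replacing a vertex of \<open>X\<close>, and there the colours of the two are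
  forced to agree. The constant 14/5 amounts to |V| + 5 * excess <= 13 for |X| = 3. The resulting
  bound 8 on |V| matters when \<open>h\<close> lies outside \<open>X\<close>, where it nearly
  determines the vertex set. The three explicit graphs are cubic graphs minus an edge
  \<open>xy\<close>, namely K4 and, in two ways, the prism, with deficiency 1 at \<open>x\<close>,
  \<open>y\<close> and \<open>h\<close>.\<close>

text \<open>\<open>gcoeff es m\<close> is the coefficient of the monomial with exponent vector \<open>m\<close> in the product of
  the factors \<open>x\<^sub>a - x\<^sub>b\<close> over the pairs \<open>(a, b)\<close> in \<open>es\<close>.\<close>

primrec gcoeff :: "('a \<times> 'a) list \<Rightarrow> ('a \<Rightarrow> nat) \<Rightarrow> int" where
  "gcoeff [] m = (if m = (\<lambda>_. 0) then 1 else 0)"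
| "gcoeff (e # es) m =
     (if 0 < m (fst e) then gcoeff es (m(fst e := m (fst e) - 1)) else 0) -
     (if 0 < m (snd e) then gcoeff es (m(snd e := m (snd e) - 1)) else 0)"

definition out_count :: "('a \<times> 'a) list \<Rightarrow> 'a \<Rightarrow> nat" where
  "out_count es v = length (filter (\<lambda>e. fst e = v) es)"

lemma out_count_simps [simp]:
  "out_count [] = (\<lambda>_. 0)"
  "out_count (e # es) v = (if fst e = v then 1 else 0) + out_count es v"
  by (auto simp: out_count_def)

lemma gcoeff_Cons_nonzero:
  assumes "gcoeff (e # es) m \<noteq> 0"
  obtains w where "w \<in> {fst e, snd e}" "0 < m w" "gcoeff es (m(w := m w - 1)) \<noteq> 0"
proof (cases "0 < m (fst e) \<and> gcoeff es (m(fst e := m (fst e) - 1)) \<noteq> 0")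
  case True
  then show ?thesis using that[of "fst e"] by simp
next
  case False
  then have "0 < m (snd e) \<and> gcoeff es (m(snd e := m (snd e) - 1)) \<noteq> 0"
    using assms by (auto split: if_splits)
  then show ?thesis using that[of "snd e"] by simp
qed

lemma gcoeff_support:
  "gcoeff es m \<noteq> 0 \<Longrightarrow> set es \<subseteq> S \<times> S \<Longrightarrow> v \<notin> S \<Longrightarrow> m v = 0"
proof (induction es arbitrary: m)
  case Nil
  then show ?case by (auto split: if_splits)
next
  case (Cons e es)
  obtain w where w: "w \<in> {fst e, snd e}" "gcoeff es (m(w := m w - 1)) \<noteq> 0"
    using gcoeff_Cons_nonzero[OF Cons.prems(1)] by blast
  have "fst e \<in> S" "snd e \<in> S" using Cons.prems(2) by auto
  then have "v \<noteq> w" using w(1) Cons.prems(3) by blast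
  have "(m(w := m w - 1)) v = 0"
    by (rule Cons.IH[OF w(2)]) (use Cons.prems in simp_all)
  then show ?case using \<open>v \<noteq> w\<close> by simp
qed

lemma sum_upd_decr:
  fixes m :: "'a \<Rightarrow> nat"
  assumes "finite T" "0 < m w"
  shows "(\<Sum>v\<in>T. m v) = (\<Sum>v\<in>T. (m(w := m w - 1)) v) + (if w \<in> T then 1 else 0)"
proof (cases "w \<in> T")
  case True
  have "sum m T = m w + sum m (T - {w})"
    using assms True by (simp add: sum.remove)
  moreover have "(\<Sum>v\<in>T. (m(w := m w - 1)) v) = (m w - 1) + sum m (T - {w})"
    using assms True by (simp add: sum.remove)
  ultimately show ?thesis
    using True assms by simp
next
  case False
  then have "(\<Sum>v\<in>T. m v) = (\<Sum>v\<in>T. (m(w := m w - 1)) v)"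
    by (intro sum.cong refl) auto
  then show ?thesis using False by simp
qed

text \<open>Each factor contributes one variable, so only factors with an end in \<open>T\<close>
  can raise the total exponent on \<open>T\<close>.\<close>

lemma gcoeff_degree_le:
  assumes "finite T"
  shows "gcoeff es m \<noteq> 0 \<Longrightarrow>
    (\<Sum>v\<in>T. m v) \<le> length (filter (\<lambda>e. fst e \<in> T \<or> snd e \<in> T) es)"
proof (induction es arbitrary: m)
  case Nil
  then show ?case by (auto split: if_splits)
next
  case (Cons e es)
  obtain w where w: "w \<in> {fst e, snd e}" "0 < m w" "gcoeff es (m(w := m w - 1)) \<noteq> 0"
    using gcoeff_Cons_nonzero[OF Cons.prems(1)] by blast
  show ?case
    using Cons.IH[OF w(3)] sum_upd_decr[OF assms, of m w] w(2) w(1) by (auto split: if_splits)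
qed

lemma gcoeff_degree_eq:
  assumes "finite T"
  shows "gcoeff es m \<noteq> 0 \<Longrightarrow> set es \<subseteq> T \<times> T \<Longrightarrow> (\<Sum>v\<in>T. m v) = length es"
proof (induction es arbitrary: m)
  case Nil
  then show ?case by (auto split: if_splits)
next
  case (Cons e es)
  obtain w where w: "w \<in> {fst e, snd e}" "0 < m w" "gcoeff es (m(w := m w - 1)) \<noteq> 0"
    using gcoeff_Cons_nonzero[OF Cons.prems(1)] by blast
  show ?case
    using Cons.IH[OF w(3)] sum_upd_decr[OF assms, of m w] w(2) w(1) Cons.prems(2) by auto
qed

lemma gcoeff_append_disjoint:
  assumes "set es2 \<subseteq> T \<times> T" "S \<inter> T = {}"
  shows "set es1 \<subseteq> S \<times> S \<Longrightarrow> (\<And>v. v \<notin> S \<Longrightarrow> m1 v = 0) \<Longrightarrow> (\<And>v. v \<notin> T \<Longrightarrow> m2 v = 0) \<Longrightarrow>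
    gcoeff (es1 @ es2) (\<lambda>v. m1 v + m2 v) = gcoeff es1 m1 * gcoeff es2 m2"
proof (induction es1 arbitrary: m1)
  case Nil
  show ?case
  proof (cases "m1 = (\<lambda>_. 0)")
    case False
    then obtain v where v: "m1 v \<noteq> 0" by auto
    then have "v \<notin> T" using Nil.prems(2)[of v] assms(2) by auto
    then have "gcoeff es2 (\<lambda>v. m1 v + m2 v) = 0"
      using gcoeff_support[OF _ assms(1), of "\<lambda>v. m1 v + m2 v" v] v by auto
    then show ?thesis using False by simp
  qed simp
next
  case (Cons e es1)
  have step: "(if 0 < m1 w + m2 w then
        gcoeff (es1 @ es2) ((\<lambda>v. m1 v + m2 v)(w := m1 w + m2 w - 1)) else 0)
      = (if 0 < m1 w then gcoeff es1 (m1(w := m1 w - 1)) else 0) * gcoeff es2 m2"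
    if "w \<in> S" for w
  proof -
    have m2: "m2 w = 0" using that Cons.prems assms(2) by auto
    have eq: "(\<lambda>v. m1 v + m2 v)(w := m1 w + m2 w - 1) = (\<lambda>v. (m1(w := m1 w - 1)) v + m2 v)"
      using m2 by auto
    have "gcoeff (es1 @ es2) (\<lambda>v. (m1(w := m1 w - 1)) v + m2 v)
      = gcoeff es1 (m1(w := m1 w - 1)) * gcoeff es2 m2"
      by (rule Cons.IH) (use Cons.prems that in auto)
    then show ?thesis using m2 eq by simp
  qed
  have "fst e \<in> S" "snd e \<in> S" using Cons.prems by auto
  from step[OF this(1)] step[OF this(2)] show ?case
    by (simp add: algebra_simps)
qed

text \<open>Among the monomials of maximal degree in the variables of \<open>T\<close>, every factor \<open>x\<^sub>t - x\<^sub>s\<close> with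
  \<open>t \<in> T\<close>, \<open>s \<notin> T\<close> has to contribute \<open>x\<^sub>t\<close>.\<close>

lemma gcoeff_append_cross:
  assumes "finite T" and tot: "length (filter (\<lambda>e. fst e \<in> T \<or> snd e \<in> T) bs) \<le> (\<Sum>v\<in>T. m v)"
  shows "set cr \<subseteq> T \<times> (- T) \<Longrightarrow>
    gcoeff (cr @ bs) (\<lambda>v. m v + out_count cr v) = gcoeff bs m"
proof (induction cr)
  case (Cons e cr)
  let ?M = "\<lambda>v. m v + out_count (e # cr) v"
  have e: "fst e \<in> T" "snd e \<notin> T" using Cons.prems by auto
  have 1: "?M(fst e := ?M (fst e) - 1) = (\<lambda>v. m v + out_count cr v)"
    by auto
  \<comment> \<open>Choosing the end outside \<open>T\<close> leaves a total exponent on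
    \<open>T\<close> that exceeds what the remaining factors can supply by at least one.\<close>
  have "gcoeff (cr @ bs) (?M(snd e := ?M (snd e) - 1)) = 0"
  proof (rule ccontr)
    assume "gcoeff (cr @ bs) (?M(snd e := ?M (snd e) - 1)) \<noteq> 0"
    from gcoeff_degree_le[OF assms(1) this]
    have s1: "(\<Sum>v\<in>T. (?M(snd e := ?M (snd e) - 1)) v)
      \<le> length cr + length (filter (\<lambda>e. fst e \<in> T \<or> snd e \<in> T) bs)"
      by (smt (verit, best) add_le_mono1 filter_append le_trans length_append length_filter_le)
    have s2: "(\<Sum>v\<in>T. (?M(snd e := ?M (snd e) - 1)) v) = (\<Sum>v\<in>T. ?M v)"
      by (rule sum.cong) (use e in auto)
    have s3: "(\<Sum>v\<in>T. ?M v) = (\<Sum>v\<in>T. m v) + (\<Sum>v\<in>T. out_count (e # cr) v)"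
      by (simp only: sum.distrib)
    have s4: "(\<Sum>v\<in>T. out_count es v) = length es" if "set es \<subseteq> T \<times> UNIV" for es :: "('a \<times> 'a) list"
      using that
    proof (induction es)
      case (Cons e es)
      then show ?case
        using assms(1) by (auto simp: sum.distrib)
    qed simp
    have s5: "set (e # cr) \<subseteq> T \<times> UNIV" using Cons.prems by auto
    have "length (e # cr) + (\<Sum>v\<in>T. m v) \<le> length cr + length (filter (\<lambda>e. fst e \<in> T \<or> snd e \<in> T) bs)"
      using s1 s2 s3 s4[OF s5] by linarith
    then show False using tot by simp
  qed
  then have "gcoeff ((e # cr) @ bs) ?M = gcoeff (cr @ bs) (?M(fst e := ?M (fst e) - 1))"
    by simp
  then show ?case using 1 Cons by simp
qed simp

text \<open>Some choice of one variable per factor produces the monomial; orienting each pair away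
  from the chosen end turns \<open>m\<close> into an outdegree vector.\<close>

lemma gcoeff_obtain_orientation:
  "gcoeff es m \<noteq> 0 \<Longrightarrow>
    \<exists>es'. list_all2 (\<lambda>e e'. e' = e \<or> e' = prod.swap e) es es' \<and> m = out_count es'"
proof (induction es arbitrary: m)
  case Nil
  then show ?case by (auto split: if_splits)
next
  case (Cons e es)
  obtain w where w: "w \<in> {fst e, snd e}" "0 < m w" "gcoeff es (m(w := m w - 1)) \<noteq> 0"
    using gcoeff_Cons_nonzero[OF Cons.prems(1)] by blast
  from Cons.IH[OF w(3)] obtain es' where
    es': "list_all2 (\<lambda>e e'. e' = e \<or> e' = prod.swap e) es es'" "m(w := m w - 1) = out_count es'"
    by blast
  define e' where "e' = (if w = fst e then e else prod.swap e)"
  have "m = out_count (e' # es')"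
    unfolding out_count_simps(2)[abs_def] es'(2)[symmetric] using w by (auto simp: e'_def)
  moreover have "list_all2 (\<lambda>e e'. e' = e \<or> e' = prod.swap e) (e # es) (e' # es')"
    using es' by (auto simp: e'_def)
  ultimately show ?case by blast
qed

text \<open>Reversing a pair negates its factor, so a reorientation multiplies all coefficients by
  one common sign.\<close>

lemma gcoeff_flip:
  "list_all2 (\<lambda>e e'. e' = e \<or> e' = prod.swap e) es es' \<Longrightarrow> \<exists>c\<in>{1, - 1}. \<forall>m. gcoeff es' m = c * gcoeff es m"
proof (induction es es' rule: list_all2_induct)
  case Nil
  then show ?case by force
next
  case (Cons e es e' es')
  then obtain c where c: "c \<in> {1, - 1}" "\<And>m. gcoeff es' m = c * gcoeff es m" by blast
  show ?case
  proof (cases "e' = e")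
    case True
    have "\<forall>m. gcoeff (e' # es') m = c * gcoeff (e # es) m"
      unfolding True gcoeff.simps c(2) by (simp add: right_diff_distrib)
    then show ?thesis using c(1) by blast
  next
    case False
    then have "e' = prod.swap e" using Cons by simp
    then have "\<forall>m. gcoeff (e' # es') m = (- c) * gcoeff (e # es) m"
      unfolding gcoeff.simps c(2) by (simp add: right_diff_distrib)
    moreover have "- c \<in> {1, - 1}" using c(1) by auto
    ultimately show ?thesis by blast
  qed
qed

lemma all_eq_Suc_at_iff:
  fixes m X :: "'a \<Rightarrow> nat"
  shows "(\<forall>v. m v = (if v = a then 1 else 0) + X v) \<longleftrightarrow>
    0 < m a \<and> (\<forall>v. (m(a := m a - 1)) v = X v)" (is "?L \<longleftrightarrow> ?R")
proof
  assume L: ?L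
  from L[rule_format, of a] L show ?R by simp
next
  assume R: ?R
  show ?L
  proof
    fix v
    show "m v = (if v = a then 1 else 0) + X v"
      using R[THEN conjunct1] R[THEN conjunct2, rule_format, of v] by (cases "v = a") auto
  qed
qed

text \<open>The product is multiplied out: \<open>F\<close> collects the factors that contribute
  their second variable, each with sign -1.\<close>

lemma gcoeff_eq_signed_sum:
  "distinct es \<Longrightarrow> gcoeff es m = (\<Sum>F\<in>Pow (set es).
     if \<forall>v. m v = card {e \<in> set es - F. fst e = v} + card {e \<in> F. snd e = v}
     then (- 1) ^ card F else 0)"
proof (induction es arbitrary: m)
  case Nil
  show ?case unfolding list.set Pow_empty by (auto simp: fun_eq_iff)
next
  case (Cons e es)
  let ?P = "\<lambda>A m F. \<forall>v. m v = card {e \<in> A - F. fst e = v} + card {e \<in> F. snd e = v}"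
  have fin: "finite F" if "F \<in> Pow (set es)" for F
    using that finite_subset by auto
  have ne: "e \<notin> set es" using Cons.prems by simp
  have A: "(\<Sum>F\<in>Pow (set es). if ?P (set (e # es)) m F then (- 1::int) ^ card F else 0)
      = (if 0 < m (fst e) then gcoeff es (m(fst e := m (fst e) - 1)) else 0)"
  proof -
    have eq: "?P (set (e # es)) m F \<longleftrightarrow> 0 < m (fst e) \<and> ?P (set es) (m(fst e := m (fst e) - 1)) F"
      if F: "F \<in> Pow (set es)" for F
    proof -
      have set: "{e' \<in> set (e # es) - F. fst e' = v} =
          (if v = fst e then insert e {e' \<in> set es - F. fst e' = v} else {e' \<in> set es - F. fst e' = v})" for v
        using ne F by auto
      have "card {e' \<in> set (e # es) - F. fst e' = v} = (if v = fst e then 1 else 0) + card {e' \<in> set es - F. fst e' = v}" for v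
        unfolding set using ne by simp
      then show ?thesis
        using all_eq_Suc_at_iff[of m "fst e" "\<lambda>v. card {e \<in> set es - F. fst e = v} + card {e \<in> F. snd e = v}"]
        by (simp only: add.assoc)
    qed
    show ?thesis
    proof (cases "0 < m (fst e)")
      case True
      have IH: "gcoeff es (m(fst e := m (fst e) - 1))
        = (\<Sum>F\<in>Pow (set es). if ?P (set es) (m(fst e := m (fst e) - 1)) F then (- 1) ^ card F else 0)"
        by (rule Cons.IH) (use Cons.prems in simp)
      show ?thesis
        unfolding if_P[OF True] IH
        by (intro sum.cong refl, subst eq, assumption) (simp only: True simp_thms)
    next
      case False
      have "(\<Sum>F\<in>Pow (set es). if ?P (set (e # es)) m F then (- 1::int) ^ card F else 0) = 0"
        by (intro sum.neutral ballI, subst eq, assumption) (simp add: False)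
      then show ?thesis using False by simp
    qed
  qed
  have B: "(\<Sum>F\<in>Pow (set es). if ?P (set (e # es)) m (insert e F) then (- 1::int) ^ card (insert e F) else 0)
      = - (if 0 < m (snd e) then gcoeff es (m(snd e := m (snd e) - 1)) else 0)"
  proof -
    have eq: "?P (set (e # es)) m (insert e F) \<longleftrightarrow> 0 < m (snd e) \<and> ?P (set es) (m(snd e := m (snd e) - 1)) F"
      if F: "F \<in> Pow (set es)" for F
    proof -
      have set: "{e' \<in> insert e F. snd e' = v} =
          (if v = snd e then insert e {e' \<in> F. snd e' = v} else {e' \<in> F. snd e' = v})" for v
        by auto
      have 1: "card {e' \<in> insert e F. snd e' = v} = (if v = snd e then 1 else 0) + card {e' \<in> F. snd e' = v}" for v
      proof -
        have "e \<notin> F" "finite F"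
          using ne F fin[OF F] by auto
        then show ?thesis unfolding set by simp
      qed
      have 2: "set (e # es) - insert e F = set es - F" using ne by auto
      show ?thesis
        unfolding 2 1
        using all_eq_Suc_at_iff[of m "snd e" "\<lambda>v. card {e \<in> set es - F. fst e = v} + card {e \<in> F. snd e = v}"]
        by (simp only: add.left_commute)
    qed
    have card: "card (insert e F) = Suc (card F)" if "F \<in> Pow (set es)" for F
      using that ne fin[OF that] by (subst card_insert_disjoint) auto
    show ?thesis
    proof (cases "0 < m (snd e)")
      case True
      have IH: "gcoeff es (m(snd e := m (snd e) - 1))
        = (\<Sum>F\<in>Pow (set es). if ?P (set es) (m(snd e := m (snd e) - 1)) F then (- 1) ^ card F else 0)"
        by (rule Cons.IH) (use Cons.prems in simp)
      show ?thesis
        unfolding if_P[OF True] IH sum_negf[symmetric]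
        by (intro sum.cong refl, subst eq, assumption)
          (simp add: True card del: fun_upd_apply split: if_split)
    next
      case False
      have "(\<Sum>F\<in>Pow (set es). if ?P (set (e # es)) m (insert e F) then (- 1::int) ^ card (insert e F) else 0) = 0"
        by (intro sum.neutral ballI, subst eq, assumption) (simp add: False)
      then show ?thesis using False by simp
    qed
  qed
  have split: "(\<Sum>F\<in>Pow (set (e # es)). f F) = (\<Sum>F\<in>Pow (set es). f F) + (\<Sum>F\<in>Pow (set es). f (insert e F))"
    for f :: "('a \<times> 'a) set \<Rightarrow> int"
  proof -
    have "inj_on (insert e) (Pow (set es))"
      using ne by (auto simp: inj_on_def)
    then have "(\<Sum>F\<in>insert e ` Pow (set es). f F) = (\<Sum>F\<in>Pow (set es). f (insert e F))"
      by (simp add: sum.reindex)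
    moreover have "Pow (set es) \<inter> insert e ` Pow (set es) = {}" using ne by auto
    ultimately show ?thesis
      by (simp add: Pow_insert sum.union_disjoint)
  qed
  show ?case
    unfolding split A B by simp
qed

text \<open>The Alon-Tarsi identity. Choosing the second variable on \<open>F\<close> means
  reversing \<open>F\<close>, and this keeps all outdegrees exactly if \<open>F\<close> is
  Eulerian.\<close>

lemma diff_eq_gcoeff:
  assumes "distinct es" and es: "set es \<subseteq> V \<times> V" and fin: "finite V"
  shows "diff V (set es) = gcoeff es (out_count es)"
proof -
  let ?D = "set es"
  have card_out: "card {w. (v, w) \<in> F} = card {e \<in> F. fst e = v}" for F :: "('a \<times> 'a) set" and v
    by (rule bij_betw_same_card[of "Pair v"]) (auto simp: bij_betw_def inj_on_def image_iff)
  have card_in: "card {w. (w, v) \<in> F} = card {e \<in> F. snd e = v}" for F :: "('a \<times> 'a) set" and v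
    by (rule bij_betw_same_card[of "\<lambda>w. (w, v)"]) (auto simp: bij_betw_def inj_on_def image_iff)
  have oc: "out_count es v = card {e \<in> ?D. fst e = v}" for v
    using distinct_card[OF distinct_filter[OF assms(1)], of "\<lambda>e. fst e = v"]
    by (simp add: out_count_def)
  have eq: "(\<forall>v. out_count es v = card {e \<in> ?D - F. fst e = v} + card {e \<in> F. snd e = v})
      \<longleftrightarrow> F \<in> eulerian_subs V ?D" if F: "F \<in> Pow ?D" for F
  proof -
    have *: "card {e \<in> ?D. fst e = v} = card {e \<in> ?D - F. fst e = v} + card {e \<in> F. fst e = v}" for v
    proof -
      have "finite F" using F finite_subset by auto
      moreover have "{e \<in> ?D. fst e = v} = {e \<in> ?D - F. fst e = v} \<union> {e \<in> F. fst e = v}"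
        using F by auto
      ultimately show ?thesis by (simp add: card_Un_disjoint disjoint_iff)
    qed
    \<comment> \<open>\<open>eulerian_subs\<close> tests only the vertices of \<open>V\<close>,
      whereas \<open>gcoeff\<close> compares exponents everywhere; outside \<open>V\<close> both
      counts are 0.\<close>
    have "card {e \<in> F. fst e = v} = card {e \<in> F. snd e = v}" if "v \<notin> V" for v
    proof -
      have "{e \<in> F. fst e = v} = {}" "{e \<in> F. snd e = v} = {}"
        using es F that by auto
      then show ?thesis by metis
    qed
    then show ?thesis
      using F unfolding eulerian_subs_def outdeg_def indeg_def card_out card_in oc *
      by auto
  qed
  have finE: "finite (eulerian_subs V ?D)"
    unfolding eulerian_subs_def by (rule finite_subset[of _ "Pow ?D"]) auto
  have "gcoeff es (out_count es) = (\<Sum>F\<in>Pow ?D. if F \<in> eulerian_subs V ?D then (- 1) ^ card F else 0)"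
    unfolding gcoeff_eq_signed_sum[OF assms(1)] by (rule sum.cong) (use eq in auto)
  also have "\<dots> = (\<Sum>F\<in>eulerian_subs V ?D. (- 1) ^ card F)"
    by (subst sum.inter_restrict[symmetric])
      (auto simp: eulerian_subs_def intro!: sum.cong)
  also have "\<dots> = (\<Sum>F\<in>{F \<in> eulerian_subs V ?D. even (card F)}. (- 1) ^ card F)
      + (\<Sum>F\<in>{F \<in> eulerian_subs V ?D. odd (card F)}. (- 1) ^ card F)"
    by (subst sum.union_disjoint[symmetric]) (use finE in \<open>auto intro!: sum.cong\<close>)
  also have "\<dots> = diff V ?D"
    by (simp add: diff_def)
  finally show ?thesis ..
qed

section \<open>Alon--Tarsi operations\<close>

locale sgraph =
  fixes adj :: "'a \<Rightarrow> 'a \<Rightarrow> bool"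
  assumes adj_sym: "adj a b \<Longrightarrow> adj b a"
    and adj_irrefl: "\<not> adj a a"
    and finite_nbrs: "finite {w. adj v w}"
begin

definition dg :: "'a \<Rightarrow> 'a set \<Rightarrow> nat" where
  "dg v S = card {w \<in> S. adj v w}"

text \<open>Each edge is listed in one direction only. Which one is immaterial: by
  \<open>gcoeff_flip\<close> it affects coefficients only by a sign.\<close>

definition edge_list :: "'a set \<Rightarrow> ('a \<times> 'a) list \<Rightarrow> bool" where
  "edge_list S es \<longleftrightarrow> distinct es \<and> (\<forall>(a, b)\<in>set es. a \<in> S \<and> b \<in> S \<and> adj a b) \<and>
     (\<forall>a\<in>S. \<forall>b\<in>S. adj a b \<longrightarrow> ((a, b) \<in> set es \<longleftrightarrow> (b, a) \<notin> set es))"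

text \<open>The subgraph induced by \<open>S\<close> is \<open>f\<close>-AT for \<open>f = 3 - g\<close>. Working with the deficiency \<open>g\<close>
  instead of \<open>f\<close> avoids subtraction: an edge oriented out of \<open>v\<close> adds \<open>1\<close> to \<open>g v\<close>.\<close>

definition AT :: "'a set \<Rightarrow> ('a \<Rightarrow> nat) \<Rightarrow> bool" where
  "AT S g \<longleftrightarrow> (\<exists>es m. edge_list S es \<and> gcoeff es m \<noteq> 0 \<and> (\<forall>v\<in>S. m v + g v \<le> 2))"

lemma finite_adj: "finite {w \<in> S. adj v w}"
  using finite_nbrs[of v] by (rule rev_finite_subset) auto

lemma adj_commute: "adj a b \<longleftrightarrow> adj b a"
  using adj_sym by blast

lemma dg_empty [simp]: "dg v {} = 0"
  by (simp add: dg_def)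

lemma dg_insert: "u \<notin> S \<Longrightarrow> dg v (insert u S) = (if adj v u then 1 else 0) + dg v S"
proof -
  assume "u \<notin> S"
  moreover have "{w \<in> insert u S. adj v w} =
      (if adj v u then insert u {w \<in> S. adj v w} else {w \<in> S. adj v w})" by auto
  ultimately show ?thesis using finite_adj[of S v] by (simp add: dg_def)
qed

lemma dg_Un_disjoint: "S \<inter> T = {} \<Longrightarrow> dg v (S \<union> T) = dg v S + dg v T"
proof -
  assume "S \<inter> T = {}"
  moreover have "{w \<in> S \<union> T. adj v w} = {w \<in> S. adj v w} \<union> {w \<in> T. adj v w}" by auto
  ultimately show ?thesis
    using finite_adj[of S v] finite_adj[of T v]
    by (simp add: dg_def) (subst card_Un_disjoint, auto)
qed

lemma dg_split: "S \<subseteq> W \<Longrightarrow> dg v W = dg v S + dg v (W - S)"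
  using dg_Un_disjoint[of S "W - S" v] by (simp add: Un_absorb1)

lemma dg_remove: "u \<in> W \<Longrightarrow> dg v W = dg v (W - {u}) + (if adj v u then 1 else 0)"
  using dg_insert[of u "W - {u}" v] by (simp add: insert_absorb)

lemma dg_mono: "S \<subseteq> W \<Longrightarrow> dg v S \<le> dg v W"
  using dg_split[of S W v] by simp

lemma dg_eq_0_iff: "dg v S = 0 \<longleftrightarrow> (\<forall>w\<in>S. \<not> adj v w)"
  using finite_adj[of S v] by (auto simp: dg_def)

lemma dg_pos_iff: "0 < dg v S \<longleftrightarrow> (\<exists>w\<in>S. adj v w)"
  using dg_eq_0_iff[of v S] by auto

lemma dg_singleton [simp]: "dg v {u} = (if adj v u then 1 else 0)"
  using dg_insert[of u "{}" v] by simp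

lemma AT_cong: "(\<And>v. v \<in> S \<Longrightarrow> g v = g' v) \<Longrightarrow> AT S g \<longleftrightarrow> AT S g'"
  by (simp add: AT_def)

lemma AT_empty [simp]: "AT {} g"
  unfolding AT_def by (intro exI[of _ "[]"] exI[of _ "\<lambda>_. 0"]) (simp add: edge_list_def)

lemma AT_singleton: "g v \<le> 2 \<Longrightarrow> AT {v} g"
  unfolding AT_def
  by (intro exI[of _ "[]"] exI[of _ "\<lambda>_. 0"]) (simp add: edge_list_def adj_irrefl)

lemma edge_list_subset: "edge_list S es \<Longrightarrow> set es \<subseteq> S \<times> S"
  by (auto simp: edge_list_def)

lemma out_count_cross:
  assumes "distinct cr" "set cr = {(t, s). t \<in> T \<and> s \<in> S \<and> adj t s}"
  shows "out_count cr v = (if v \<in> T then dg v S else 0)"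
proof -
  have "out_count cr v = card {e \<in> set cr. fst e = v}"
    using distinct_card[OF distinct_filter[OF assms(1)], of "\<lambda>e. fst e = v"]
    by (simp add: out_count_def)
  also have "{e \<in> set cr. fst e = v} = (if v \<in> T then Pair v ` {s \<in> S. adj v s} else {})"
    unfolding assms(2) by auto
  also have "card \<dots> = (if v \<in> T then dg v S else 0)"
    by (simp add: dg_def card_image inj_on_def)
  finally show ?thesis .
qed

lemma obtain_cross:
  assumes "finite T" "finite S"
  obtains cr where "distinct cr" "set cr = {(t, s). t \<in> T \<and> s \<in> S \<and> adj t s}"
proof -
  have "finite {(t, s). t \<in> T \<and> s \<in> S \<and> adj t s}"
    by (rule finite_subset[of _ "T \<times> S"]) (use assms in auto)
  then show ?thesis using finite_distinct_list that by blast
qed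

text \<open>Orienting all edges between the two parts towards \<open>S\<close>.\<close>

lemma AT_compose:
  assumes W: "finite W" "S \<subseteq> W" and S: "AT S g" and T: "AT (W - S) (\<lambda>w. g w + dg w S)"
  shows "AT W g"
proof -
  let ?T = "W - S"
  have fin: "finite S" "finite ?T" using W finite_subset by auto
  obtain es1 m1 where 1: "edge_list S es1" "gcoeff es1 m1 \<noteq> 0" "\<And>v. v \<in> S \<Longrightarrow> m1 v + g v \<le> 2"
    using S by (auto simp: AT_def)
  obtain es2 m2 where 2: "edge_list ?T es2" "gcoeff es2 m2 \<noteq> 0"
    "\<And>v. v \<in> ?T \<Longrightarrow> m2 v + (g v + dg v S) \<le> 2"
    using T unfolding AT_def by blast
  have m1: "m1 v = 0" if "v \<notin> S" for v
    using gcoeff_support[OF 1(2) edge_list_subset[OF 1(1)] that] .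
  have m2: "m2 v = 0" if "v \<notin> ?T" for v
    using gcoeff_support[OF 2(2) edge_list_subset[OF 2(1)] that] .
  obtain cr where cr: "distinct cr" "set cr = {(t, s). t \<in> ?T \<and> s \<in> S \<and> adj t s}"
    using obtain_cross[OF fin(2,1)] by blast
  let ?m = "\<lambda>v. m1 v + m2 v"
  \<comment> \<open>The exponents of \<open>?m\<close> on \<open>?T\<close> already use up the full
    degree \<open>length es2\<close> available there, so every cross factor is forced to contribute
    its end in \<open>?T\<close>.\<close>
  have "filter (\<lambda>e. fst e \<in> ?T \<or> snd e \<in> ?T) es1 = []"
    using edge_list_subset[OF 1(1)] by (auto simp: filter_empty_conv)
  then have "length (filter (\<lambda>e. fst e \<in> ?T \<or> snd e \<in> ?T) (es1 @ es2)) \<le> length es2"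
    by (simp del: filter_False)
  also have "\<dots> = (\<Sum>v\<in>?T. m2 v)"
    using gcoeff_degree_eq[OF fin(2) 2(2) edge_list_subset[OF 2(1)]] by simp
  also have "\<dots> = (\<Sum>v\<in>?T. ?m v)"
    by (rule sum.cong) (use m1 in auto)
  finally have "gcoeff (cr @ (es1 @ es2)) (\<lambda>v. ?m v + out_count cr v) = gcoeff (es1 @ es2) ?m"
    by (intro gcoeff_append_cross[OF fin(2)]) (auto simp: cr)
  also have "\<dots> = gcoeff es1 m1 * gcoeff es2 m2"
    by (rule gcoeff_append_disjoint[OF edge_list_subset[OF 2(1)] _ edge_list_subset[OF 1(1)] m1 m2])
      auto
  finally have nz: "gcoeff (cr @ (es1 @ es2)) (\<lambda>v. ?m v + out_count cr v) \<noteq> 0"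
    using 1(2) 2(2) by simp
  have bd: "?m v + out_count cr v + g v \<le> 2" if "v \<in> W" for v
    using 1(3)[of v] 2(3)[of v] m1[of v] m2[of v] that
    by (cases "v \<in> S") (auto simp: out_count_cross[OF cr])
  have el1: "distinct es1" "(a, b) \<in> set es1 \<Longrightarrow> a \<in> S \<and> b \<in> S \<and> adj a b"
    "a \<in> S \<Longrightarrow> b \<in> S \<Longrightarrow> adj a b \<Longrightarrow> (a, b) \<in> set es1 \<longleftrightarrow> (b, a) \<notin> set es1" for a b
    using 1(1) unfolding edge_list_def by blast+
  have el2: "distinct es2" "(a, b) \<in> set es2 \<Longrightarrow> a \<in> ?T \<and> b \<in> ?T \<and> adj a b"
    "a \<in> ?T \<Longrightarrow> b \<in> ?T \<Longrightarrow> adj a b \<Longrightarrow> (a, b) \<in> set es2 \<longleftrightarrow> (b, a) \<notin> set es2" for a b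
    using 2(1) unfolding edge_list_def by blast+
  have "edge_list W (cr @ (es1 @ es2))"
    unfolding edge_list_def
  proof (intro conjI ballI impI)
    show "distinct (cr @ es1 @ es2)"
      unfolding distinct_append set_append using cr(1) el1(1) el2(1)
      by (auto simp: cr(2) dest: el1(2) el2(2))
    show "case e of (a, b) \<Rightarrow> a \<in> W \<and> b \<in> W \<and> adj a b" if "e \<in> set (cr @ es1 @ es2)" for e
      using that W(2) unfolding set_append
      by (cases e) (auto simp: cr(2) dest: el1(2) el2(2))
    fix a b assume ab: "a \<in> W" "b \<in> W" "adj a b"
    have "(c, d) \<in> set (cr @ es1 @ es2) \<longleftrightarrow> (if c \<in> S then (if d \<in> S then (c, d) \<in> set es1 else False)
       else (if d \<in> S then True else (c, d) \<in> set es2))" if "c \<in> W" "d \<in> W" "adj c d" for c d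
      using that unfolding set_append by (auto simp: cr(2) dest: el1(2) el2(2))
    from this[OF ab] this[OF ab(2,1) adj_sym[OF ab(3)]]
    show "(a, b) \<in> set (cr @ es1 @ es2) \<longleftrightarrow> (b, a) \<notin> set (cr @ es1 @ es2)"
      using el1(3)[of a b] el2(3)[of a b] ab by (auto split: if_splits)
  qed
  then show ?thesis using nz bd unfolding AT_def by blast
qed

text \<open>All edges at \<open>v\<close> are oriented away from it, so its neighbours pay nothing;
  this corresponds to colouring \<open>v\<close> last.\<close>

lemma AT_source:
  assumes "finite W" "v \<in> W" "dg v W + g v \<le> 2" "AT (W - {v}) g"
  shows "AT W g"
proof (rule AT_compose[of W "W - {v}"])
  have "W - (W - {v}) = {v}" using assms by auto
  moreover have "dg v (W - {v}) \<le> dg v W" by (rule dg_mono) auto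
  ultimately show "AT (W - (W - {v})) (\<lambda>w. g w + dg w (W - {v}))"
    using AT_singleton[of "\<lambda>w. g w + dg w (W - {v})" v] assms(3) by simp
qed (use assms in auto)

lemma AT_sink:
  assumes "finite W" "v \<in> W" "g v \<le> 2" "AT (W - {v}) (\<lambda>w. g w + (if adj w v then 1 else 0))"
  shows "AT W g"
  by (rule AT_compose[of W "{v}"]) (use assms AT_singleton in auto)

text \<open>Removing sources one at a time, beginning with \<open>p\<close>, has to get stuck, and a
  smallest non-AT subset of \<open>W - {p}\<close> is a place where it does.\<close>

lemma not_AT_core:
  assumes "finite W" "p \<in> W" "dg p W + g p \<le> 2" "\<not> AT W g"
  obtains R where "R \<subseteq> W - {p}" "R \<noteq> {}" "\<not> AT R g" "\<And>r. r \<in> R \<Longrightarrow> 3 \<le> dg r R + g r"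
proof -
  have "\<not> AT (W - {p}) g" using AT_source assms by blast
  then have "W - {p} \<subseteq> W - {p} \<and> \<not> AT (W - {p}) g" by simp
  from ex_has_least_nat[of "\<lambda>R. R \<subseteq> W - {p} \<and> \<not> AT R g", OF this, of card]
  obtain R where R: "R \<subseteq> W - {p}" "\<not> AT R g"
    and min: "\<And>R'. R' \<subseteq> W - {p} \<Longrightarrow> \<not> AT R' g \<Longrightarrow> card R \<le> card R'"
    by auto
  have fin: "finite R" using R(1) assms(1) finite_subset by blast
  have "3 \<le> dg r R + g r" if "r \<in> R" for r
  proof (rule ccontr)
    assume "\<not> 3 \<le> dg r R + g r"
    then have "\<not> AT (R - {r}) g" using AT_source[OF fin that, of g] R(2) by linarith
    then have "card R \<le> card (R - {r})" using R(1) by (intro min) auto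
    then show False using that fin by (metis card_Diff1_less not_less)
  qed
  moreover have "R \<noteq> {}" using R(2) by auto
  ultimately show ?thesis using that R by blast
qed

text \<open>The counterpart for orientations of colouring \<open>q\<close> with a colour that is missing from the
  shorter list of its neighbour \<open>p\<close>: the edge \<open>pq\<close> imposes no condition any more.\<close>

lemma AT_delete_larger:
  assumes W: "finite W" and pq: "p \<in> W" "q \<in> W" "adj p q" and less: "g q < g p"
    and del: "AT (W - {q}) (\<lambda>w. g w + (if adj w q \<and> w \<noteq> p then 1 else 0))"
  shows "AT W g"
proof -
  let ?T = "W - {q}" and ?N = "{w \<in> W. adj w q \<and> w \<noteq> p}"
  obtain es m where es: "edge_list ?T es" "gcoeff es m \<noteq> 0"
    "\<And>v. v \<in> ?T \<Longrightarrow> m v + (g v + (if adj v q \<and> v \<noteq> p then 1 else 0)) \<le> 2"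
    using del unfolding AT_def by blast
  have pneq: "p \<noteq> q" using pq(3) adj_irrefl by auto
  have m: "m v = 0" if "v \<notin> ?T" for v
    using gcoeff_support[OF es(2) edge_list_subset[OF es(1)] that] .
  have finT: "finite ?T" using W by auto
  have "finite ((\<lambda>w. (w, q)) ` ?N)" using W by auto
  from finite_distinct_list[OF this]
  obtain cr where cr: "distinct cr" "set cr = (\<lambda>w. (w, q)) ` ?N" by metis
  have oc: "out_count cr v = (if v \<in> ?N then 1 else 0)" for v
  proof -
    have "out_count cr v = card {e \<in> set cr. fst e = v}"
      using distinct_card[OF distinct_filter[OF cr(1)], of "\<lambda>e. fst e = v"]
      by (simp add: out_count_def)
    also have "{e \<in> set cr. fst e = v} = (if v \<in> ?N then {(v, q)} else {})"
      unfolding cr(2) by auto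
    finally show ?thesis by simp
  qed
  define M where "M = (\<lambda>v. m v + out_count cr v)"
  \<comment> \<open>Everything except the edge \<open>pq\<close>: all other edges at
    \<open>q\<close> point to \<open>q\<close>.\<close>
  let ?bs = "cr @ es"
  have "length (filter (\<lambda>e. fst e \<in> ?T \<or> snd e \<in> ?T) es) \<le> (\<Sum>v\<in>?T. m v)"
    using gcoeff_degree_eq[OF finT es(2) edge_list_subset[OF es(1)]] by simp
  then have "gcoeff ?bs M = gcoeff es m"
    unfolding M_def by (rule gcoeff_append_cross[OF finT]) (use cr(2) adj_irrefl in auto)
  then have nz: "gcoeff ?bs M \<noteq> 0" using es(2) by simp
  have Mq: "M q = 0" using m[of q] oc[of q] adj_irrefl by (simp add: M_def)
  have Mp: "M p + g p \<le> 2" using es(3)[of p] oc[of p] pq pneq by (simp add: M_def)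
  \<comment> \<open>Exponent is moved from \<open>p\<close> to \<open>q\<close> as far as the
    coefficient stays nonzero. For the largest such \<open>J\<close> the exponents \<open>N\<close>
    can arise from the factor \<open>x_q - x_p\<close> only through \<open>x_q\<close>: the other
    choice would be a transfer of \<open>J + 1\<close>.\<close>
  let ?P = "\<lambda>j. j \<le> M p \<and> gcoeff ?bs (M(q := j, p := M p - j)) \<noteq> 0"
  have P0: "?P 0" using nz Mq pneq by (metis diff_zero fun_upd_triv zero_le)
  define J where "J = (GREATEST j. ?P j)"
  have J: "?P J" "\<And>j. ?P j \<Longrightarrow> j \<le> J"
    unfolding J_def
    using GreatestI_nat[of ?P 0 "M p"] Greatest_le_nat[of ?P _ "M p"] P0 by blast+
  define N where "N = M(q := Suc J, p := M p - J)"
  have "gcoeff ((q, p) # ?bs) N = gcoeff ?bs (M(q := J, p := M p - J))"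
  proof -
    have "N(q := N q - 1) = M(q := J, p := M p - J)"
      using pneq by (auto simp: N_def fun_eq_iff)
    moreover have "gcoeff ?bs (N(p := N p - 1)) = 0" if "0 < N p"
    proof (rule ccontr)
      assume "gcoeff ?bs (N(p := N p - 1)) \<noteq> 0"
      moreover have "N(p := N p - 1) = M(q := Suc J, p := M p - Suc J)"
        by (auto simp: N_def fun_eq_iff)
      ultimately have "?P (Suc J)" using that by (simp add: N_def)
      then show False using J(2) by force
    qed
    moreover have "0 < N q" using pneq by (simp add: N_def)
    ultimately show ?thesis by (simp del: fun_upd_apply)
  qed
  then have "gcoeff ((q, p) # ?bs) N \<noteq> 0" using J(1) by simp
  moreover have "N v + g v \<le> 2" if "v \<in> W" for v
  proof -
    consider "v = p" | "v = q" | "v \<noteq> p" "v \<noteq> q" by blast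
    then show ?thesis
    proof cases
      case 1
      then show ?thesis using Mp J(1) by (simp add: N_def)
    next
      \<comment> \<open>\<open>J + 1 + g q <= M p + g p <= 2\<close>, where \<open>g q < g p\<close>
        pays for the additional unit.\<close>
      case 2
      then show ?thesis using Mp J(1) less pneq by (simp add: N_def)
    next
      case 3
      then show ?thesis using es(3)[of v] that oc[of v] by (simp add: N_def M_def)
    qed
  qed
  moreover have "edge_list W ((q, p) # ?bs)"
  proof -
    have el: "distinct es" "(a, b) \<in> set es \<Longrightarrow> a \<in> ?T \<and> b \<in> ?T \<and> adj a b"
      "a \<in> ?T \<Longrightarrow> b \<in> ?T \<Longrightarrow> adj a b \<Longrightarrow> (a, b) \<in> set es \<longleftrightarrow> (b, a) \<notin> set es" for a b
      using es(1) unfolding edge_list_def by blast+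
    show ?thesis
      unfolding edge_list_def
    proof (intro conjI ballI impI)
      show "distinct ((q, p) # ?bs)"
        unfolding distinct.simps distinct_append set_append using cr(1) el(1) pneq
        by (auto simp: cr(2) dest: el(2))
      show "case e of (a, b) \<Rightarrow> a \<in> W \<and> b \<in> W \<and> adj a b" if "e \<in> set ((q, p) # ?bs)" for e
        using that pq adj_sym[OF pq(3)] unfolding list.set set_append
        by (cases e) (auto simp: cr(2) dest: el(2))
      fix a b assume ab: "a \<in> W" "b \<in> W" "adj a b"
      have "(c, d) \<in> set ((q, p) # ?bs) \<longleftrightarrow> (if c = q then d = p
         else (if d = q then c \<noteq> p else (c, d) \<in> set es))" if "c \<in> W" "d \<in> W" "adj c d" for c d
        using that pneq adj_irrefl unfolding list.set set_append
        by (auto simp: cr(2) dest: el(2))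
      from this[OF ab] this[OF ab(2,1) adj_sym[OF ab(3)]]
      show "(a, b) \<in> set ((q, p) # ?bs) \<longleftrightarrow> (b, a) \<notin> set ((q, p) # ?bs)"
        using el(3)[of a b] ab pneq adj_irrefl by (auto split: if_splits)
    qed
  qed
  ultimately show ?thesis unfolding AT_def by blast
qed

text \<open>For disjoint sets this counts the edges between them; \<open>ee S S\<close> is a degree
  sum and counts every edge inside \<open>S\<close> twice.\<close>

definition ee :: "'a set \<Rightarrow> 'a set \<Rightarrow> nat" where
  "ee S T = (\<Sum>s\<in>S. dg s T)"

definition coloring :: "'a set \<Rightarrow> ('a \<Rightarrow> nat) \<Rightarrow> bool" where
  "coloring W \<phi> \<longleftrightarrow> (\<forall>v\<in>W. \<phi> v \<in> {0, 1, 2}) \<and> (\<forall>u\<in>W. \<forall>v\<in>W. adj u v \<longrightarrow> \<phi> u \<noteq> \<phi> v)"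

definition unblocked :: "'a set \<Rightarrow> 'a set \<Rightarrow> bool" where
  "unblocked W Y \<longleftrightarrow> (\<exists>\<phi>. coloring W \<phi> \<and> card (\<phi> ` Y) \<noteq> 3) \<and> (\<exists>\<phi>. coloring W \<phi> \<and> card (\<phi> ` Y) \<noteq> 1)"

lemma coloring_subset: "coloring W \<phi> \<Longrightarrow> S \<subseteq> W \<Longrightarrow> coloring S \<phi>"
  unfolding coloring_def by blast

lemma unblocked_subset: "unblocked W Y \<Longrightarrow> S \<subseteq> W \<Longrightarrow> unblocked S Y"
  unfolding unblocked_def using coloring_subset by blast

lemma dg_eq_sum: "finite T \<Longrightarrow> dg v T = (\<Sum>w\<in>T. if adj v w then 1 else 0)"
  by (simp add: dg_def sum.If_cases Int_def)

lemma ee_commute: "finite S \<Longrightarrow> finite T \<Longrightarrow> ee S T = ee T S"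
  unfolding ee_def
  by (simp add: dg_eq_sum) (subst sum.swap, simp add: adj_commute)

lemma ee_empty [simp]: "ee {} T = 0" "ee S {} = 0"
  by (simp_all add: ee_def)

lemma ee_singleton [simp]: "ee {v} T = dg v T"
  by (simp add: ee_def)

lemma ee_singleton_right: "finite S \<Longrightarrow> ee S {v} = dg v S"
  using ee_commute[of S "{v}"] by simp

lemma ee_Un_left: "finite S \<Longrightarrow> finite T \<Longrightarrow> S \<inter> T = {} \<Longrightarrow> ee (S \<union> T) U = ee S U + ee T U"
  by (simp add: ee_def sum.union_disjoint)

lemma ee_Un_right: "T \<inter> U = {} \<Longrightarrow> ee S (T \<union> U) = ee S T + ee S U"
  by (simp add: ee_def dg_Un_disjoint sum.distrib)

lemma ee_eq_0_iff: "finite S \<Longrightarrow> ee S T = 0 \<longleftrightarrow> (\<forall>s\<in>S. \<forall>t\<in>T. \<not> adj s t)"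
  by (simp add: ee_def dg_eq_0_iff)

lemma ee_insert_self:
  assumes "finite S" "v \<notin> S"
  shows "ee (insert v S) (insert v S) = ee S S + 2 * dg v S"
proof -
  have "ee (insert v S) (insert v S) = dg v (insert v S) + ee S (insert v S)"
    using assms by (simp add: ee_def)
  moreover have "dg v (insert v S) = dg v S"
    using dg_insert[OF assms(2), of v] adj_irrefl by simp
  moreover have "ee S (insert v S) = ee S {v} + ee S S"
    using ee_Un_right[of "{v}" S S] assms by simp
  ultimately show ?thesis using ee_singleton_right[OF assms(1)] by simp
qed

lemma even_ee_self: "finite S \<Longrightarrow> even (ee S S)"
  by (induction S rule: finite_induct) (simp_all add: ee_insert_self)

lemma dg_less_card: "finite W \<Longrightarrow> v \<in> W \<Longrightarrow> dg v W < card W"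
proof -
  assume "finite W" "v \<in> W"
  moreover have "{w \<in> W. adj v w} \<subset> W" using \<open>v \<in> W\<close> adj_irrefl by blast
  ultimately show ?thesis unfolding dg_def by (intro psubset_card_mono)
qed

lemma nbrs_eqI:
  assumes "dg v W \<le> card A" "A \<subseteq> W" "\<And>a. a \<in> A \<Longrightarrow> adj v a" "finite A"
  shows "{w \<in> W. adj v w} = A"
proof -
  have "A \<subseteq> {w \<in> W. adj v w}" using assms by auto
  from card_seteq[OF finite_adj this] assms(1) show ?thesis by (simp add: dg_def)
qed

text \<open>Deleting \<open>q\<close> costs \<open>p\<close> nothing but lowers its degree, so
  \<open>p\<close> becomes a source and the removal of sources can start. In the last conclusion the
  excess of \<open>r\<close> has to pay for each of its neighbours among the removed vertices; with
  excess 0 there are none.\<close>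

lemma not_AT_delete_larger:
  assumes "finite W" "p \<in> W" "q \<in> W" "adj p q" "g q < g p" "dg p W + g p \<le> 3" "\<not> AT W g"
  obtains R where "R \<subseteq> W - {p, q}" "R \<noteq> {}" "\<not> AT R (\<lambda>w. g w + (if adj w q then 1 else 0))"
    "\<And>r. r \<in> R \<Longrightarrow> dg r (W - {q} - R) + 3 \<le> dg r W + g r"
proof -
  let ?g = "\<lambda>w. g w + (if adj w q \<and> w \<noteq> p then 1 else 0)"
  have pq: "p \<noteq> q" using assms(4) adj_irrefl by auto
  have n: "\<not> AT (W - {q}) ?g" using AT_delete_larger assms by blast
  have d: "dg p (W - {q}) + ?g p \<le> 2"
    using assms(6) dg_remove[OF assms(3), of p] assms(4) by simp
  obtain R where R: "R \<subseteq> W - {q} - {p}" "R \<noteq> {}" "\<not> AT R ?g"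
    "\<And>r. r \<in> R \<Longrightarrow> 3 \<le> dg r R + ?g r"
    using not_AT_core[OF _ _ d n] assms(1,2) pq by blast
  have "\<not> AT R (\<lambda>w. g w + (if adj w q then 1 else 0))"
    using R(3) by (subst AT_cong[of R _ ?g]) (use R(1) in auto)
  moreover have "dg r (W - {q} - R) + 3 \<le> dg r W + g r" if "r \<in> R" for r
  proof -
    have "dg r W = dg r R + dg r (W - {q} - R) + (if adj r q then 1 else 0)"
      using dg_remove[OF assms(3), of r] dg_split[of R "W - {q}" r] R(1) by auto
    then show ?thesis using R(4)[OF that] by (auto split: if_splits)
  qed
  ultimately show ?thesis using that[of R] R(1,2) by blast
qed

section \<open>Three explicit graphs: K4 minus an edge and the prism minus an edge\<close>

lemma zero_fun_upd: "(\<lambda>_. 0)(a := 0) = (\<lambda>_. 0::nat)"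
  by auto

lemma edge_listI:
  assumes "distinct es" "\<And>a b. a \<in> S \<Longrightarrow> b \<in> S \<Longrightarrow> adj a b \<longleftrightarrow> (a, b) \<in> set es \<or> (b, a) \<in> set es"
    "\<And>a b. (a, b) \<in> set es \<Longrightarrow> a \<in> S \<and> b \<in> S \<and> (b, a) \<notin> set es"
  shows "edge_list S es"
  unfolding edge_list_def using assms by blast

text \<open>K4 minus the edge \<open>xy\<close>.\<close>

lemma AT_diamond:
  assumes V: "V = {x, y, h, v}" and d: "distinct [x, y, h, v]"
    and N: "{u \<in> V. adj x u} = {h, v}" "{u \<in> V. adj y u} = {h, v}" "{u \<in> V. adj h u} = {x, y, v}"
      "{u \<in> V. adj v u} = {x, y, h}"
    and g: "g x \<le> 1" "g y \<le> 1" "g h \<le> 1" "g v = 0"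
  shows "AT V g"
proof -
  let ?es = "[(x, h), (x, v), (y, h), (y, v), (v, h)]"
  \<comment> \<open>For \<open>g x = g y = g h = 1\<close> the budget \<open>2 - g\<close> has total
    5, the number of edges, so this exponent vector is the only candidate.\<close>
  let ?m = "(\<lambda>_. 0)(x := 1, y := 1, h := 1, v := 2::nat)"
  have d': "x \<noteq> y" "x \<noteq> h" "x \<noteq> v" "y \<noteq> h" "y \<noteq> v"
    "h \<noteq> v"
    using d by auto
  have "edge_list V ?es"
  proof (rule edge_listI)
    show "distinct ?es" using d' by simp
    fix a b
    show "a \<in> V \<and> b \<in> V \<and> (b, a) \<notin> set ?es" if "(a, b) \<in> set ?es"
      using d' that by (auto simp: V)
    assume "a \<in> V" and b: "b \<in> V"
    then consider "a = x" | "a = y" | "a = h" | "a = v"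
      using V by blast
    then show "adj a b \<longleftrightarrow> (a, b) \<in> set ?es \<or> (b, a) \<in> set ?es"
    proof cases
      case 1
      then show ?thesis using set_eq_iff[THEN iffD1, OF N(1), rule_format, of b] b d' by auto
    next
      case 2
      then show ?thesis using set_eq_iff[THEN iffD1, OF N(2), rule_format, of b] b d' by auto
    next
      case 3
      then show ?thesis using set_eq_iff[THEN iffD1, OF N(3), rule_format, of b] b d' by auto
    next
      case 4
      then show ?thesis using set_eq_iff[THEN iffD1, OF N(4), rule_format, of b] b d' by auto
    qed
  qed
  moreover have "gcoeff ?es ?m \<noteq> 0"
    by (simp add: d' d'[symmetric] zero_fun_upd)
  moreover have "\<forall>u\<in>V. ?m u + g u \<le> 2"
    using d' g by (auto simp: V)
  ultimately show ?thesis unfolding AT_def by blast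
qed

text \<open>The prism with triangles \<open>x h v\<close> and \<open>y k w\<close>, with the edge
  \<open>xy\<close> between the triangles missing.\<close>

lemma AT_prism_minus_edge:
  assumes V: "V = {x, h, v, k, w, y}" and d: "distinct [x, h, v, k, w, y]"
    and N: "{u \<in> V. adj x u} = {h, v}" "{u \<in> V. adj h u} = {x, v, k}" "{u \<in> V. adj v u} = {x, h, w}"
      "{u \<in> V. adj y u} = {w, k}" "{u \<in> V. adj w u} = {v, y, k}" "{u \<in> V. adj k u} = {h, y, w}"
    and g: "g x \<le> 1" "g y \<le> 1" "g h \<le> 1" "g v = 0" "g w = 0" "g k = 0"
  shows "AT V g"
proof -
  let ?es = "[(h, x), (h, v), (x, v), (h, k), (v, w), (w, y), (w, k), (y, k)]"
  \<comment> \<open>For \<open>g x = g y = g h = 1\<close> the budget is 9 for 8 edges; the spare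
    unit is left at \<open>y\<close>.\<close>
  let ?m = "(\<lambda>_. 0)(x := 1, h := 1, v := 2, w := 2, k := 2::nat)"
  have d': "x \<noteq> h" "x \<noteq> v" "x \<noteq> k" "x \<noteq> w" "x \<noteq> y"
    "h \<noteq> v" "h \<noteq> k" "h \<noteq> w" "h \<noteq> y" "v \<noteq> k"
    "v \<noteq> w" "v \<noteq> y" "k \<noteq> w" "k \<noteq> y" "w \<noteq> y"
    using d by auto
  have "edge_list V ?es"
  proof (rule edge_listI)
    show "distinct ?es" using d' by simp
    fix a b
    show "a \<in> V \<and> b \<in> V \<and> (b, a) \<notin> set ?es" if "(a, b) \<in> set ?es"
      using d' that by (auto simp: V)
    assume "a \<in> V" and b: "b \<in> V"
    then consider "a = x" | "a = h" | "a = v" | "a = k" | "a = w" | "a = y"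
      using V by blast
    then show "adj a b \<longleftrightarrow> (a, b) \<in> set ?es \<or> (b, a) \<in> set ?es"
    proof cases
      case 1
      then show ?thesis using set_eq_iff[THEN iffD1, OF N(1), rule_format, of b] b d' by auto
    next
      case 2
      then show ?thesis using set_eq_iff[THEN iffD1, OF N(2), rule_format, of b] b d' by auto
    next
      case 3
      then show ?thesis using set_eq_iff[THEN iffD1, OF N(3), rule_format, of b] b d' by auto
    next
      case 4
      then show ?thesis using set_eq_iff[THEN iffD1, OF N(6), rule_format, of b] b d' by auto
    next
      case 5
      then show ?thesis using set_eq_iff[THEN iffD1, OF N(5), rule_format, of b] b d' by auto
    next
      case 6
      then show ?thesis using set_eq_iff[THEN iffD1, OF N(4), rule_format, of b] b d' by auto
    qed
  qed
  moreover have "gcoeff ?es ?m \<noteq> 0"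
    by (simp add: d' d'[symmetric] zero_fun_upd)
  moreover have "\<forall>u\<in>V. ?m u + g u \<le> 2"
    using d' g by (auto simp: V)
  ultimately show ?thesis unfolding AT_def by blast
qed

text \<open>The prism on \<open>x h y\<close> and \<open>v t w\<close>, with the edge
  \<open>xy\<close> of the first triangle missing.\<close>

lemma AT_triangle_path_claw:
  assumes V: "V = {x, h, v, y, w, t}" and d: "distinct [x, h, v, y, w, t]"
    and N: "{u \<in> V. adj x u} = {h, v}" "{u \<in> V. adj y u} = {h, w}" "{u \<in> V. adj h u} = {x, y, t}"
      "{u \<in> V. adj v u} = {x, w, t}" "{u \<in> V. adj w u} = {y, v, t}" "{u \<in> V. adj t u} = {h, v, w}"
    and g: "g x \<le> 1" "g y \<le> 1" "g h \<le> 1" "g v = 0" "g w = 0" "g t = 0"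
  shows "AT V g"
proof -
  let ?es = "[(x, h), (x, v), (y, h), (y, w), (h, t), (v, w), (v, t), (w, t)]"
  \<comment> \<open>Again one unit of the budget is spare, here left at \<open>w\<close>.\<close>
  let ?m = "(\<lambda>_. 0)(x := 1, y := 1, h := 1, v := 2, w := 1, t := 2::nat)"
  have d': "x \<noteq> h" "x \<noteq> v" "x \<noteq> y" "x \<noteq> w" "x \<noteq> t"
    "h \<noteq> v" "h \<noteq> y" "h \<noteq> w" "h \<noteq> t" "v \<noteq> y"
    "v \<noteq> w" "v \<noteq> t" "y \<noteq> w" "y \<noteq> t" "w \<noteq> t"
    using d by auto
  have "edge_list V ?es"
  proof (rule edge_listI)
    show "distinct ?es" using d' by simp
    fix a b
    show "a \<in> V \<and> b \<in> V \<and> (b, a) \<notin> set ?es" if "(a, b) \<in> set ?es"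
      using d' that by (auto simp: V)
    assume "a \<in> V" and b: "b \<in> V"
    then consider "a = x" | "a = h" | "a = v" | "a = y" | "a = w" | "a = t"
      using V by blast
    then show "adj a b \<longleftrightarrow> (a, b) \<in> set ?es \<or> (b, a) \<in> set ?es"
    proof cases
      case 1
      then show ?thesis using set_eq_iff[THEN iffD1, OF N(1), rule_format, of b] b d' by auto
    next
      case 2
      then show ?thesis using set_eq_iff[THEN iffD1, OF N(3), rule_format, of b] b d' by auto
    next
      case 3
      then show ?thesis using set_eq_iff[THEN iffD1, OF N(4), rule_format, of b] b d' by auto
    next
      case 4
      then show ?thesis using set_eq_iff[THEN iffD1, OF N(2), rule_format, of b] b d' by auto
    next
      case 5
      then show ?thesis using set_eq_iff[THEN iffD1, OF N(5), rule_format, of b] b d' by auto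
    next
      case 6
      then show ?thesis using set_eq_iff[THEN iffD1, OF N(6), rule_format, of b] b d' by auto
    qed
  qed
  moreover have "gcoeff ?es ?m \<noteq> 0"
    by (simp add: d' d'[symmetric] zero_fun_upd)
  moreover have "\<forall>u\<in>V. ?m u + g u \<le> 2"
    using d' g by (auto simp: V)
  ultimately show ?thesis unfolding AT_def by blast
qed

end

section \<open>Minimal counterexamples\<close>

definition ind :: "'a set \<Rightarrow> 'a \<Rightarrow> nat" where
  "ind Y v = (if v \<in> Y then 1 else 0)"

lemma sum_ind: "finite S \<Longrightarrow> sum (ind Y) S = card (Y \<inter> S)"
  by (simp add: ind_def sum.If_cases Int_commute)

definition (in sgraph) conn :: "'a set \<Rightarrow> bool" where
  "conn R \<longleftrightarrow> (\<forall>P\<subseteq>R. P \<noteq> {} \<longrightarrow> P \<noteq> R \<longrightarrow> (\<exists>p\<in>P. \<exists>q\<in>R - P. adj p q))"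

lemma (in sgraph) connD:
  assumes "conn R" "P \<subseteq> R" "P \<noteq> {}" "P \<noteq> R"
  obtains p q where "p \<in> P" "q \<in> R" "q \<notin> P" "adj p q"
  using assms unfolding conn_def by blast

text \<open>Minimality speaks about all deficient sets \<open>Y\<close> of all smaller induced
  subgraphs, because charging neighbours moves deficiency away from \<open>X\<close>.\<close>

locale minimal_counterexample = sgraph adj for adj :: "'a \<Rightarrow> 'a \<Rightarrow> bool" +
  fixes V X :: "'a set"
  assumes finite_V: "finite V"
    and X_subset: "X \<subseteq> V"
    and card_X: "card X \<le> 3"
    and unblocked_X: "card X = 3 \<Longrightarrow> unblocked V X"
    and sparse: "V \<noteq> {} \<Longrightarrow> 5 * ee V V < 14 * card V"
    and minimal: "\<And>W Y. W \<subset> V \<Longrightarrow> Y \<subseteq> W \<Longrightarrow> card Y \<le> 3 \<Longrightarrow> (card Y = 3 \<Longrightarrow> unblocked W Y) \<Longrightarrow> AT W (ind Y)"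
    and not_AT: "\<not> AT V (ind X)"
begin

definition cut :: "'a set \<Rightarrow> nat" where
  "cut S = ee S (V - S)"

lemma finite_sub: "S \<subseteq> V \<Longrightarrow> finite S"
  using finite_V finite_subset by blast

lemma V_nonempty: "V \<noteq> {}"
  using not_AT by auto

text \<open>Either fewer than three vertices of \<open>X\<close> survive, or all of \<open>X\<close>
  does and colourings of \<open>V\<close> restrict to \<open>W\<close>.\<close>

lemma AT_induced: "W \<subset> V \<Longrightarrow> AT W (ind X)"
proof -
  assume W: "W \<subset> V"
  have le: "card (X \<inter> W) \<le> card X"
    using finite_sub[OF X_subset] by (intro card_mono) auto
  have "AT W (ind (X \<inter> W))"
  proof (rule minimal[OF W])
    show "card (X \<inter> W) \<le> 3" using le card_X by simp
    assume "card (X \<inter> W) = 3"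
    then have "card X = 3" "X \<inter> W = X"
      using le card_X finite_sub[OF X_subset] card_seteq[of X "X \<inter> W"] by auto
    then show "unblocked W (X \<inter> W)"
      using unblocked_subset[OF unblocked_X] W by auto
  qed auto
  then show ?thesis
    by (subst AT_cong[of W _ "ind (X \<inter> W)"]) (auto simp: ind_def)
qed

text \<open>Non-blockedness is required only of three deficient vertices, so total deficiency 2 is
  harmless. A vertex of deficiency 2 is made a sink; by the degree bound this charges at most two
  neighbours.\<close>

lemma AT_deficiency_le_2:
  assumes Q: "Q \<subset> V" and le: "sum g Q \<le> 2" and deg: "\<And>v. v \<in> Q \<Longrightarrow> dg v Q + g v \<le> 4"
  shows "AT Q g"
proof -
  have fin: "finite Q" using Q finite_sub by auto
  show ?thesis
  proof (cases "\<exists>v\<in>Q. 2 \<le> g v")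
    case True
    then obtain v where v: "v \<in> Q" "2 \<le> g v" by blast
    have s: "sum g Q = g v + sum g (Q - {v})" using fin v(1) by (simp add: sum.remove)
    then have 0: "g v = 2" "sum g (Q - {v}) = 0" using le v(2) by auto
    then have 1: "g w = 0" if "w \<in> Q - {v}" for w using fin that by auto
    let ?Y = "{w \<in> Q. adj v w}"
    have "card ?Y \<le> 2" using deg[OF v(1)] 0(1) by (simp add: dg_def)
    then have "AT (Q - {v}) (ind ?Y)"
      using Q adj_irrefl by (intro minimal) auto
    then have "AT (Q - {v}) (\<lambda>w. g w + (if adj w v then 1 else 0))"
      by (subst AT_cong[of _ _ "ind ?Y"]) (use 1 in \<open>auto simp: ind_def adj_commute\<close>)
    then show ?thesis using AT_sink[OF fin v(1)] 0(1) by simp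
  next
    case False
    then have g: "g v = ind {w \<in> Q. g w = 1} v" if "v \<in> Q" for v
      using that by (force simp: ind_def not_le less_2_cases_iff)
    have "card {w \<in> Q. g w = 1} = sum (ind {w \<in> Q. g w = 1}) Q"
      using fin by (simp add: sum_ind Int_absorb2 subset_iff)
    also have "\<dots> = sum g Q" by (rule sum.cong) (use g in auto)
    finally have "AT Q (ind {w \<in> Q. g w = 1})"
      using le by (intro minimal Q) auto
    then show ?thesis by (subst AT_cong[of _ _ "ind {w \<in> Q. g w = 1}"]) (use g in auto)
  qed
qed

section \<open>Degree excess and edge boundaries\<close>

lemma dg_plus_ind_ge_3: "v \<in> V \<Longrightarrow> 3 \<le> dg v V + ind X v"
proof (rule ccontr)
  assume v: "v \<in> V" and "\<not> 3 \<le> dg v V + ind X v"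
  then show False
    using AT_source[OF finite_V v, of "ind X"] AT_induced[of "V - {v}"] not_AT by auto
qed

text \<open>The degree sum is 3|V| + excess - |X| and lies below (14/5)|V|. It is even, so both
  sides of \<open>5 * ee V V < 14 * card V\<close> are even and differ by at least 2.\<close>

lemma card_V_bound: "card V + 5 * (\<Sum>v\<in>V. dg v V + ind X v - 3) + 2 \<le> 5 * card X"
proof -
  have "(\<Sum>v\<in>V. dg v V + ind X v) = (\<Sum>v\<in>V. 3 + (dg v V + ind X v - 3))"
    by (rule sum.cong) (use dg_plus_ind_ge_3 in auto)
  then have "(\<Sum>v\<in>V. dg v V) + (\<Sum>v\<in>V. ind X v) = 3 * card V + (\<Sum>v\<in>V. dg v V + ind X v - 3)"
    by (simp only: sum.distrib) simp
  moreover have "(\<Sum>v\<in>V. ind X v) = card X"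
    using sum_ind[OF finite_V, of X] X_subset by (simp add: Int_absorb2)
  moreover obtain k where k: "(\<Sum>v\<in>V. dg v V) = 2 * k"
    using even_ee_self[OF finite_V] unfolding ee_def by (elim evenE)
  moreover have "5 * k < 7 * card V"
    using sparse[OF V_nonempty] k by (simp add: ee_def)
  ultimately show ?thesis by linarith
qed

lemma excess_le: "v \<in> V \<Longrightarrow> dg v V + ind X v - 3 \<le> (\<Sum>v\<in>V. dg v V + ind X v - 3)"
  by (rule member_le_sum) (use finite_V in auto)

text \<open>Otherwise \<open>V\<close> is a triangle, whose vertices always receive three colours,
  against \<open>unblocked_X\<close>.\<close>

lemma X_neq_V: "X \<noteq> V"
proof
  assume XV: "X = V"
  have ge: "2 \<le> dg v V" if "v \<in> V" for v using dg_plus_ind_ge_3[OF that] that by (simp add: ind_def XV)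
  obtain v where v: "v \<in> V" using V_nonempty by auto
  have "card V = 3"
    using ge[OF v] dg_less_card[OF finite_V v] card_X XV by simp
  have adj: "adj u w" if "u \<in> V" "w \<in> V" "u \<noteq> w" for u w
  proof -
    have "{w' \<in> V. adj u w'} = V - {u}"
    proof (rule card_seteq)
      show "card (V - {u}) \<le> card {w' \<in> V. adj u w'}"
        using ge[OF that(1)] \<open>card V = 3\<close> that(1) finite_V by (simp add: dg_def)
    qed (use finite_V adj_irrefl in auto)
    then show ?thesis using that by auto
  qed
  have "unblocked V X" using unblocked_X XV \<open>card V = 3\<close> by simp
  then obtain \<phi> where \<phi>: "coloring V \<phi>" "card (\<phi> ` X) \<noteq> 3" unfolding unblocked_def by blast
  have "inj_on \<phi> V" using \<phi>(1) adj unfolding inj_on_def coloring_def by blast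
  then show False using \<phi>(2) XV \<open>card V = 3\<close> card_image by metis
qed

lemma card_V_ge_4: "4 \<le> card V"
proof -
  obtain v where "v \<in> V" "v \<notin> X" using X_subset X_neq_V by blast
  then show ?thesis using dg_plus_ind_ge_3[of v] dg_less_card[OF finite_V, of v] by (simp add: ind_def)
qed

lemma excess_sum_le_1: "(\<Sum>v\<in>V. dg v V + ind X v - 3) \<le> 1"
  using card_V_bound card_V_ge_4 card_X by linarith

lemma dg_plus_ind_le_4: "v \<in> V \<Longrightarrow> dg v V + ind X v \<le> 4"
  using excess_le[of v] excess_sum_le_1 by linarith

lemma cut_compl: "S \<subseteq> V \<Longrightarrow> cut (V - S) = cut S"
  using ee_commute[of "V - S" S] finite_V finite_sub by (simp add: cut_def double_diff)

text \<open>With all boundary edges oriented out of \<open>S\<close>, the total deficiency of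
  \<open>S\<close> is \<open>cut S + card (X \<inter> S)\<close>; if it were at most 2,
  \<open>AT_deficiency_le_2\<close> would solve \<open>S\<close>.\<close>

lemma cut_plus_card_ge_3:
  assumes "S \<subseteq> V" "S \<noteq> {}" "S \<noteq> V"
  shows "3 \<le> cut S + card (X \<inter> S)"
proof (rule ccontr)
  assume n: "\<not> ?thesis"
  have fin: "finite S" using assms(1) finite_sub by auto
  have "AT S (\<lambda>w. ind X w + dg w (V - S))"
  proof (rule AT_deficiency_le_2)
    show "(\<Sum>w\<in>S. ind X w + dg w (V - S)) \<le> 2"
      using n sum_ind[OF fin, of X] by (simp add: sum.distrib cut_def ee_def)
    fix v assume "v \<in> S"
    then show "dg v S + (ind X v + dg v (V - S)) \<le> 4"
      using dg_plus_ind_le_4[of v] dg_split[OF assms(1), of v] assms(1) by auto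
  qed (use assms in auto)
  then have "AT (V - (V - S)) (\<lambda>w. ind X w + dg w (V - S))"
    using assms(1) by (simp add: double_diff)
  then show False
    using AT_compose[OF finite_V, of "V - S" "ind X"] AT_induced[of "V - S"] not_AT assms by auto
qed

lemma cut_ge_3: "S \<subseteq> V \<Longrightarrow> S \<noteq> {} \<Longrightarrow> X \<noteq> {} \<Longrightarrow> X \<inter> S = {} \<Longrightarrow> 3 \<le> cut S"
  using cut_plus_card_ge_3[of S] X_subset by auto

text \<open>Adding \<open>cut_plus_card_ge_3\<close> for \<open>S\<close> and for its complement
  gives 2 * cut + |X| >= 6, and |X| <= 3.\<close>

lemma cut_ge_2:
  assumes "S \<subseteq> V" "S \<noteq> {}" "S \<noteq> V"
  shows "2 \<le> cut S"
proof -
  have "card (X \<inter> S) + card (X \<inter> (V - S)) = card X"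
    using X_subset finite_sub[OF X_subset]
    by (subst card_Un_disjoint[symmetric]) (auto intro!: arg_cong[where f = card])
  moreover have "3 \<le> cut S + card (X \<inter> (V - S))"
    using cut_plus_card_ge_3[of "V - S"] cut_compl[OF assms(1)] assms by auto
  ultimately show ?thesis
    using cut_plus_card_ge_3[OF assms] card_X by linarith
qed

text \<open>Otherwise \<open>v\<close> is joined to \<open>P\<close> or to \<open>Q\<close> by at most one edge, contradicting \<open>cut_ge_2\<close>.\<close>

lemma not_cut_vertex:
  assumes "v \<in> V" "dg v V \<le> 3" "P \<inter> Q = {}" "P \<union> Q = V - {v}" "P \<noteq> {}" "Q \<noteq> {}"
  shows "ee P Q \<noteq> 0"
proof
  assume 0: "ee P Q = 0"
  have fin: "finite P" "finite Q" using assms(4) finite_V by (metis finite_Diff finite_Un)+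
  have v: "v \<notin> P" "v \<notin> Q" using assms(4) by auto
  have "V - P = insert v Q" "V - Q = insert v P" using assms by auto
  then have "cut P = dg v P + ee P Q" "cut Q = dg v Q + ee Q P"
    using ee_Un_right[of "{v}" Q P] ee_Un_right[of "{v}" P Q] v fin
    by (simp_all add: cut_def ee_singleton_right)
  moreover have "ee Q P = 0" using ee_commute[OF fin] 0 by simp
  moreover have "P \<subseteq> V" "Q \<subseteq> V" using assms(4) by auto
  then have "2 \<le> cut P" "2 \<le> cut Q"
    using cut_ge_2[of P] cut_ge_2[of Q] assms(1,5,6) v by blast+
  moreover have "dg v V = dg v P + dg v Q"
  proof -
    have "dg v V = dg v (V - {v})" using dg_remove[OF assms(1), of v] adj_irrefl[of v] by simp
    also have "\<dots> = dg v P + dg v Q" unfolding assms(4)[symmetric] by (rule dg_Un_disjoint[OF assms(3)])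
    finally show ?thesis .
  qed
  ultimately show False using 0 assms(2) by linarith
qed

lemma exists_high:
  obtains h where "h \<in> V" "dg h V + ind X h = 4" "\<And>v. v \<in> V \<Longrightarrow> v \<noteq> h \<Longrightarrow> dg v V + ind X v = 3"
    "card X = 3" "card V \<le> 8"
proof (cases "\<forall>v\<in>V. dg v V + ind X v = 3")
  case True
  have "X \<noteq> {}" using card_V_bound card_V_ge_4 by auto
  then have "2 \<le> cut X" using cut_ge_2[OF X_subset] X_neq_V by blast
  then have "ee X (V - X) \<noteq> 0" by (simp add: cut_def)
  then obtain u v where uv: "u \<in> X" "v \<in> V" "v \<notin> X" "adj u v"
    using ee_eq_0_iff[OF finite_sub[OF X_subset]] by auto
  obtain R where R: "R \<subseteq> V - {u, v}" "R \<noteq> {}"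
    "\<And>r. r \<in> R \<Longrightarrow> dg r (V - {v} - R) + 3 \<le> dg r V + ind X r"
  proof (rule not_AT_delete_larger[OF finite_V _ uv(2,4) _ _ not_AT])
    show "ind X v < ind X u" using uv by (simp add: ind_def)
    show "dg u V + ind X u \<le> 3" using True uv(1) X_subset by auto
  qed (use uv X_subset that in auto)
  have "dg r (V - {v} - R) = 0" if "r \<in> R" for r
    using R(3)[OF that] True R(1) that by force
  then have "ee R (V - {v} - R) = 0" by (simp add: ee_def)
  moreover have "dg v V \<le> 3" using True uv(2) by force
  ultimately show ?thesis
    using not_cut_vertex[OF uv(2), of R "V - {v} - R"] R(1,2) uv X_subset adj_irrefl by blast
next
  case False
  then obtain h where h: "h \<in> V" "dg h V + ind X h \<noteq> 3" by blast
  have h4: "dg h V + ind X h = 4"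
    using dg_plus_ind_le_4[OF h(1)] dg_plus_ind_ge_3[OF h(1)] h(2) by linarith
  have s: "(\<Sum>v\<in>V. dg v V + ind X v - 3) = 1 + (\<Sum>v\<in>V - {h}. dg v V + ind X v - 3)"
    using h(1) h4 finite_V by (simp add: sum.remove)
  then have "(\<Sum>v\<in>V - {h}. dg v V + ind X v - 3) = 0" using excess_sum_le_1 by linarith
  then have "dg v V + ind X v = 3" if "v \<in> V" "v \<noteq> h" for v
    using that finite_V dg_plus_ind_ge_3[of v] by force
  moreover have "card X = 3" "card V \<le> 8"
    using s card_V_bound card_V_ge_4 card_X by linarith+
  ultimately show ?thesis using that h(1) h4 by blast
qed

text \<open>The bridge is oriented out of \<open>P\<close>, which raises the deficiency of
  \<open>P\<close> to at most 2; both sides then fall under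
  \<open>AT_deficiency_le_2\<close>.\<close>

lemma AT_split_bridge:
  assumes R: "R \<subset> V" "\<And>w. w \<in> R \<Longrightarrow> dg w R + g w \<le> 4"
    and PQ: "P \<union> Q = R" "P \<inter> Q = {}" "Q \<noteq> {}" and bridge: "ee P Q = 1" and g: "sum g P \<le> 1" "sum g Q \<le> 2"
  shows "AT R g"
proof (rule AT_compose)
  show fin: "finite R" using R(1) finite_sub by auto
  show "Q \<subseteq> R" using PQ by auto
  show "AT Q g"
  proof (rule AT_deficiency_le_2)
    show "dg v Q + g v \<le> 4" if "v \<in> Q" for v
      using R(2)[of v] dg_mono[of Q R v] PQ that by fastforce
  qed (use R PQ g in auto)
  have "AT P (\<lambda>w. g w + dg w Q)"
  proof (rule AT_deficiency_le_2)
    show "P \<subset> V" using R PQ by auto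
    show "(\<Sum>w\<in>P. g w + dg w Q) \<le> 2" using g bridge by (simp add: sum.distrib ee_def)
    show "dg v P + (g v + dg v Q) \<le> 4" if "v \<in> P" for v
      using R(2)[of v] dg_Un_disjoint[OF PQ(2), of v] PQ that by auto
  qed
  moreover have "R - Q = P" using PQ by auto
  ultimately show "AT (R - Q) (\<lambda>w. g w + dg w Q)" by simp
qed

text \<open>Deleting a vertex \<open>q\<close> of deficiency 0 next to a deficient \<open>p\<close>
  leaves a core \<open>S\<close>, and \<open>q\<close> separates it from the rest \<open>K\<close>.
  As \<open>q\<close> has degree 3, it is joined to one of the two sides by a single edge, and
  cutting there splits the total deficiency 3 into parts of at most 1 and 2.\<close>

lemma AT_low:
  assumes R: "R \<subset> V" "conn R" and low: "\<And>w. w \<in> R \<Longrightarrow> dg w R + g w = 3" and le: "sum g R \<le> 3"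
    and w: "w1 \<in> R" "g w1 \<noteq> 1" "w2 \<in> R" "1 \<le> g w2" and le2: "\<And>w. w \<in> R \<Longrightarrow> g w \<le> 2"
  shows "AT R g"
proof (rule ccontr)
  assume not: "\<not> AT R g"
  have fin: "finite R" using R(1) finite_sub by auto
  \<comment> \<open>Otherwise \<open>w1\<close> has deficiency 2 and one neighbour \<open>a\<close>,
    which takes the last unit. But then \<open>a\<close> has degree 2, and a third vertex pushes the
    sum beyond 3.\<close>
  have "\<exists>w\<in>R. g w = 0"
  proof (rule ccontr)
    assume "\<not> ?thesis"
    then have 1: "1 \<le> g w" if "w \<in> R" for w using that by fastforce
    have "g w1 = 2" using 1[OF w(1)] w(2) le2[OF w(1)] by linarith
    then have s: "sum g R = 2 + sum g (R - {w1})" using fin w(1) by (simp add: sum.remove)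
    have dg: "dg w1 R = 1" using low[OF w(1)] \<open>g w1 = 2\<close> by simp
    then obtain a where a: "a \<in> R" "adj w1 a" using dg_pos_iff[of w1 R] by auto
    then have "a \<in> R - {w1}" using adj_irrefl by auto
    then have s': "sum g (R - {w1}) = g a + sum g (R - {w1} - {a})" using fin by (simp add: sum.remove)
    have ga: "g a = 1" using 1[OF a(1)] s s' le by linarith
    have "2 = dg a R" using low[OF a(1)] ga by simp
    then have "2 < card R" using dg_less_card[OF fin a(1)] by simp
    have "R - {w1} - {a} \<noteq> {}"
    proof
      assume "R - {w1} - {a} = {}"
      then have "R \<subseteq> {w1, a}" by blast
      then have "card R \<le> card {w1, a}" by (intro card_mono) auto
      also have "\<dots> \<le> 2" by (simp add: card_insert_if)
      finally show False using \<open>2 < card R\<close> by simp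
    qed
    then obtain b where b: "b \<in> R - {w1} - {a}" by blast
    then have "g b \<le> sum g (R - {w1} - {a})" using fin by (intro member_le_sum) auto
    then show False using 1[of b] b s s' ga le by auto
  qed
  then obtain w0 where w0: "w0 \<in> R" "g w0 = 0" by blast
  obtain p q where pq: "p \<in> R" "1 \<le> g p" "q \<in> R" "g q = 0" "adj p q"
  proof (rule connD[OF R(2), of "{w \<in> R. 1 \<le> g w}"])
    show "{w \<in> R. 1 \<le> g w} \<noteq> R" using w0 by force
    show "{w \<in> R. 1 \<le> g w} \<noteq> {}" using w(3,4) by blast
  qed (use that in \<open>auto simp: not_le\<close>)
  obtain S where S: "S \<subseteq> R - {p, q}" "S \<noteq> {}" "\<not> AT S (\<lambda>w. g w + (if adj w q then 1 else 0))"
    "\<And>r. r \<in> S \<Longrightarrow> dg r (R - {q} - S) + 3 \<le> dg r R + g r"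
    by (rule not_AT_delete_larger[OF fin pq(1,3,5) _ _ not]) (use pq low[OF pq(1)] in auto)
  define K where "K = R - {q} - S"
  have K: "p \<in> K" "K \<subseteq> R" "q \<notin> K" "K \<inter> S = {}" using S(1) pq adj_irrefl by (auto simp: K_def)
  have finS: "finite S" "finite K" using S(1) K(2) fin finite_subset by blast+
  have RS: "R - S = insert q K" using S(1) pq(3) by (auto simp: K_def)
  have "dg r K = 0" if "r \<in> S" for r
    using S(4)[OF that] low[of r] S(1) that by (auto simp: K_def)
  then have SK: "ee S K = 0" by (simp add: ee_def)
  have KS: "ee K S = 0" using ee_commute finS SK by simp
  have "dg q S + dg q K = 3"
  proof -
    have "dg q R = dg q S + dg q (insert q K)" using dg_split[of S R q] S(1) RS by auto
    then show ?thesis using dg_insert[OF K(3), of q] adj_irrefl low[OF pq(3)] pq(4) by simp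
  qed
  moreover have "1 \<le> dg q K" using dg_pos_iff[of q K] K(1) pq(5) adj_sym by (metis Suc_leI One_nat_def)
  moreover have "1 \<le> dg q S"
  proof -
    obtain a b where ab: "a \<in> S" "b \<in> R" "b \<notin> S" "adj a b"
    proof (rule connD[OF R(2), of S])
      show "S \<noteq> R" using S(1) pq by auto
    qed (use S in auto)
    have "b \<notin> K" using SK ab ee_eq_0_iff[OF finS(1)] by blast
    then have "b = q" using ab RS by blast
    then show ?thesis using dg_pos_iff[of q S] ab adj_sym by (metis Suc_leI One_nat_def)
  qed
  moreover have "3 \<le> sum g S + dg q S"
  proof (rule ccontr)
    assume n: "\<not> ?thesis"
    have "(\<Sum>w\<in>S. if adj w q then 1 else (0::nat)) = dg q S"
      using dg_eq_sum[OF finS(1), of q] by (simp add: adj_commute)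
    then have "(\<Sum>w\<in>S. g w + (if adj w q then 1 else 0)) \<le> 2"
      using n by (simp add: sum.distrib)
    moreover have "dg v S + (g v + (if adj v q then 1 else 0)) \<le> 4" if "v \<in> S" for v
      using low[of v] dg_mono[of S R v] S(1) that by force
    ultimately have "AT S (\<lambda>w. g w + (if adj w q then 1 else 0))"
      using S(1) R(1) by (intro AT_deficiency_le_2) auto
    then show False using S(3) by simp
  qed
  moreover have "1 \<le> sum g K"
    using member_le_sum[of p K g] K(1) finS(2) pq(2) by simp
  moreover have "sum g S + sum g K \<le> 3"
  proof -
    have "sum g R = sum g S + sum g (R - S)"
      using sum.subset_diff[of S R g] S(1) fin by (metis Diff_subset add.commute subset_trans)
    also have "sum g (R - S) = sum g K" using RS K(3) finS(2) pq(4) by simp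
    finally show ?thesis using le by simp
  qed
  \<comment> \<open>A core cannot be solved by \<open>AT_deficiency_le_2\<close>, so few edges from
    \<open>q\<close> to \<open>S\<close> mean much deficiency in \<open>S\<close> and hence little
    in \<open>K\<close>.\<close>
  ultimately consider "dg q S = 1" "sum g K \<le> 1" "sum g S \<le> 2"
    | "dg q K = 1" "sum g K \<le> 1" "sum g S \<le> 2" | "dg q K = 1" "sum g S \<le> 1" "sum g K \<le> 2"
    by linarith
  then have "AT R g"
  proof cases
    case 1
    show ?thesis
    proof (rule AT_split_bridge[of R g "insert q K" S])
      have "ee S (insert q K) = 1"
        using ee_Un_right[of "{q}" K S] K(3) SK 1(1) finS by (simp add: ee_singleton_right)
      then show "ee (insert q K) S = 1" using ee_commute[of S "insert q K"] finS by simp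
      show "sum g (insert q K) \<le> 1" using 1 finS K(3) pq(4) by simp
      show "insert q K \<union> S = R" "insert q K \<inter> S = {}" using RS S(1) by auto
      show "dg w R + g w \<le> 4" if "w \<in> R" for w using low[OF that] by simp
    qed (use 1 R(1) S(2) in auto)
  next
    case 2
    show ?thesis
    proof (rule AT_split_bridge[of R g K "insert q S"])
      show "ee K (insert q S) = 1"
        using ee_Un_right[of "{q}" S K] S(1) KS 2(1) finS by (auto simp: ee_singleton_right)
      show "sum g (insert q S) \<le> 2" using 2 finS S(1) pq(4) by (auto simp: sum.insert_if)
      show "K \<union> insert q S = R" using RS S(1) by auto
      show "K \<inter> insert q S = {}" using K by auto
      show "dg w R + g w \<le> 4" if "w \<in> R" for w using low[OF that] by simp
    qed (use 2 R(1) in auto)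
  next
    case 3
    show ?thesis
    proof (rule AT_split_bridge[of R g "insert q S" K])
      have "ee K (insert q S) = 1"
        using ee_Un_right[of "{q}" S K] S(1) KS 3(1) finS by (auto simp: ee_singleton_right)
      then show "ee (insert q S) K = 1" using ee_commute[of K "insert q S"] finS by simp
      show "sum g (insert q S) \<le> 1" using 3 finS S(1) pq(4) by (auto simp: sum.insert_if)
      show "insert q S \<union> K = R" using RS S(1) by auto
      show "insert q S \<inter> K = {}" using K by auto
      show "dg w R + g w \<le> 4" if "w \<in> R" for w using low[OF that] by simp
    qed (use 3 R(1) K(1) in auto)
  qed
  then show False using not by simp
qed

end

section \<open>The vertex of excess one\<close>

locale high_vertex = minimal_counterexample adj V X for adj :: "'a \<Rightarrow> 'a \<Rightarrow> bool" and V X +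
  fixes h :: 'a
  assumes h_in: "h \<in> V"
    and high: "dg h V + ind X h = 4"
    and low: "\<And>v. v \<in> V \<Longrightarrow> v \<noteq> h \<Longrightarrow> dg v V + ind X v = 3"
    and card_X_eq: "card X = 3"
    and card_V_le: "card V \<le> 8"
begin

lemma X_nonempty: "X \<noteq> {}"
  using card_X_eq by auto

lemma adj_neq: "adj a b \<Longrightarrow> a \<noteq> b"
  using adj_irrefl by auto

lemma ee_cut:
  assumes "S \<union> T = V" "S \<inter> T = {}"
  shows "cut S = ee S T"
proof -
  have "V - S = T" using assms by auto
  then show ?thesis by (simp add: cut_def)
qed

lemma nbrs2:
  assumes "dg v V = 2" "adj v a" "adj v b" "a \<noteq> b" "a \<in> V" "b \<in> V" "w \<in> V"
  shows "adj v w \<longleftrightarrow> w = a \<or> w = b"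
proof -
  have "{w \<in> V. adj v w} = {a, b}" by (rule nbrs_eqI) (use assms in auto)
  then show ?thesis using assms(7) by blast
qed

lemma nbrs3:
  assumes "dg v V = 3" "adj v a" "adj v b" "adj v c" "a \<noteq> b" "a \<noteq> c" "b \<noteq> c"
    "a \<in> V" "b \<in> V" "c \<in> V" "w \<in> V"
  shows "adj v w \<longleftrightarrow> w = a \<or> w = b \<or> w = c"
proof -
  have "{w \<in> V. adj v w} = {a, b, c}" by (rule nbrs_eqI) (use assms in auto)
  then show ?thesis using assms(11) by blast
qed

lemma second_nbr:
  assumes "2 \<le> dg v V" "a \<in> V"
  obtains b where "b \<in> V" "b \<noteq> a" "adj v b"
proof -
  have "0 < dg v (V - {a})" using dg_remove[OF assms(2), of v] assms(1) by (auto split: if_splits)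
  then show ?thesis using that unfolding dg_pos_iff by blast
qed

lemma third_nbr:
  assumes "3 \<le> dg v V" "a \<in> V" "b \<in> V" "a \<noteq> b"
  obtains c where "c \<in> V" "c \<noteq> a" "c \<noteq> b" "adj v c"
proof -
  have "dg v (V - {a}) = dg v (V - {a} - {b}) + (if adj v b then 1 else 0)"
    using assms by (intro dg_remove) auto
  then have "0 < dg v (V - {a} - {b})" using dg_remove[OF assms(2), of v] assms(1) by (auto split: if_splits)
  then show ?thesis using that unfolding dg_pos_iff by blast
qed

text \<open>The deficiency that remains once \<open>v\<close> has been made a sink.\<close>

definition del :: "'a \<Rightarrow> 'a \<Rightarrow> nat" where
  "del v w = ind X w + (if adj w v then 1 else 0)"

lemma del_le_2: "del v w \<le> 2"
  by (simp add: del_def ind_def)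

lemma sum_del:
  assumes "finite R"
  shows "sum (del v) R = card (X \<inter> R) + dg v R"
proof -
  have "(\<Sum>w\<in>R. if adj w v then 1 else 0) = dg v R"
    unfolding dg_eq_sum[OF assms] by (rule sum.cong) (auto dest: adj_sym)
  then show ?thesis unfolding del_def by (simp add: sum.distrib sum_ind[OF assms])
qed

text \<open>After colouring \<open>v\<close> with a colour missing at \<open>u\<close>, colouring greedily from \<open>u\<close> stops only at
  \<open>h\<close>; \<open>R\<close> is the part that is not reached.\<close>

lemma remainder:
  assumes u: "u \<in> X" "u \<noteq> h" and v: "v \<in> V" "v \<notin> X" "v \<noteq> h" and uv: "adj u v"
  obtains R K where "R \<subseteq> V" "K \<subseteq> V" "K \<union> R = V - {v}" "K \<inter> R = {}" "u \<in> K" "h \<in> R" "dg h K = 1"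
    "\<And>r k. r \<in> R \<Longrightarrow> r \<noteq> h \<Longrightarrow> k \<in> K \<Longrightarrow> \<not> adj r k" "conn R"
    "\<And>w. w \<in> R \<Longrightarrow> w \<noteq> h \<Longrightarrow> dg w R + del v w = 3" "dg h R + del v h = 3"
    "\<not> AT R (del v)" "1 \<le> dg v R" "1 \<le> dg v K" "dg v R + dg v K = 3"
proof -
  have uV: "u \<in> V" using u X_subset by auto
  obtain R where R: "R \<subseteq> V - {u, v}" "R \<noteq> {}" "\<not> AT R (\<lambda>w. ind X w + (if adj w v then 1 else 0))"
    "\<And>r. r \<in> R \<Longrightarrow> dg r (V - {v} - R) + 3 \<le> dg r V + ind X r"
    by (rule not_AT_delete_larger[OF finite_V uV v(1) uv _ _ not_AT])
      (use u v low[OF uV u(2)] in \<open>auto simp: ind_def\<close>)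
  define K where "K = V - {v} - R"
  have sub: "R \<subseteq> V" "K \<subseteq> V" "K \<union> R = V - {v}" "K \<inter> R = {}" "v \<notin> K" "v \<notin> R"
    using R(1) by (auto simp: K_def)
  have fin: "finite R" "finite K" using sub finite_sub by auto
  have uK: "u \<in> K" using R(1) uV adj_neq[OF uv] by (auto simp: K_def)
  have 0: "dg r K = 0" if "r \<in> R" "r \<noteq> h" for r
    using R(4)[OF that(1)] low[of r] that sub by (auto simp: K_def)
  have dv: "dg v V = 3" using low[OF v(1,3)] v(2) by (simp add: ind_def)
  \<comment> \<open>Otherwise no vertex of \<open>R\<close> has a neighbour in \<open>K\<close>, and
    \<open>v\<close> is a cut vertex of degree 3.\<close>
  have hR: "h \<in> R \<and> dg h K \<noteq> 0"
  proof (rule ccontr)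
    assume "\<not> ?thesis"
    then have "dg r K = 0" if "r \<in> R" for r using 0 that by (cases "r = h") auto
    then have "ee R K = 0" by (simp add: ee_def)
    then show False using not_cut_vertex[OF v(1), of R K] dv sub R(2) uK by auto
  qed
  have hK: "dg h K = 1" using R(4)[of h] hR high by (simp add: K_def)
  have dgV: "dg w V = dg w R + dg w K + (if adj w v then 1 else 0)" for w
    using dg_remove[OF v(1), of w] dg_Un_disjoint[of K R w] sub by simp
  have sum3: "dg v R + dg v K = 3" using dgV[of v] dv adj_irrefl by simp
  have vK: "1 \<le> dg v K"
    using dg_pos_iff[of v K] uK adj_sym[OF uv] by (metis Suc_leI One_nat_def)
  have cutP: "cut P = dg v P + (if h \<in> P then 1 else 0)" if P: "P \<subseteq> R" "ee P (R - P) = 0" for P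
  proof -
    have finP: "finite P" using P(1) fin finite_subset by blast
    have VP: "V - P = ({v} \<union> K) \<union> (R - P)" using sub P(1) v(1) by auto
    have "({v} \<union> K) \<inter> (R - P) = {}" using sub by auto
    from ee_Un_right[OF this, of P] have "cut P = ee P ({v} \<union> K) + ee P (R - P)"
      unfolding cut_def VP .
    also have "\<dots> = ee P {v} + ee P K" using ee_Un_right[of "{v}" K P] sub P(2) by simp
    also have "ee P {v} = dg v P" using ee_singleton_right[OF finP] .
    also have "ee P K = (if h \<in> P then 1 else 0)"
    proof -
      have "ee P K = (\<Sum>w\<in>P. if w = h then 1 else 0)"
        unfolding ee_def using P(1) 0 hK by (intro sum.cong) auto
      then show ?thesis using finP by simp
    qed
    finally show ?thesis .
  qed
  \<comment> \<open>Two parts of \<open>R\<close> without edges between them share at most two edges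
    to \<open>v\<close> and the one edge from \<open>h\<close> to \<open>K\<close>, but each needs
    boundary at least 2.\<close>
  have "conn R"
    unfolding conn_def
  proof (intro allI impI)
    fix P assume P: "P \<subseteq> R" "P \<noteq> {}" "P \<noteq> R"
    have finP: "finite P" "finite (R - P)" using P(1) fin finite_subset by blast+
    show "\<exists>p\<in>P. \<exists>q\<in>R - P. adj p q"
    proof (rule ccontr)
      assume "\<not> ?thesis"
      then have e: "ee P (R - P) = 0" using ee_eq_0_iff[OF finP(1)] by blast
      then have "ee (R - P) P = 0" using ee_commute[OF finP] by simp
      moreover have "R - (R - P) = P" using P(1) by auto
      ultimately have "cut (R - P) = dg v (R - P) + (if h \<in> R - P then 1 else 0)"
        by (intro cutP) auto
      moreover have "cut P = dg v P + (if h \<in> P then 1 else 0)" by (rule cutP[OF P(1) e])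
      moreover have "2 \<le> cut P" by (rule cut_ge_2) (use P sub v(1) in auto)
      moreover have "2 \<le> cut (R - P)" by (rule cut_ge_2) (use P sub v(1) in auto)
      moreover have "dg v R = dg v P + dg v (R - P)" by (rule dg_split[OF P(1)])
      ultimately show False using sum3 vK by (auto split: if_splits)
    qed
  qed
  moreover have "1 \<le> dg v R"
  proof -
    have "R \<noteq> V" using sub(6) v(1) by blast
    then show ?thesis using cutP[of R] cut_ge_2[OF sub(1) R(2)] by (simp split: if_splits)
  qed
  moreover have "dg w R + del v w = 3" if "w \<in> R" "w \<noteq> h" for w
    using dgV[of w] 0[OF that] low[OF subsetD[OF sub(1) that(1)] that(2)] by (simp add: del_def)
  moreover have "dg h R + del v h = 3"
    using dgV[of h] hK high by (simp add: del_def)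
  moreover have "\<not> adj r k" if "r \<in> R" "r \<noteq> h" "k \<in> K" for r k
    using 0[OF that(1,2)] that(3) by (simp add: dg_eq_0_iff)
  ultimately show ?thesis
    using that[OF sub(1,2,3,4) uK conjunct1[OF hR] hK] R(3) sum3 vK unfolding del_def by blast
qed

text \<open>By \<open>AT_low\<close> all deficiencies equal 1. The sum then bounds
  \<open>card R\<close> by 3, while all degrees are 2.\<close>

lemma remainder_triangle:
  assumes R: "R \<subset> V" "conn R" "\<And>w. w \<in> R \<Longrightarrow> dg w R + g w = 3" "\<not> AT R g" "sum g R \<le> 3"
    "\<And>w. w \<in> R \<Longrightarrow> g w \<le> 2" "w2 \<in> R" "1 \<le> g w2"
  shows "\<And>w. w \<in> R \<Longrightarrow> g w = 1" "card R = 3" "\<And>a b. a \<in> R \<Longrightarrow> b \<in> R \<Longrightarrow> a \<noteq> b \<Longrightarrow> adj a b"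
proof -
  have fin: "finite R" using R(1) finite_sub by auto
  show 1: "g w = 1" if "w \<in> R" for w
    using AT_low[OF R(1,2,3,5) that _ R(7,8,6)] R(4) by blast
  have "card R \<le> 3" using R(5) 1 by simp
  moreover have dg2: "dg w R = 2" if "w \<in> R" for w using R(3)[OF that] 1[OF that] by simp
  moreover have "2 < card R" using dg2[OF R(7)] dg_less_card[OF fin R(7)] by simp
  ultimately show 3: "card R = 3" by simp
  fix a b assume ab: "a \<in> R" "b \<in> R" "a \<noteq> b"
  have "{w \<in> R. adj a w} = R - {a}"
  proof (rule card_seteq)
    show "card (R - {a}) \<le> card {w \<in> R. adj a w}" using dg2[OF ab(1)] 3 ab(1) fin by (simp add: dg_def)
  qed (use fin adj_irrefl in auto)
  then show "adj a b" using ab by auto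
qed

text \<open>Since \<open>t\<close> is no cut vertex, some deficient vertex has a neighbour
  \<open>q\<close> of deficiency 0. All excesses in \<open>V - {t}\<close> are 0, so the core left
  by deleting \<open>q\<close> has no further neighbours: \<open>t\<close> and \<open>q\<close>
  together separate the graph.\<close>

lemma low_split:
  assumes t: "t \<in> V" "dg t V \<le> 3" and lowg: "\<And>w. w \<in> V - {t} \<Longrightarrow> dg w (V - {t}) + g w = 3"
    and n: "\<not> AT (V - {t}) g" and p0: "p0 \<in> V - {t}" "1 \<le> g p0" and q0: "q0 \<in> V - {t}" "g q0 = 0"
  obtains q P Q where "q \<in> V" "q \<noteq> t" "g q = 0" "P \<union> Q = V - {t, q}" "P \<inter> Q = {}"
    "P \<noteq> {}" "Q \<noteq> {}" "ee P Q = 0"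
proof -
  let ?W = "V - {t}" and ?A = "{w \<in> V - {t}. 1 \<le> g w}"
  have "ee ?A (?W - ?A) \<noteq> 0"
    by (rule not_cut_vertex[OF t]) (use p0 q0 in auto)
  moreover have fin: "finite ?A" using finite_V by auto
  ultimately obtain p q where pq: "p \<in> ?A" "q \<in> ?W - ?A" "adj p q"
    unfolding ee_eq_0_iff[OF fin] by blast
  have g: "g q = 0" "1 \<le> g p" using pq by auto
  obtain R where R: "R \<subseteq> ?W - {p, q}" "R \<noteq> {}"
    "\<And>r. r \<in> R \<Longrightarrow> dg r (?W - {q} - R) + 3 \<le> dg r ?W + g r"
    by (rule not_AT_delete_larger[OF _ _ _ pq(3) _ _ n])
      (use pq g finite_V lowg[of p] in auto)
  have "dg r (?W - {q} - R) = 0" if "r \<in> R" for r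
  proof -
    have "r \<in> V - {t}" using R(1) that by auto
    then show ?thesis using R(3)[OF that] lowg[of r] by linarith
  qed
  then have "ee R (?W - {q} - R) = 0" by (simp add: ee_def)
  then show ?thesis
    using that[of q R "?W - {q} - R"] pq g R(1,2) adj_neq[OF pq(3)] by blast
qed

section \<open>The vertex of excess one is not in \<open>X\<close>\<close>

lemma nbrs_split_part:
  assumes "ee P Q = 0" "P \<union> Q = U" "a \<in> P" "adj a b" "b \<in> U" "finite P"
  shows "b \<in> P"
proof -
  have "\<not> adj a t" if "t \<in> Q" for t
    using ee_eq_0_iff[OF assms(6), of Q] assms(1,3) that by blast
  then show ?thesis using assms(2,4,5) by blast
qed

text \<open>The vertex \<open>r1\<close> is deleted at \<open>h\<close>. If there is a vertex
  besides the six named ones, \<open>low_split\<close> separates the graph at \<open>r1\<close> and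
  some \<open>q\<close>; but the neighbours of \<open>r1\<close> lie on one side, so
  \<open>q\<close> alone separates, impossible at degree 3. Six vertices alone make \<open>X\<close>
  blocked.\<close>

lemma not_diamond_at_high:
  assumes X: "X = {h, u, u'}" "u \<noteq> u'" "u \<noteq> h" "u' \<noteq> h"
    and mem: "r1 \<in> V" "r2 \<in> V" "v \<in> V" "r1 \<notin> X" "r2 \<notin> X" "v \<notin> X" "r1 \<noteq> r2" "v \<noteq> r1" "v \<noteq> r2"
    and adj: "adj h r1" "adj h r2" "adj r1 r2" "adj v r1" "adj v r2" "adj v u"
  shows False
proof -
  note adj' = adj[THEN adj_sym]
  have XV: "h \<in> V" "u \<in> V" "u' \<in> V" using X(1) X_subset by auto
  have deg: "dg h V = 3" "dg u V = 2" "dg u' V = 2" "dg r1 V = 3" "dg r2 V = 3" "dg v V = 3"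
    using high low[OF XV(2)] low[OF XV(3)] low[OF mem(1)] low[OF mem(2)] low[OF mem(3)] mem X
    by (auto simp: ind_def)
  have ne: "r1 \<noteq> h" "r2 \<noteq> h" "v \<noteq> h" "r1 \<noteq> u" "r2 \<noteq> u" "v \<noteq> u" "r1 \<noteq> u'" "r2 \<noteq> u'" "v \<noteq> u'"
    using mem X(1) by auto
  have Nr1: "adj r1 w \<longleftrightarrow> w = h \<or> w = r2 \<or> w = v" if "w \<in> V" for w
    by (rule nbrs3) (use deg adj adj' mem XV ne that in auto)
  have Nr2: "adj r2 w \<longleftrightarrow> w = h \<or> w = r1 \<or> w = v" if "w \<in> V" for w
    by (rule nbrs3) (use deg adj adj' mem XV ne that in auto)
  have Nv: "adj v w \<longleftrightarrow> w = r1 \<or> w = r2 \<or> w = u" if "w \<in> V" for w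
    by (rule nbrs3) (use deg adj adj' mem XV ne that in auto)
  define g where "g = (\<lambda>w. ind X w + (if adj w r1 \<and> w \<noteq> h then 1 else 0))"
  have n: "\<not> AT (V - {r1}) g"
    using AT_delete_larger[OF finite_V XV(1) mem(1) adj(1), of "ind X"] not_AT X mem(4)
    unfolding g_def by (auto simp: ind_def)
  have lowg: "dg w (V - {r1}) + g w = 3" if "w \<in> V - {r1}" for w
    using dg_remove[OF mem(1), of w] low[of w] high that adj(1) X(1)
    by (cases "w = h") (auto simp: g_def ind_def)
  have g1: "g w = 0 \<longleftrightarrow> w \<notin> {h, u, u', r2, v}" if "w \<in> V" "w \<noteq> r1" for w
    using Nr1[OF that(1)] X ne adj_commute[of w r1] by (auto simp: g_def ind_def)
  show False
  proof (cases "V \<subseteq> {h, u, u', r1, r2, v}")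
    case True
    have Nu: "adj u u' \<or> adj u h"
    proof -
      obtain w where w: "w \<in> V" "w \<noteq> v" "adj u w"
        using second_nbr[of u v] deg mem by auto
      then have "w \<noteq> u" "w \<noteq> r1" "w \<noteq> r2"
        using Nr1[OF XV(2)] Nr2[OF XV(2)] ne X(3) adj_irrefl adj_sym[OF w(3)] by auto
      then show ?thesis using w True by auto
    qed
    have nu': "w = u \<or> w = h" if "w \<in> V" "adj u' w" for w
    proof -
      have "w \<noteq> u'" "w \<noteq> r1" "w \<noteq> r2" "w \<noteq> v"
        using Nr1[OF XV(3)] Nr2[OF XV(3)] Nv[OF XV(3)] ne X(2,4) adj_irrefl adj_sym[OF that(2)] by auto
      then show ?thesis using that True by auto
    qed
    have "2 \<le> dg u' V" using deg by simp
    have u'u: "adj u' u" "adj u' h"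
      using second_nbr[OF \<open>2 \<le> dg u' V\<close> XV(1)] second_nbr[OF \<open>2 \<le> dg u' V\<close> XV(2)] nu' by metis+
    \<comment> \<open>\<open>h\<close> and \<open>v\<close> are the tips of a diamond and share a
      colour; \<open>v\<close> is adjacent to \<open>u\<close>, and \<open>u'\<close> to both
      \<open>u\<close> and \<open>h\<close>.\<close>
    have "card (\<phi> ` X) = 3" if "coloring V \<phi>" for \<phi>
    proof -
      have ran: "\<phi> w \<in> {0, 1, 2}" if "w \<in> V" for w using \<open>coloring V \<phi>\<close> that by (auto simp: coloring_def)
      have dif: "\<phi> a \<noteq> \<phi> b" if "adj a b" "a \<in> V" "b \<in> V" for a b
        using \<open>coloring V \<phi>\<close> that by (auto simp: coloring_def)
      have "\<phi> h = \<phi> v"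
        using ran[OF XV(1)] ran[OF mem(1)] ran[OF mem(2)] ran[OF mem(3)]
          dif[OF adj(1)] dif[OF adj(2)] dif[OF adj(3)] dif[OF adj(4)] dif[OF adj(5)] XV mem by auto
      then have "\<phi> h \<noteq> \<phi> u" "\<phi> u' \<noteq> \<phi> u" "\<phi> u' \<noteq> \<phi> h"
        using dif[OF adj(6)] dif[OF u'u(1)] dif[OF u'u(2)] XV mem by auto
      then show ?thesis by (simp add: X(1))
    qed
    then show False using unblocked_X[OF card_X_eq] by (auto simp: unblocked_def)
  next
    case False
    then obtain q0 where q0: "q0 \<in> V" "q0 \<notin> {h, u, u', r1, r2, v}" by blast
    obtain q P Q where S: "q \<in> V" "q \<noteq> r1" "g q = 0" "P \<union> Q = V - {r1, q}" "P \<inter> Q = {}"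
      "P \<noteq> {}" "Q \<noteq> {}" "ee P Q = 0"
      by (rule low_split[OF mem(1) _ lowg n, of h q0]) (use deg q0 g1[of q0] g1[of h] XV ne in auto)
    have q: "q \<notin> {h, u, u', r2, v}" using g1[of q] S by blast
    have key: False if hP: "h \<in> P" and PQ: "P \<union> Q = V - {r1, q}" "P \<inter> Q = {}" "Q \<noteq> {}" "ee P Q = 0" for P Q
    proof -
      have fin: "finite P" "finite Q" using PQ(1) finite_V by (metis finite_Diff finite_Un)+
      have QP: "ee Q P = 0" using ee_commute[OF fin] PQ by simp
      have r2P: "r2 \<in> P"
        by (rule nbrs_split_part[OF PQ(4,1) hP adj(2) _ fin(1)]) (use mem q in auto)
      have vP: "v \<in> P"
        by (rule nbrs_split_part[OF PQ(4,1) r2P adj'(5) _ fin(1)]) (use mem q in auto)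
      have "\<not> adj r1 w" if "w \<in> Q" for w
        using Nr1[of w] that PQ(1,2) hP r2P vP by blast
      then have r1Q: "ee Q {r1} = 0" using fin by (simp add: ee_singleton_right dg_eq_0_iff)
      have "cut Q = ee Q ({q} \<union> ({r1} \<union> P))"
        by (rule ee_cut) (use PQ mem S(1) in auto)
      also have "\<dots> = ee Q {q} + (ee Q {r1} + ee Q P)"
        by (subst ee_Un_right, use PQ S(2) in blast)+ simp
      also have "\<dots> = dg q Q" using r1Q QP fin by (simp add: ee_singleton_right)
      finally have "cut Q = dg q Q" .
      moreover have "cut (V - Q) = cut Q" by (rule cut_compl) (use PQ in auto)
      moreover have "cut (insert r1 P) = dg q P"
      proof -
        have "cut (insert r1 P) = ee ({r1} \<union> P) ({q} \<union> Q)"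
          by (subst insert_is_Un, rule ee_cut) (use PQ mem S(1,2) in auto)
        also have "\<dots> = ee {r1} ({q} \<union> Q) + ee P ({q} \<union> Q)"
          by (rule ee_Un_left) (use fin PQ in auto)
        also have "ee {r1} ({q} \<union> Q) = 0"
          using Nr1 S(1) PQ(1,2) hP r2P vP q by (subst ee_eq_0_iff) blast+
        also have "ee P ({q} \<union> Q) = ee P {q} + ee P Q"
          by (rule ee_Un_right) (use PQ in auto)
        finally show ?thesis using PQ(4) fin by (simp add: ee_singleton_right)
      qed
      moreover have "2 \<le> cut Q" by (rule cut_ge_2) (use PQ mem in auto)
      moreover have "2 \<le> cut (insert r1 P)" by (rule cut_ge_2) (use PQ mem S(1,2) in auto)
      moreover have "dg q V = 3" using low[OF S(1)] q X(1) by (auto simp: ind_def)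
      moreover have "dg q P + dg q Q \<le> dg q V"
        using dg_Un_disjoint[OF PQ(2), of q] dg_mono[of "P \<union> Q" V q] PQ(1) by auto
      ultimately show False by linarith
    qed
    have "h \<in> P \<or> h \<in> Q" using S(4) XV q ne by auto
    moreover have "ee Q P = 0"
      using S(4,8) finite_V ee_commute by (metis finite_Diff finite_Un)
    ultimately show False using key[of P Q] key[of Q P] S by blast
  qed
qed

text \<open>The position of \<open>u'\<close> relative to \<open>remainder\<close> decides. In
  \<open>K\<close>, the rest \<open>R\<close> is a triangle that forms an excluded diamond with
  \<open>v\<close>. In \<open>R\<close>, one edge from \<open>v\<close> to \<open>R\<close> gives
  the second outcome, and two such edges force the first.\<close>

lemma trichotomy:
  assumes X: "X = {h, u, u'}" "u \<noteq> u'" "u \<noteq> h" "u' \<noteq> h"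
    and v: "v \<in> V" "v \<notin> X" and uv: "adj u v"
  obtains (near) "adj u h"
  | (triangle) r where "r \<in> V" "r \<notin> X" "r \<noteq> v" "adj u' h" "adj u' r" "adj r h" "adj r v" "\<not> adj h v"
proof -
  have XV: "h \<in> V" "u \<in> V" "u' \<in> V" using X(1) X_subset by auto
  have vh: "v \<noteq> h" "v \<noteq> u" "v \<noteq> u'" using v X(1) by auto
  have ind1: "ind X h = 1" "ind X u = 1" "ind X u' = 1" "ind X v = 0" using X v by (auto simp: ind_def)
  have dh: "dg h V = 3" using high ind1 by simp
  obtain R K where RK: "R \<subseteq> V" "K \<subseteq> V" "K \<union> R = V - {v}" "K \<inter> R = {}" "u \<in> K" "h \<in> R" "dg h K = 1"
    "\<And>r k. r \<in> R \<Longrightarrow> r \<noteq> h \<Longrightarrow> k \<in> K \<Longrightarrow> \<not> adj r k" "conn R"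
    "\<And>w. w \<in> R \<Longrightarrow> w \<noteq> h \<Longrightarrow> dg w R + del v w = 3" "dg h R + del v h = 3"
    "\<not> AT R (del v)" "1 \<le> dg v R" "1 \<le> dg v K" "dg v R + dg v K = 3"
    by (rule remainder[of u v]) (use X v vh uv in auto)
  have fin: "finite R" "finite K" using RK finite_sub by auto
  have RV: "R \<subset> V" using RK(1,3) v(1) by blast
  have lowR: "dg w R + del v w = 3" if "w \<in> R" for w using RK(10,11) that by blast
  have sumR: "sum (del v) R = card (X \<inter> R) + dg v R" by (rule sum_del[OF fin(1)])
  have h1: "1 \<le> del v h" using ind1 by (simp add: del_def)
  note tri = remainder_triangle[OF RV RK(9) lowR RK(12) _ del_le_2 RK(6) h1]
  show ?thesis
  proof (cases "u' \<in> K")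
    case True
    then have XR: "X \<inter> R = {h}" using X(1) RK(4-6) by auto
    then have le: "sum (del v) R \<le> 3" using sumR RK(14,15) by simp
    note tri = tri[OF _ le]
    have del1: "del v w = 1" if "w \<in> R" for w using tri(1) that lowR by blast
    have cR: "card R = 3" using tri(2) lowR by blast
    have cl: "adj a b" if "a \<in> R" "b \<in> R" "a \<noteq> b" for a b using tri(3) that lowR by blast
    have "card (R - {h}) = 2" using cR RK(6) fin by simp
    then obtain r1 r2 where r: "R - {h} = {r1, r2}" "r1 \<noteq> r2" by (auto simp: card_2_iff)
    have r': "r1 \<in> R" "r2 \<in> R" "r1 \<noteq> h" "r2 \<noteq> h" using r by auto
    have rX: "r1 \<notin> X" "r2 \<notin> X" using r' XR by auto
    have "adj w v" if "w \<in> R" "w \<notin> X" for w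
      using del1[OF that(1)] that(2) by (auto simp: del_def ind_def split: if_splits)
    then have rv: "adj r1 v" "adj r2 v" using r' rX by blast+
    have False
    proof (rule not_diamond_at_high[OF X, of r1 r2 v])
      show "adj h r1" "adj h r2" "adj r1 r2" using cl r' RK(6) r(2) by auto
      show "adj v r1" "adj v r2" "adj v u" using rv uv adj_sym by auto
      show "v \<noteq> r1" "v \<noteq> r2" using rv adj_neq by auto
    qed (use r r' rX RK(1) v in auto)
    then show ?thesis ..
  next
    case False
    then have u'R: "u' \<in> R" using RK(3) XV vh by blast
    then have XR: "X \<inter> R = {h, u'}" using X(1) RK(4-6) by auto
    show ?thesis
    proof (cases "dg v R = 1")
      case True
      then have le: "sum (del v) R \<le> 3" using sumR XR X(4) by simp
      note tri = tri[OF _ le]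
      have del1: "del v w = 1" if "w \<in> R" for w using tri(1) that lowR by blast
      have cR: "card R = 3" using tri(2) lowR by blast
      have cl: "adj a b" if "a \<in> R" "b \<in> R" "a \<noteq> b" for a b using tri(3) that lowR by blast
      have "card (R - {h} - {u'}) = 1" using cR RK(6) u'R X(4) fin by simp
      then obtain r where r: "R - {h} - {u'} = {r}" by (auto simp: card_1_singleton_iff)
      have r': "r \<in> R" "r \<noteq> h" "r \<noteq> u'" using r by auto
      have rX: "r \<notin> X" using r' XR by auto
      have "adj r v" using del1[OF r'(1)] rX by (auto simp: del_def ind_def split: if_splits)
      moreover have "\<not> adj h v" using del1[OF RK(6)] ind1 by (auto simp: del_def split: if_splits)
      ultimately show ?thesis
        using triangle[of r] r' rX RK(1) cl[OF u'R RK(6) X(4)] cl[OF u'R r'(1)] cl[OF r'(1) RK(6)] adj_neq by blast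
    next
      case False
      \<comment> \<open>Now \<open>R\<close> has total deficiency 4, out of reach of
        \<open>remainder_triangle\<close>. Unless the second neighbour \<open>x2\<close> of
        \<open>u\<close> is \<open>h\<close>, the remainder for deleting \<open>x2\<close> is laid
        over the first one.\<close>
      then have vR: "dg v R = 2" and vK: "dg v K = 1" using RK(13-15) by auto
      have du: "dg u V = 2" using low[OF XV(2) X(3)] ind1 by simp
      obtain x2 where x2: "x2 \<in> V" "x2 \<noteq> v" "adj u x2"
        using second_nbr[of u v] du v(1) by auto
      show ?thesis
      proof (cases "x2 = h")
        case True
        then show ?thesis using near x2 by simp
      next
        case h2: False
        have x2K: "x2 \<in> K" using RK(3) RK(8)[of x2 u] x2 h2 RK(5) adj_sym[OF x2(3)] by blast
        have x2X: "x2 \<notin> X" using x2K XR X(1) RK(4) adj_neq[OF x2(3)] RK(6) u'R by blast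
        obtain R3 K3 where S: "R3 \<subseteq> V" "K3 \<subseteq> V" "K3 \<union> R3 = V - {x2}" "K3 \<inter> R3 = {}" "u \<in> K3" "h \<in> R3"
          "dg h K3 = 1" "\<And>r k. r \<in> R3 \<Longrightarrow> r \<noteq> h \<Longrightarrow> k \<in> K3 \<Longrightarrow> \<not> adj r k"
          by (rule remainder[of u x2]) (use X x2 x2X h2 in auto)
        have vK3: "v \<in> K3" using S(3) S(8)[of v u] S(5) x2(2) v(1) vh(1) adj_sym[OF uv] by blast
        have x2R: "x2 \<notin> R" using x2K RK(4) by blast
        \<comment> \<open>\<open>h\<close> has one neighbour in \<open>K3\<close> and so at least
          one in \<open>A\<close>. The cut bounds then put two neighbours of \<open>h\<close> into
          \<open>A\<close> and two of \<open>v\<close> into \<open>B\<close>, and both sets get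
          boundary 2. Each must therefore meet \<open>X\<close>, but only \<open>u'\<close> is
          available.\<close>
        define A where "A = (R - {h}) \<inter> R3"
        define B where "B = (R - {h}) - R3"
        have BK: "B \<subseteq> K3" using S(3) RK(1) x2R by (auto simp: B_def)
        have AB: "A \<union> B = R - {h}" "A \<inter> B = {}" by (auto simp: A_def B_def)
        have finAB: "finite A" "finite B" using fin by (auto simp: A_def B_def)
        have RhV: "R - {h} \<union> {h} \<union> K \<union> {v} = V" using RK(1-3,6) v(1) by auto
        have AK: "ee A (K \<union> {v} \<union> B) = 0"
        proof (subst ee_eq_0_iff[OF finAB(1)], intro ballI)
          fix a t assume a: "a \<in> A" "t \<in> K \<union> {v} \<union> B"
          have aR: "a \<in> R" "a \<noteq> h" "a \<in> R3" using a(1) by (auto simp: A_def)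
          show "\<not> adj a t"
            using a(2) RK(8)[OF aR(1,2)] S(8)[OF aR(3,2)] vK3 BK by blast
        qed
        have BKA: "ee B (K \<union> A) = 0"
        proof (subst ee_eq_0_iff[OF finAB(2)], intro ballI)
          fix b t assume b: "b \<in> B" "t \<in> K \<union> A"
          have bR: "b \<in> R" "b \<noteq> h" "b \<in> K3" using b(1) BK by (auto simp: B_def)
          show "\<not> adj b t"
            using b(2) RK(8)[OF bR(1,2)] S(8)[of t b] bR(3) adj_sym[of b t] by (auto simp: A_def)
        qed
        have cutA: "cut A = dg h A"
        proof -
          have "cut A = ee A ((K \<union> {v} \<union> B) \<union> {h})"
            by (rule ee_cut) (use RhV AB RK(3,4,6) vh in \<open>auto simp: A_def\<close>)
          also have "\<dots> = ee A (K \<union> {v} \<union> B) + ee A {h}"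
            by (rule ee_Un_right) (use RK(4,6) vh AB in \<open>auto simp: B_def\<close>)
          finally show ?thesis using AK finAB by (simp add: ee_singleton_right)
        qed
        have cutB: "cut B = dg v B + dg h B"
        proof -
          have "cut B = ee B ((K \<union> A) \<union> ({v} \<union> {h}))"
            by (rule ee_cut) (use RhV AB RK(3,4,6) vh in \<open>auto simp: B_def\<close>)
          also have "\<dots> = ee B (K \<union> A) + ee B ({v} \<union> {h})"
            by (rule ee_Un_right) (use RK(3,4,6) AB in auto)
          also have "ee B ({v} \<union> {h}) = ee B {v} + ee B {h}"
            by (rule ee_Un_right) (use vh in auto)
          finally show ?thesis using BKA finAB by (simp add: ee_singleton_right)
        qed
        have dgR: "dg w R = dg w A + dg w B + (if adj w h then 1 else 0)" for w
          using dg_remove[OF RK(6), of w] dg_Un_disjoint[OF AB(2), of w] AB(1) by simp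
        have vhA: "v \<notin> A" "v \<notin> B" using RK(3) by (auto simp: A_def B_def)
        have hv3: "dg h B + (if adj h v then 1 else 0) \<le> 1"
          using dg_mono[of "insert v B" K3 h] BK vK3 S(7) dg_insert[OF vhA(2), of h] by simp
        have hsum: "dg h A + dg h B + (if adj h v then 1 else 0) = 2"
          using dg_remove[OF v(1), of h] dg_Un_disjoint[OF RK(4), of h] RK(3,7) dh dgR[of h] adj_irrefl by simp
        then have "0 < dg h A" using hv3 by linarith
        then have "A \<noteq> {}" by auto
        then have "2 \<le> cut A" by (intro cut_ge_2) (use RK(1) h_in in \<open>auto simp: A_def\<close>)
        then have hA: "dg h A = 2" "dg h B = 0" "\<not> adj h v" using cutA hsum by (auto split: if_splits)
        have "dg v A = 0" using AK vK3 by (auto simp: ee_eq_0_iff[OF finAB(1)] dg_eq_0_iff dest: adj_sym)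
        then have vB: "dg v B = 2" using dgR[of v] vR hA(3) adj_commute[of v h] by simp
        then have "B \<noteq> {}" by auto
        moreover have "A \<subseteq> V" "B \<subseteq> V" using RK(1) by (auto simp: A_def B_def)
        moreover have "cut A = 2" "cut B = 2" using cutA cutB hA vB by auto
        ultimately have "X \<inter> A \<noteq> {}" "X \<inter> B \<noteq> {}"
          using cut_ge_3[of A] cut_ge_3[of B] X_nonempty \<open>A \<noteq> {}\<close> by auto
        then have "u' \<in> A" "u' \<in> B" using XR AB by auto
        then show ?thesis using AB(2) by blast
      qed
    qed
  qed
qed

text \<open>The four degrees sum to 10, and the two path edges account for 4. With e edges from
  \<open>s\<close> to the path the boundary is 6 - 2e; the complement misses \<open>X\<close>, so
  this is at least 3.\<close>

lemma cut_bound_path: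
  assumes X: "X = {h, x, y}" "x \<noteq> y" "x \<noteq> h" "y \<noteq> h"
    and adj: "adj x h" "adj y h" "\<not> adj x y" and s: "s \<in> V" "s \<notin> X" "V \<noteq> {x, y, h, s}"
  shows "(if adj x s then 1 else 0) + (if adj y s then 1 else 0) + (if adj h s then 1 else (0::nat)) \<le> 1"
proof -
  let ?S = "{x, y, h, s}"
  let ?T = "V - ?S"
  have mem: "x \<in> V" "y \<in> V" "h \<in> V" "s \<in> V" using X(1) X_subset s by auto
  have ne: "s \<noteq> x" "s \<noteq> y" "s \<noteq> h" using s X(1) by auto
  have deg: "dg h V = 3" "dg x V = 2" "dg y V = 2" "dg s V = 3"
    using high low[OF mem(1)] low[OF mem(2)] low[OF mem(4)] s ne X by (auto simp: ind_def)
  have TS: "?T \<noteq> {}" using s(3) mem by auto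
  have S: "dg w V = (if adj w x then 1 else 0) + (if adj w y then 1 else 0) + (if adj w h then 1 else 0)
      + (if adj w s then 1 else 0) + dg w ?T" for w
  proof -
    have "dg w V = dg w ?S + dg w ?T" by (rule dg_split) (use mem in auto)
    moreover have "dg w ?S = (if adj w x then 1 else 0) + (if adj w y then 1 else 0) + (if adj w h then 1 else 0)
      + (if adj w s then 1 else 0)"
      using X ne by (simp add: dg_insert)
    ultimately show ?thesis by simp
  qed
  have "3 \<le> cut ?T"
    by (rule cut_ge_3[OF _ TS X_nonempty]) (use X in auto)
  also have "cut ?T = cut ?S" by (rule cut_compl) (use mem in auto)
  also have "\<dots> = dg x ?T + dg y ?T + dg h ?T + dg s ?T"
    using X ne by (simp add: cut_def ee_def)
  finally show ?thesis
    using S[of x] S[of y] S[of h] S[of s] deg adj adj_sym[OF adj(1)] adj_sym[OF adj(2)] adj_irrefl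
      adj_commute[of y x] adj_commute[of s x] adj_commute[of s y] adj_commute[of s h]
    by (auto split: if_splits)
qed

text \<open>If \<open>v = v'\<close>, then \<open>cut_bound_path\<close> leaves only K4 minus an
  edge. Otherwise the third neighbour \<open>t\<close> of \<open>h\<close> is deleted at
  \<open>h\<close>: either \<open>t\<close> and some \<open>q\<close> separate the graph, which
  parity excludes, or the graph is a prism minus a triangle edge.\<close>

lemma not_path_through_high:
  assumes X: "X = {h, x, y}" "x \<noteq> y" "x \<noteq> h" "y \<noteq> h"
    and adj: "adj x h" "adj y h" "adj x v" "adj y v'"
    and v: "v \<in> V" "v \<notin> X" "v' \<in> V" "v' \<notin> X"
  shows False
proof -
  note adj' = adj[THEN adj_sym]
  have mem: "x \<in> V" "y \<in> V" "h \<in> V" using X(1) X_subset by auto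
  have ne: "v \<noteq> x" "v \<noteq> y" "v \<noteq> h" "v' \<noteq> x" "v' \<noteq> y" "v' \<noteq> h" using v X(1) by auto
  have deg: "dg h V = 3" "dg x V = 2" "dg y V = 2" "dg v V = 3" "dg v' V = 3"
    using high low[OF mem(1)] low[OF mem(2)] low[OF v(1)] low[OF v(3)] v ne X by (auto simp: ind_def)
  have Nx: "adj x w \<longleftrightarrow> w = h \<or> w = v" if "w \<in> V" for w
    by (rule nbrs2[OF deg(2) adj(1,3)]) (use mem v ne that in auto)
  have Ny: "adj y w \<longleftrightarrow> w = h \<or> w = v'" if "w \<in> V" for w
    by (rule nbrs2[OF deg(3) adj(2,4)]) (use mem v ne that in auto)
  have nxy: "\<not> adj x y" using Nx[OF mem(2)] X(4) ne by auto
  have nyx: "\<not> adj y x" using nxy adj_sym by blast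
  note cb = cut_bound_path[OF X adj(1,2) nxy]
  show False
  proof (cases "v = v'")
    case True
    have V: "V = {x, y, h, v}"
      using cb[OF v(1,2)] adj(3,4) True by auto
    have hv: "adj v h"
    proof -
      obtain c where "c \<in> V" "c \<noteq> x" "c \<noteq> y" "adj v c"
        using third_nbr[of v x y] deg mem X(2) by auto
      then show ?thesis using V adj_irrefl by auto
    qed
    have Nh: "adj h w \<longleftrightarrow> w = x \<or> w = y \<or> w = v" if "w \<in> V" for w
      by (rule nbrs3[OF deg(1) adj'(1,2) adj_sym[OF hv]]) (use mem v ne X that in auto)
    have Nv: "adj v w \<longleftrightarrow> w = x \<or> w = y \<or> w = h" if "w \<in> V" for w
      by (rule nbrs3[OF deg(4) adj'(3) _ hv]) (use mem v ne X that adj' True in auto)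
    have "AT V (ind X)"
    proof (rule AT_diamond[OF V])
      show "{u \<in> V. adj x u} = {h, v}" using Nx mem v by blast
      show "{u \<in> V. adj y u} = {h, v}" using Ny mem v True by blast
      show "{u \<in> V. adj h u} = {x, y, v}" using Nh mem v by blast
      show "{u \<in> V. adj v u} = {x, y, h}" using Nv mem by blast
    qed (use X ne v in \<open>auto simp: ind_def\<close>)
    then show False using not_AT by simp
  next
    case vv': False
    have "V \<noteq> {x, y, h, v}" "V \<noteq> {x, y, h, v'}" using v(1,3) ne vv' by blast+
    then have hv: "\<not> adj h v" and hv': "\<not> adj h v'"
      using cb[OF v(1,2)] cb[OF v(3,4)] adj(3,4) by (auto split: if_splits)
    obtain t where t: "t \<in> V" "t \<noteq> x" "t \<noteq> y" "adj h t"
      using third_nbr[of h x y] deg mem X(2) by auto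
    have tne: "t \<noteq> h" "t \<noteq> v" "t \<noteq> v'" using t(4) hv hv' adj_irrefl by auto
    have tX: "t \<notin> X" using t tne X(1) by auto
    have dt: "dg t V = 3" using low[OF t(1) tne(1)] tX by (simp add: ind_def)
    have Nh: "adj h w \<longleftrightarrow> w = x \<or> w = y \<or> w = t" if "w \<in> V" for w
      by (rule nbrs3[OF deg(1) adj'(1,2) t(4)]) (use mem t X that in auto)
    define g where "g = (\<lambda>w. ind X w + (if adj w t \<and> w \<noteq> h then 1 else 0))"
    have n: "\<not> AT (V - {t}) g"
      using AT_delete_larger[OF finite_V mem(3) t(1,4), of "ind X"] not_AT X tX
      unfolding g_def by (auto simp: ind_def)
    have lowg: "dg w (V - {t}) + g w = 3" if "w \<in> V - {t}" for w
      using dg_remove[OF t(1), of w] low[of w] high that t(4) X(1)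
      by (cases "w = h") (auto simp: g_def ind_def)
    show False
    proof (cases "\<exists>q0\<in>V - {t}. g q0 = 0")
      case True
      then obtain q0 where q0: "q0 \<in> V - {t}" "g q0 = 0" by blast
      obtain q P Q where S: "q \<in> V" "q \<noteq> t" "g q = 0" "P \<union> Q = V - {t, q}" "P \<inter> Q = {}"
        "P \<noteq> {}" "Q \<noteq> {}" "ee P Q = 0"
        by (rule low_split[OF t(1) _ lowg n _ _ q0, of h]) (use dt mem tne X in \<open>auto simp: g_def ind_def\<close>)
      have q: "q \<notin> X" "\<not> adj q t"
        using S(3) X(1) by (auto simp: g_def ind_def split: if_splits)
      have qt: "\<not> adj t q" using q(2) adj_sym by blast
      have qh: "q \<noteq> h" using q(1) X by auto
      have dq: "dg q V = 3" using low[OF S(1) qh] q by (simp add: ind_def)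
      have key: False if hP: "h \<in> P" and PQ: "P \<union> Q = V - {t, q}" "P \<inter> Q = {}" "Q \<noteq> {}" "ee P Q = 0" for P Q
      proof -
        have fin: "finite P" "finite Q" using PQ(1) finite_V by (metis finite_Diff finite_Un)+
        have QP: "ee Q P = 0" using ee_commute[OF fin] PQ by simp
        have xP: "x \<in> P"
          by (rule nbrs_split_part[OF PQ(4,1) hP adj'(1) _ fin(1)]) (use mem q t X in auto)
        have yP: "y \<in> P"
          by (rule nbrs_split_part[OF PQ(4,1) hP adj'(2) _ fin(1)]) (use mem q t X in auto)
        have tq: "t \<notin> P" "q \<notin> P" "t \<notin> Q" "q \<notin> Q" using PQ(1) by auto
        have XQ: "X \<inter> Q = {}" "X \<inter> insert q Q = {}" "X \<inter> insert t Q = {}" "X \<inter> insert t (insert q Q) = {}"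
          using X(1) PQ(2) hP xP yP q tX by auto
        have dgV: "dg w V = dg w P + dg w Q + (if adj w t then 1 else 0) + (if adj w q then 1 else 0)" for w
        proof -
          have "V = insert t (insert q (P \<union> Q))" using PQ(1) t(1) S(1) by auto
          moreover have "t \<notin> insert q (P \<union> Q)" "q \<notin> P \<union> Q" using tq S(2) by auto
          ultimately show ?thesis using dg_Un_disjoint[OF PQ(2), of w] by (simp add: dg_insert)
        qed
        have ins: "ee Q (insert a A) = dg a Q + ee Q A" if "a \<notin> A" for a A
          using ee_Un_right[of "{a}" A Q] that fin by (simp add: ee_singleton_right)
        have insL: "ee (insert a A) B = dg a B + ee A B" if "a \<notin> A" "finite A" for a A B
          using that by (simp add: ee_def)
        have "cut Q = ee Q (insert t (insert q P))"
          by (rule ee_cut) (use PQ t(1) S(1) tq in auto)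
        then have c1: "cut Q = dg t Q + dg q Q" using tq S(2) QP by (simp add: ins)
        have "cut (insert q Q) = ee (insert q Q) (insert t P)"
          by (rule ee_cut) (use PQ t(1) S(1,2) tq in auto)
        then have c2: "cut (insert q Q) = dg q P + dg t Q"
          using tq fin QP q(2) by (simp add: ins insL dg_insert)
        have "cut (insert t Q) = ee (insert t Q) (insert q P)"
          by (rule ee_cut) (use PQ t(1) S(1,2) tq in auto)
        then have c3: "cut (insert t Q) = dg t P + dg q Q"
          using tq fin QP qt by (simp add: ins insL dg_insert)
        have "cut (insert t (insert q Q)) = ee (insert t (insert q Q)) P"
          by (rule ee_cut) (use PQ t(1) S(1,2) tq in auto)
        then have c4: "cut (insert t (insert q Q)) = dg t P + dg q P"
          using tq fin QP S(2) by (simp add: insL)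
        have sub: "Q \<subseteq> V" using PQ(1) by auto
        have sub': "insert q Q \<subseteq> V" "insert t Q \<subseteq> V" "insert t (insert q Q) \<subseteq> V"
          using sub t(1) S(1) by auto
        note cuts = cut_ge_3[OF sub PQ(3) X_nonempty XQ(1)]
          cut_ge_3[OF sub'(1) insert_not_empty X_nonempty XQ(2)]
          cut_ge_3[OF sub'(2) insert_not_empty X_nonempty XQ(3)]
          cut_ge_3[OF sub'(3) insert_not_empty X_nonempty XQ(4)]
        \<comment> \<open>The four cuts are complementary in pairs of sum 6, so all equal 3.
          Comparing the first two gives \<open>dg t Q = dg q Q\<close>, whence
          \<open>2 * dg q Q = 3\<close>.\<close>
        have "dg q P + dg q Q = 3" "dg t P + dg t Q = 3"
          using dgV[of q] dgV[of t] dq dt q(2) qt adj_irrefl by simp_all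
        moreover have "dg q Q \<le> 1 \<or> 2 \<le> dg q Q" by linarith
        ultimately show False
          using cuts c1 c2 c3 c4 by (elim disjE) linarith+
      qed
      have "h \<in> P \<or> h \<in> Q" using S(4) mem qh tne by auto
      moreover have "ee Q P = 0"
        using S(4,8) finite_V ee_commute by (metis finite_Diff finite_Un)
      ultimately show False using key[of P Q] key[of Q P] S by blast
    next
      case False
      then have all: "adj w t" if "w \<in> V" "w \<noteq> t" "w \<notin> X" for w
        using that by (auto simp: g_def ind_def split: if_splits)
      have Nt: "adj t w \<longleftrightarrow> w = h \<or> w = v \<or> w = v'" if "w \<in> V" for w
        by (rule nbrs3[OF dt adj_sym[OF t(4)] adj_sym[OF all] adj_sym[OF all]])
          (use mem v ne vv' tne that in auto)
      have V: "V = {x, h, v, y, v', t}"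
      proof -
        have "w \<in> {x, h, v, y, v', t}" if "w \<in> V" for w
          using all[OF that] Nt[OF that] X(1) adj_sym[of w t] by auto
        then show ?thesis using mem v t(1) by blast
      qed
      have tv: "adj v t" "adj v' t" using all v tne by auto
      obtain c where c: "c \<in> V" "c \<noteq> x" "c \<noteq> t" "adj v c"
        using third_nbr[of v x t] deg mem t by auto
      then have "c = v'"
        using V hv adj_sym[OF c(4)] Ny[OF v(1)] ne vv' adj_irrefl by auto
      then have vv: "adj v v'" using c by simp
      have Nv: "adj v w \<longleftrightarrow> w = x \<or> w = v' \<or> w = t" if "w \<in> V" for w
        by (rule nbrs3[OF deg(4) adj'(3) vv tv(1)]) (use mem v ne tne t that in auto)
      have Nv': "adj v' w \<longleftrightarrow> w = y \<or> w = v \<or> w = t" if "w \<in> V" for w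
        by (rule nbrs3[OF deg(5) adj'(4) adj_sym[OF vv] tv(2)]) (use mem v ne tne t that in auto)
      have "AT V (ind X)"
      proof (rule AT_triangle_path_claw[OF V])
        show "distinct [x, h, v, y, v', t]" using X ne tne t vv' by auto
        show "{u \<in> V. adj x u} = {h, v}" using Nx mem v by blast
        show "{u \<in> V. adj y u} = {h, v'}" using Ny mem v by blast
        show "{u \<in> V. adj h u} = {x, y, t}" using Nh mem t by blast
        show "{u \<in> V. adj v u} = {x, v', t}" using Nv mem v t by blast
        show "{u \<in> V. adj v' u} = {y, v, t}" using Nv' mem v t by blast
        show "{u \<in> V. adj t u} = {h, v, v'}" using Nt mem v by blast
      qed (use X v tX in \<open>auto simp: ind_def\<close>)
      then show False using not_AT by simp
    qed
  qed
qed

text \<open>After deleting \<open>v\<close> at \<open>x\<close>, removing \<open>x\<close> as a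
  source and \<open>h\<close> as a sink, the rest has total deficiency 3, coming from
  \<open>y\<close>, \<open>v'\<close> and the third neighbour of \<open>h\<close>. It must be a
  triangle, and the whole graph is a prism minus an edge.\<close>

lemma not_triangle_at_high:
  assumes X: "X = {h, x, y}" "x \<noteq> y" "x \<noteq> h" "y \<noteq> h"
    and adj: "adj x h" "adj x v" "adj v h" "adj v v'" "adj y v'" "\<not> adj h v'"
    and v: "v \<in> V" "v \<notin> X" "v' \<in> V" "v' \<notin> X"
  shows False
proof -
  note adj' = adj(1-5)[THEN adj_sym]
  have mem: "x \<in> V" "y \<in> V" "h \<in> V" using X(1) X_subset by auto
  have ne: "v \<noteq> x" "v \<noteq> y" "v \<noteq> h" "v' \<noteq> x" "v' \<noteq> y" "v' \<noteq> h" "v \<noteq> v'"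
    using v X(1) adj_neq[OF adj(4)] by auto
  have deg: "dg h V = 3" "dg x V = 2" "dg y V = 2" "dg v V = 3" "dg v' V = 3"
    using high low[OF mem(1)] low[OF mem(2)] low[OF v(1)] low[OF v(3)] v ne X by (auto simp: ind_def)
  have Nx: "adj x w \<longleftrightarrow> w = h \<or> w = v" if "w \<in> V" for w
    by (rule nbrs2[OF deg(2) adj(1,2)]) (use mem v ne that in auto)
  have Nv: "adj v w \<longleftrightarrow> w = x \<or> w = h \<or> w = v'" if "w \<in> V" for w
    by (rule nbrs3[OF deg(4) adj'(2) adj(3,4)]) (use mem v ne X that in auto)
  obtain k where k: "k \<in> V" "k \<noteq> x" "k \<noteq> v" "adj h k"
    using third_nbr[of h x v] deg mem v ne by auto
  have kne: "k \<noteq> h" "k \<noteq> v'" using k(4) adj(6) adj_irrefl by auto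
  have Nh: "adj h w \<longleftrightarrow> w = x \<or> w = v \<or> w = k" if "w \<in> V" for w
    by (rule nbrs3[OF deg(1) adj'(1,3) k(4)]) (use mem v ne k that in auto)
  define g1 where "g1 = (\<lambda>w. ind X w + (if adj w v \<and> w \<noteq> x then 1 else 0))"
  \<comment> \<open>In \<open>g1\<close> the vertex \<open>h\<close> has deficiency 2, from
    \<open>X\<close> and from \<open>v\<close>, so it can only be a sink; \<open>g2\<close> charges
    its neighbours.\<close>
  define g2 where "g2 = (\<lambda>w. g1 w + (if adj w h then 1 else 0))"
  let ?M = "V - {v} - {x} - {h}"
  have n1: "\<not> AT (V - {v}) g1"
    using AT_delete_larger[OF finite_V mem(1) v(1) adj(2), of "ind X"] not_AT X v(2)
    unfolding g1_def by (auto simp: ind_def)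
  have "\<not> AT (V - {v} - {x}) g1"
  proof
    assume "AT (V - {v} - {x}) g1"
    moreover have "dg x (V - {v}) + g1 x \<le> 2"
      using dg_remove[OF v(1), of x] deg(2) adj(2) X(1) by (simp add: g1_def ind_def)
    ultimately show False using AT_source[of "V - {v}" x g1] n1 mem(1) ne finite_V by auto
  qed
  moreover have "g1 h \<le> 2" by (simp add: g1_def ind_def)
  ultimately have n2: "\<not> AT ?M g2"
    using AT_sink[of "V - {v} - {x}" h g1] mem(3) ne(3) X(3) finite_V unfolding g2_def by auto
  have MV: "?M \<subset> V" using v(1) by auto
  have finM: "finite ?M" using finite_V by auto
  have dgV: "dg w V = dg w ?M + (if adj w v then 1 else 0) + (if adj w x then 1 else 0) + (if adj w h then 1 else 0)" for w
  proof -
    have "dg w V = dg w (V - {v}) + (if adj w v then 1 else 0)" by (rule dg_remove[OF v(1)])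
    also have "dg w (V - {v}) = dg w (V - {v} - {x}) + (if adj w x then 1 else 0)"
      by (rule dg_remove) (use mem ne in auto)
    also have "dg w (V - {v} - {x}) = dg w ?M + (if adj w h then 1 else 0)"
      by (rule dg_remove) (use mem ne X in auto)
    finally show ?thesis by simp
  qed
  have nx: "\<not> adj w x" if "w \<in> ?M" for w
    using Nx[of w] that adj_sym[of w x] by auto
  have lowM: "dg w ?M + g2 w = 3" if "w \<in> ?M" for w
    using dgV[of w] nx[OF that] low[of w] that by (auto simp: g1_def g2_def)
  have hM: "dg h ?M = 1" "dg v ?M = 1" "dg x ?M = 0"
    using dgV[of h] dgV[of v] dgV[of x] deg adj(1-4) adj'(1-4) adj_irrefl by auto
  \<comment> \<open>Only one edge from \<open>v\<close> and one from \<open>h\<close> enter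
    \<open>?M\<close>, so two separated parts cannot both have boundary 2.\<close>
  have connM: "conn ?M"
    unfolding conn_def
  proof (intro allI impI)
    fix P assume P: "P \<subseteq> ?M" "P \<noteq> {}" "P \<noteq> ?M"
    define Q where "Q = ?M - P"
    have fin: "finite P" "finite Q" using finite_subset[OF P(1) finM] finM by (auto simp: Q_def)
    have PQ: "P \<union> Q = ?M" "P \<inter> Q = {}" "Q \<noteq> {}" using P by (auto simp: Q_def)
    show "\<exists>p\<in>P. \<exists>q\<in>?M - P. adj p q"
    proof (rule ccontr)
      assume "\<not> ?thesis"
      then have PQ0: "ee P Q = 0" using ee_eq_0_iff[OF fin(1)] by (auto simp: Q_def)
      then have QP0: "ee Q P = 0" using ee_commute[OF fin] by simp
      have ins: "ee S (insert a A) = dg a S + ee S A" if "a \<notin> A" "finite S" for a A S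
        using ee_Un_right[of "{a}" A S] that by (simp add: ee_singleton_right)
      have nm: "v \<notin> insert x (insert h Q)" "x \<notin> insert h Q" "h \<notin> Q"
        "v \<notin> insert x (insert h P)" "x \<notin> insert h P" "h \<notin> P"
        using PQ(1) X(3) ne by blast+
      have "cut P = ee P (insert v (insert x (insert h Q)))"
        by (rule ee_cut) (use PQ mem v in auto)
      then have c1: "cut P = dg v P + (dg x P + (dg h P + 0))"
        by (simp only: ins[OF nm(1) fin(1)] ins[OF nm(2) fin(1)] ins[OF nm(3) fin(1)] PQ0)
      have "cut Q = ee Q (insert v (insert x (insert h P)))"
        by (rule ee_cut) (use PQ mem v in auto)
      then have c2: "cut Q = dg v Q + (dg x Q + (dg h Q + 0))"
        by (simp only: ins[OF nm(4) fin(2)] ins[OF nm(5) fin(2)] ins[OF nm(6) fin(2)] QP0)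
      have "2 \<le> cut P" by (rule cut_ge_2) (use P(2) PQ(1) v in auto)
      moreover have "2 \<le> cut Q" by (rule cut_ge_2) (use PQ v in auto)
      moreover have "dg w ?M = dg w P + dg w Q" for w
        unfolding PQ(1)[symmetric] by (rule dg_Un_disjoint[OF PQ(2)])
      from this[of v] this[of x] this[of h]
      have "dg v P + dg v Q = 1" "dg x P + dg x Q = 0" "dg h P + dg h Q = 1" using hM by linarith+
      ultimately show False using c1 c2 by linarith
    qed
  qed
  have XM: "X \<inter> ?M = {y}" using X mem ne by auto
  have sum3: "sum g2 ?M = 3"
  proof -
    have "sum g2 ?M = (\<Sum>w\<in>?M. ind X w) + (\<Sum>w\<in>?M. if adj v w then 1 else 0) + (\<Sum>w\<in>?M. if adj h w then 1 else 0)"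
      unfolding sum.distrib[symmetric]
      by (rule sum.cong) (auto simp: g1_def g2_def dest: adj_sym)
    then show ?thesis
      using sum_ind[OF finM, of X] XM hM by (simp add: dg_eq_sum[OF finM, symmetric])
  qed
  have g2le: "g2 w \<le> 2" if "w \<in> ?M" for w
    using Nv[of w] adj_sym[of w v] adj(6) adj_sym[of w h] that v(4)
    by (auto simp: g1_def g2_def ind_def)
  have yM: "y \<in> ?M" "1 \<le> g2 y" using XM X(1) by (auto simp: g1_def g2_def ind_def)
  note tri = remainder_triangle[OF MV connM _ n2 _ g2le yM, OF lowM]
  have g21: "g2 w = 1" if "w \<in> ?M" for w using tri(1) that sum3 by simp
  have cM: "card ?M = 3" using tri(2) sum3 by simp
  have cl: "adj a b" if "a \<in> ?M" "b \<in> ?M" "a \<noteq> b" for a b using tri(3) that sum3 by simp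
  have kM: "k \<in> ?M" "v' \<in> ?M" using k kne v ne by auto
  have kX: "k \<notin> X" using g21[OF kM(1)] adj_sym[OF k(4)] by (auto simp: g2_def g1_def ind_def split: if_splits)
  then have ky: "k \<noteq> y" using X(1) by auto
  have M: "?M = {k, v', y}"
    by (rule card_seteq[symmetric]) (use finM kM yM cM kne ky ne in auto)
  have V: "V = {x, h, v, k, v', y}" using M mem v by auto
  have tri': "adj k v'" "adj v' y" "adj k y" using cl kM yM kne ky ne by auto
  note tri'' = tri'[THEN adj_sym]
  have dk: "dg k V = 3" using low[OF k(1) kne(1)] kX by (simp add: ind_def)
  have Nk: "adj k w \<longleftrightarrow> w = h \<or> w = y \<or> w = v'" if "w \<in> V" for w
    by (rule nbrs3[OF dk adj_sym[OF k(4)] tri'(3,1)]) (use mem v ne X that in auto)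
  have Nv': "adj v' w \<longleftrightarrow> w = v \<or> w = y \<or> w = k" if "w \<in> V" for w
    by (rule nbrs3[OF deg(5) adj'(4) tri'(2) tri''(1)]) (use mem v ne k ky that in auto)
  have Ny: "adj y w \<longleftrightarrow> w = v' \<or> w = k" if "w \<in> V" for w
    by (rule nbrs2[OF deg(3) adj(5) tri''(3)]) (use mem v ne k kne that in auto)
  have "AT V (ind X)"
  proof (rule AT_prism_minus_edge[OF V])
    show "distinct [x, h, v, k, v', y]" using X ne k kne ky by auto
    show "{u \<in> V. adj x u} = {h, v}" using Nx mem v by blast
    show "{u \<in> V. adj h u} = {x, v, k}" using Nh mem v k by blast
    show "{u \<in> V. adj v u} = {x, h, v'}" using Nv mem v by blast
    show "{u \<in> V. adj y u} = {v', k}" using Ny v k by blast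
    show "{u \<in> V. adj v' u} = {v, y, k}" using Nv' mem v k by blast
    show "{u \<in> V. adj k u} = {h, y, v'}" using Nk mem v by blast
  qed (use X v kX in \<open>auto simp: ind_def\<close>)
  then show False using not_AT by simp
qed

text \<open>At \<open>y\<close> the outcomes of \<open>trichotomy\<close> are a path
  \<open>x h y\<close> and a triangle \<open>x h v\<close>, both already excluded.\<close>

lemma not_near_high:
  assumes X: "X = {h, x, y}" "x \<noteq> y" "x \<noteq> h" "y \<noteq> h"
    and adj: "adj x h" "adj x v" and v: "v \<in> V" "v \<notin> X"
  shows False
proof -
  have mem: "x \<in> V" "y \<in> V" "h \<in> V" using X(1) X_subset by auto
  have ne: "v \<noteq> h" "v \<noteq> y" using v X(1) by auto
  have deg: "dg x V = 2" "dg y V = 2"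
    using low[OF mem(1)] low[OF mem(2)] X by (auto simp: ind_def)
  have Nx: "adj x w \<longleftrightarrow> w = h \<or> w = v" if "w \<in> V" for w
    by (rule nbrs2[OF deg(1) adj]) (use mem v ne that in auto)
  obtain v' where v': "v' \<in> V" "v' \<noteq> h" "adj y v'"
    using second_nbr[of y h] deg mem by auto
  have "v' \<noteq> x" using v'(3) Nx[OF mem(2)] X(4) ne adj_sym by blast
  then have v'X: "v' \<notin> X" using v' X(1) adj_irrefl by auto
  have X': "X = {h, y, x}" using X(1) by auto
  show False
  proof (rule trichotomy[OF X' X(2)[symmetric] X(4,3) v'(1) v'X v'(3)])
    assume near: "adj y h"
    show False using not_path_through_high[OF X adj(1) near adj(2) v'(3)] v v' v'X by blast
  next
    fix r
    assume triangle: "r \<in> V" "r \<notin> X" "adj x r" "adj r h" "adj r v'" "\<not> adj h v'"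
    then have "r = v" using Nx X(1) by blast
    then show False
      using not_triangle_at_high[OF X adj, of v'] triangle v v' v'X by blast
  qed
qed

text \<open>By \<open>not_near_high\<close> neither outcome of \<open>trichotomy\<close> can occur,
  so the other two vertices of \<open>X\<close> have all neighbours in \<open>X\<close>. Then
  \<open>X\<close> is a triangle left by at most one edge, against \<open>cut_ge_2\<close>.\<close>

lemma high_notin_X: "h \<notin> X"
proof
  assume hX: "h \<in> X"
  have "card (X - {h}) = 2" using card_X_eq hX finite_sub[OF X_subset] by simp
  then obtain x y where xy: "X - {h} = {x, y}" "x \<noteq> y" by (auto simp: card_2_iff)
  have X: "X = {h, x, y}" "x \<noteq> h" "y \<noteq> h" using xy hX by auto
  have key: False if X: "X = {h, x, y}" "x \<noteq> y" "x \<noteq> h" "y \<noteq> h"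
    and v: "v \<in> V" "v \<notin> X" "adj x v" for x y v
  proof (rule trichotomy[OF X v])
    assume near: "adj x h"
    show False using not_near_high[OF X near v(3,1,2)] .
  next
    fix r
    assume "r \<in> V" "r \<notin> X" "adj y h" "adj y r"
    moreover have "X = {h, y, x}" using X(1) by auto
    ultimately show False using not_near_high[of y x r] X by blast
  qed
  have mem: "x \<in> V" "y \<in> V" "h \<in> V" using X(1) X_subset by auto
  have ind: "ind X x = 1" "ind X y = 1" "ind X h = 1" using X by (auto simp: ind_def)
  have "2 \<le> cut X" by (rule cut_ge_2[OF X_subset X_nonempty X_neq_V])
  also have "cut X = dg h (V - X) + dg x (V - X) + dg y (V - X)"
    unfolding cut_def ee_def by (subst X(1), use X xy(2) in simp)
  finally have *: "2 \<le> dg h (V - X) + dg x (V - X) + dg y (V - X)" .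
  have X': "X = {h, y, x}" using X(1) by auto
  have "\<not> adj x w" if "w \<in> V - X" for w
    using key[OF X(1) xy(2) X(2,3)] that by blast
  then have x0: "dg x (V - X) = 0" by (simp only: dg_eq_0_iff) blast
  have "\<not> adj y w" if "w \<in> V - X" for w
    using key[OF X' xy(2)[symmetric] X(3,2)] that by blast
  then have y0: "dg y (V - X) = 0" by (simp only: dg_eq_0_iff) blast
  have dgX: "dg w V = (if adj w h then 1 else 0) + (if adj w x then 1 else 0) + (if adj w y then 1 else 0) + dg w (V - X)" for w
  proof -
    have "dg w X = (if adj w h then 1 else 0) + (if adj w x then 1 else 0) + (if adj w y then 1 else 0)"
      by (subst X(1)) (use X(2,3) xy(2) in \<open>simp add: dg_insert\<close>)
    then show ?thesis using dg_split[OF X_subset, of w] by simp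
  qed
  have "dg x V = 2" "dg y V = 2" "dg h V = 3"
    using low[OF mem(1) X(2)] low[OF mem(2) X(3)] high ind by simp_all
  have "dg x V \<le> 1" if "\<not> adj x h"
    using dgX[of x] x0 adj_irrefl[of x] that by simp
  then have "adj x h" using \<open>dg x V = 2\<close> by force
  have "dg y V \<le> 1" if "\<not> adj y h"
    using dgX[of y] y0 adj_irrefl[of y] that by simp
  then have "adj y h" using \<open>dg y V = 2\<close> by force
  have "dg h V = 2 + dg h (V - X)"
    using dgX[of h] adj_sym[OF \<open>adj x h\<close>] adj_sym[OF \<open>adj y h\<close>] adj_irrefl[of h] by simp
  then have "dg h (V - X) \<le> 1" using \<open>dg h V = 3\<close> by linarith
  with * x0 y0 show False by simp
qed

section \<open>A vertex of excess one outside \<open>X\<close>\<close>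

lemma dg_h: "dg h V = 4"
  using high high_notin_X by (simp add: ind_def)

lemma dg_eq_0D: "dg v S = 0 \<Longrightarrow> w \<in> S \<Longrightarrow> \<not> adj v w"
  by (simp add: dg_eq_0_iff)

lemma connI_no_split:
  assumes "finite R" "\<And>A B. A \<union> B = R \<Longrightarrow> A \<inter> B = {} \<Longrightarrow> A \<noteq> {} \<Longrightarrow> B \<noteq> {} \<Longrightarrow> ee A B \<noteq> 0"
  shows "conn R"
  unfolding conn_def
proof (intro allI impI)
  fix A assume A: "A \<subseteq> R" "A \<noteq> {}" "A \<noteq> R"
  have "ee A (R - A) \<noteq> 0" by (rule assms(2)) (use A in auto)
  then show "\<exists>p\<in>A. \<exists>q\<in>R - A. adj p q"
    unfolding ee_eq_0_iff[OF finite_subset[OF A(1) assms(1)]] by blast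
qed

text \<open>Here the third operation deletes \<open>h\<close> itself. All other vertices have excess
  0, so the core is joined to the rest only through \<open>h\<close>.\<close>

lemma not_AT_del_high:
  assumes u: "u \<in> X" "adj u h"
  obtains R where "R \<subseteq> V - {u, h}" "R \<noteq> {}" "\<not> AT R (del h)" "\<And>r k. r \<in> R \<Longrightarrow> k \<in> V - {h} - R \<Longrightarrow> \<not> adj r k"
proof -
  have uV: "u \<in> V" "u \<noteq> h" using u X_subset high_notin_X by auto
  obtain R where R: "R \<subseteq> V - {u, h}" "R \<noteq> {}" "\<not> AT R (\<lambda>w. ind X w + (if adj w h then 1 else 0))"
    "\<And>r. r \<in> R \<Longrightarrow> dg r (V - {h} - R) + 3 \<le> dg r V + ind X r"
    by (rule not_AT_delete_larger[OF finite_V uV(1) h_in u(2) _ _ not_AT])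
      (use u high_notin_X low[OF uV] in \<open>auto simp: ind_def\<close>)
  have no: "\<not> adj r k" if "r \<in> R" "k \<in> V - {h} - R" for r k
  proof -
    have "r \<in> V" "r \<noteq> h" using R(1) that(1) by auto
    then have "dg r (V - {h} - R) = 0" using R(4)[OF that(1)] low[of r] by simp
    then show ?thesis using that(2) by (rule dg_eq_0D)
  qed
  have "del h = (\<lambda>w. ind X w + (if adj w h then 1 else 0))"
    by (rule ext) (simp add: del_def)
  then have "\<not> AT R (del h)" using R(3) by simp
  from that[OF R(1,2) this no] show ?thesis .
qed

text \<open>The side \<open>P\<close> with a single vertex \<open>x\<close> of \<open>X\<close> must
  be a triangle. It forms a diamond with \<open>h\<close>, which allows \<open>x\<close> to be
  traded for \<open>h\<close> and yields a smaller instance on \<open>insert h Q\<close>.\<close>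

lemma not_cut_vertex_high:
  assumes PQ: "P \<union> Q = V - {h}" "P \<inter> Q = {}" "ee P Q = 0"
    and XP: "card (X \<inter> P) = 1" and dgP: "dg h P = 2" and dgQ: "dg h Q = 2"
  shows False
proof -
  have fin: "finite P" "finite Q" using PQ(1) finite_V by (metis finite_Diff finite_Un)+
  have sub: "P \<subseteq> V" "Q \<subseteq> V" "h \<notin> P" "h \<notin> Q" using PQ(1) by auto
  have no: "\<not> adj p q" "\<not> adj q p" if "p \<in> P" "q \<in> Q" for p q
    using ee_eq_0_iff[OF fin(1)] PQ(3) that adj_sym by blast+
  have conn: "conn S" if "S \<union> T = V - {h}" "S \<inter> T = {}" "ee S T = 0" "dg h S = 2" for S T
  proof (rule connI_no_split)
    show finS: "finite S" using that(1) finite_V by (metis finite_Diff finite_Un)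
    fix A B assume AB: "A \<union> B = S" "A \<inter> B = {}" "A \<noteq> {}" "B \<noteq> {}"
    show "ee A B \<noteq> 0"
    proof
      assume 0: "ee A B = 0"
      have fin: "finite A" "finite B" using AB(1) finS by (metis finite_Un)+
      have BA: "ee B A = 0" using ee_commute[OF fin] 0 by simp
      have "ee A T + ee B T = 0" using ee_Un_left[OF fin AB(2)] AB(1) that(3) by simp
      then have T: "ee A T = 0" "ee B T = 0" by auto
      have nm: "h \<notin> B \<union> T" "h \<notin> A \<union> T" "B \<inter> T = {}" "A \<inter> T = {}" using AB(1) that(1,2) by auto
      have "cut A = ee A ({h} \<union> (B \<union> T))"
        by (rule ee_cut) (use AB that h_in in auto)
      also have "\<dots> = ee A {h} + ee A (B \<union> T)" by (rule ee_Un_right) (use nm in auto)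
      also have "\<dots> = dg h A" using ee_Un_right[OF nm(3), of A] 0 T fin by (simp add: ee_singleton_right)
      finally have 1: "cut A = dg h A" .
      have "cut B = ee B ({h} \<union> (A \<union> T))"
        by (rule ee_cut) (use AB that h_in in auto)
      also have "\<dots> = ee B {h} + ee B (A \<union> T)" by (rule ee_Un_right) (use nm in auto)
      also have "\<dots> = dg h B" using ee_Un_right[OF nm(4), of B] BA T fin by (simp add: ee_singleton_right)
      finally have 2: "cut B = dg h B" .
      have SV: "S \<subseteq> V" "h \<notin> S" using that(1) by auto
      then have "A \<subseteq> V" "A \<noteq> V" "B \<subseteq> V" "B \<noteq> V" using AB(1) h_in by auto
      then have "2 \<le> cut A" "2 \<le> cut B" using cut_ge_2 AB(3,4) by blast+
      moreover have "dg h S = dg h A + dg h B" using dg_Un_disjoint[OF AB(2), of h] AB(1) by simp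
      ultimately show False using 1 2 that(4) by linarith
    qed
  qed
  have connP: "conn P" by (rule conn[OF PQ dgP])
  have connQ: "conn Q"
    by (rule conn[of Q P]) (use PQ dgQ ee_commute[OF fin] in auto)
  have PV: "P \<subset> V" using sub h_in by blast
  have lowP: "dg w P + del h w = 3" if "w \<in> P" for w
  proof -
    have wV: "w \<in> V" "w \<noteq> h" using that sub by auto
    have "dg w Q = 0" using no(1)[OF that] by (simp add: dg_eq_0_iff)
    then show ?thesis
      using dg_remove[OF h_in, of w] dg_Un_disjoint[OF PQ(2), of w] low[OF wV]
      by (simp add: del_def PQ(1))
  qed
  have sumP: "sum (del h) P = 3" using sum_del[OF fin(1), of h] XP dgP by simp
  obtain x where x: "X \<inter> P = {x}" using XP by (auto simp: card_1_singleton_iff)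
  then have xP: "x \<in> P" "x \<in> X" by auto
  have x1: "1 \<le> del h x" using xP by (simp add: del_def ind_def)
  have XQ: "card (X \<inter> Q) = 2"
  proof -
    have "X = (X \<inter> P) \<union> (X \<inter> Q)" using X_subset PQ(1) high_notin_X by blast
    then have "card X = card (X \<inter> P) + card (X \<inter> Q)"
      using fin PQ(2) by (metis card_Un_disjoint finite_Int inf.commute inf_assoc inf_bot_right inf_left_commute)
    then show ?thesis using card_X_eq XP by simp
  qed
  \<comment> \<open>Either \<open>h\<close> has a neighbour in \<open>X \<inter> Q\<close>, and
    deleting \<open>h\<close> there leaves exactly \<open>P\<close> as core; or \<open>Q\<close>
    contains two vertices of \<open>X\<close> and two other neighbours of \<open>h\<close>, and |V|
    <= 8 leaves at most three vertices for \<open>P\<close>.\<close>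
  have tri: "(\<forall>w\<in>P. del h w = 1) \<and> card P = 3 \<and> (\<forall>a\<in>P. \<forall>b\<in>P. a \<noteq> b \<longrightarrow> adj a b)"
  proof (cases "\<exists>u\<in>X \<inter> Q. adj u h")
    case True
    then obtain u where u: "u \<in> X" "u \<in> Q" "adj u h" by blast
    obtain R where R: "R \<subseteq> V - {u, h}" "R \<noteq> {}" "\<not> AT R (del h)"
      "\<And>r k. r \<in> R \<Longrightarrow> k \<in> V - {h} - R \<Longrightarrow> \<not> adj r k"
      using not_AT_del_high[OF u(1,3)] by blast
    have all: "S \<subseteq> R \<or> S \<inter> R = {}" if "conn S" "S \<subseteq> V - {h}" for S
    proof (rule ccontr)
      assume n: "\<not> ?thesis"
      show False
        by (rule connD[OF that(1), of "S \<inter> R"]) (use n R(4) that(2) in blast)+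
    qed
    have "Q \<inter> R = {}" using all[OF connQ] u(2) R(1) PQ(1) by blast
    then have "R \<subseteq> P" using R(1) PQ(1) by blast
    then have "R = P" using all[OF connP] PQ(1) R(2) by blast
    then show ?thesis
      using remainder_triangle[OF PV connP lowP _ _ del_le_2 xP(1) x1] R(3) sumP by (metis order_refl)
  next
    case False
    have "card (X \<inter> Q \<union> {w \<in> Q. adj h w}) = 4"
      using False XQ dgQ fin adj_sym
      by (subst card_Un_disjoint) (auto simp: dg_def)
    moreover have "card (X \<inter> Q \<union> {w \<in> Q. adj h w}) \<le> card Q"
      using fin by (intro card_mono) auto
    moreover have "card V = card P + card Q + 1"
    proof -
      have "card (V - {h}) = card P + card Q" using card_Un_disjoint[OF fin PQ(2)] PQ(1) by simp
      then show ?thesis using h_in finite_V by (metis Suc_eq_plus1 card_Suc_Diff1)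
    qed
    ultimately have cP: "card P \<le> 3" using card_V_le by linarith
    have del1: "1 \<le> del h w" if "w \<in> P" for w
      using lowP[OF that] dg_less_card[OF fin(1) that] cP by linarith
    have "2 \<le> card P"
      using dgP card_mono[OF fin(1), of "{w \<in> P. adj h w}"] by (simp add: dg_def)
    have c3: "card P = 3"
    proof (rule ccontr)
      assume "card P \<noteq> 3"
      then have c2: "card P = 2" using cP \<open>2 \<le> card P\<close> by simp
      have "2 \<le> del h w" if "w \<in> P" for w
        using lowP[OF that] dg_less_card[OF fin(1) that] c2 by linarith
      then have "(\<Sum>w\<in>P. 2) \<le> sum (del h) P" by (intro sum_mono) auto
      then show False using c2 sumP by simp
    qed
    have eq1: "del h w = 1" if "w \<in> P" for w
    proof (rule ccontr)
      assume "del h w \<noteq> 1"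
      then have "2 \<le> del h w" using del1[OF that] by linarith
      moreover have "sum (del h) P = del h w + sum (del h) (P - {w})"
        using fin(1) that by (simp add: sum.remove)
      moreover have "(\<Sum>w\<in>P - {w}. 1) \<le> sum (del h) (P - {w})"
        by (intro sum_mono) (use del1 in auto)
      ultimately show False using sumP c3 fin(1) that by simp
    qed
    have "adj a b" if "a \<in> P" "b \<in> P" "a \<noteq> b" for a b
    proof -
      have "{w \<in> P. adj a w} = P - {a}"
      proof (rule card_seteq)
        show "card (P - {a}) \<le> card {w \<in> P. adj a w}"
          using lowP[OF that(1)] eq1[OF that(1)] c3 that(1) fin by (simp add: dg_def)
      qed (use fin adj_irrefl in auto)
      then show ?thesis using that by auto
    qed
    then show ?thesis using eq1 c3 by blast
  qed
  have "card (P - {x}) = 2" using tri xP(1) fin by simp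
  then obtain a b where ab: "P - {x} = {a, b}" "a \<noteq> b" by (auto simp: card_2_iff)
  then have P: "P = {x, a, b}" "a \<noteq> x" "b \<noteq> x" using xP(1) by auto
  have abX: "a \<notin> X" "b \<notin> X" using x P by auto
  have adj: "adj x a" "adj x b" "adj a b" "adj a x" "adj b x" "adj b a" using tri P ab(2) by auto
  have "adj w h" if "w \<in> P" "w \<notin> X" for w
  proof -
    have "del h w = 1" using tri that(1) by blast
    then show ?thesis using that(2) by (simp add: del_def ind_def split: if_splits)
  qed
  then have abh: "adj a h" "adj b h" using P abX by auto
  have mem: "x \<in> V" "a \<in> V" "b \<in> V" "a \<noteq> h" "b \<noteq> h" "x \<noteq> h" using P sub by auto
  have deg: "dg x V = 2" "dg b V = 3"
    using low[OF mem(1,6)] low[OF mem(3,5)] xP abX by (simp_all add: ind_def)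
  define g where "g = (\<lambda>w. ind X w + (if adj w a \<and> w \<noteq> x then 1 else 0))"
  have n1: "\<not> AT (V - {a}) g"
    using AT_delete_larger[OF finite_V mem(1,2) adj(1), of "ind X"] not_AT xP abX
    unfolding g_def by (auto simp: ind_def)
  have n2: "\<not> AT (V - {a} - {x}) g"
  proof
    assume "AT (V - {a} - {x}) g"
    moreover have "dg x (V - {a}) + g x \<le> 2"
      using dg_remove[OF mem(2), of x] deg(1) adj(1) xP by (simp add: g_def ind_def)
    ultimately show False using AT_source[of "V - {a}" x g] n1 mem P(2) finite_V by auto
  qed
  have n3: "\<not> AT (V - {a} - {x} - {b}) g"
  proof
    assume "AT (V - {a} - {x} - {b}) g"
    moreover have "dg b V = dg b (V - {a} - {x}) + 2"
      using dg_remove[OF mem(2), of b] dg_remove[of x "V - {a}" b] mem P(2) adj by simp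
    then have "dg b (V - {a} - {x}) + g b \<le> 2"
      using deg(2) abX by (simp add: g_def ind_def)
    ultimately show False using AT_source[of "V - {a} - {x}" b g] n2 mem P ab(2) finite_V by auto
  qed
  have W: "V - {a} - {x} - {b} = insert h Q" using PQ(1,2) P(1) h_in mem by blast
  \<comment> \<open>Deleting \<open>a\<close> at \<open>x\<close> charges \<open>h\<close>, and
    \<open>x\<close> and \<open>b\<close> then leave as sources at no cost: the deficiency of
    \<open>x\<close> has moved to \<open>h\<close>.\<close>
  define Y where "Y = insert h (X \<inter> Q)"
  have "g w = ind Y w" if "w \<in> insert h Q" for w
  proof (cases "w = h")
    case True
    then show ?thesis using adj_sym[OF abh(1)] high_notin_X mem by (simp add: g_def ind_def Y_def)
  next
    case False
    then have "w \<in> Q" using that by simp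
    then have "\<not> adj w a" using no(2)[of a w] P by simp
    then show ?thesis using False \<open>w \<in> Q\<close> by (simp add: g_def ind_def Y_def)
  qed
  then have n4: "\<not> AT (insert h Q) (ind Y)"
    using n3 AT_cong[of "insert h Q" g "ind Y"] unfolding W by blast
  have "AT (insert h Q) (ind Y)"
  proof (rule minimal)
    show "insert h Q \<subset> V" using sub h_in mem(1) xP(1) PQ(2) mem(6) by blast
    show "Y \<subseteq> insert h Q" by (auto simp: Y_def)
    show "card Y \<le> 3" using XQ high_notin_X fin by (simp add: Y_def)
    have X: "X = insert x (X \<inter> Q)" using x X_subset PQ(1) high_notin_X by blast
    \<comment> \<open>\<open>x\<close> and \<open>h\<close> are the tips of the diamond with middle
      edge \<open>ab\<close>, so they always share a colour.\<close>
    have same: "\<phi> ` Y = \<phi> ` X" if "coloring V \<phi>" for \<phi>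
    proof -
      have ran: "\<phi> w \<in> {0, 1, 2}" if "w \<in> V" for w using \<open>coloring V \<phi>\<close> that by (auto simp: coloring_def)
      have dif: "\<phi> a \<noteq> \<phi> b" if "adj a b" "a \<in> V" "b \<in> V" for a b
        using \<open>coloring V \<phi>\<close> that by (auto simp: coloring_def)
      have "\<phi> h = \<phi> x"
        using ran[OF h_in] ran[OF mem(1)] ran[OF mem(2)] ran[OF mem(3)]
          dif[OF adj(1)] dif[OF adj(2)] dif[OF adj(3)] dif[OF abh(1)] dif[OF abh(2)] h_in mem by auto
      then show ?thesis by (subst X) (simp add: Y_def)
    qed
    have "unblocked V Y"
      using unblocked_X[OF card_X_eq] same unfolding unblocked_def by metis
    then show "unblocked (insert h Q) Y"
      using unblocked_subset sub h_in by blast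
  qed
  then show False using n4 by simp
qed

text \<open>Both sides of a cut vertex \<open>h\<close> receive two of its four edges, so each
  contains a vertex of \<open>X\<close>; one of them contains exactly one.\<close>

lemma conn_without_high: "conn (V - {h})"
proof (rule connI_no_split)
  show "finite (V - {h})" using finite_V by simp
  fix P Q assume PQ: "P \<union> Q = V - {h}" "P \<inter> Q = {}" "P \<noteq> {}" "Q \<noteq> {}"
  show "ee P Q \<noteq> 0"
  proof
    assume 0: "ee P Q = 0"
    have fin: "finite P" "finite Q" using PQ(1) finite_V by (metis finite_Diff finite_Un)+
    have sub: "P \<subseteq> V" "Q \<subseteq> V" "h \<notin> P" "h \<notin> Q" using PQ(1) by auto
    have QP: "ee Q P = 0" using ee_commute[OF fin] 0 by simp
    have "cut P = ee P ({h} \<union> Q)" by (rule ee_cut) (use PQ h_in in auto)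
    also have "\<dots> = ee P {h} + ee P Q" by (rule ee_Un_right) (use sub in auto)
    finally have 1: "cut P = dg h P" using 0 fin by (simp add: ee_singleton_right)
    have "cut Q = ee Q ({h} \<union> P)" by (rule ee_cut) (use PQ h_in in auto)
    also have "\<dots> = ee Q {h} + ee Q P" by (rule ee_Un_right) (use sub in auto)
    finally have 2: "cut Q = dg h Q" using QP fin by (simp add: ee_singleton_right)
    have neV: "P \<noteq> V" "Q \<noteq> V" using sub h_in by auto
    have "dg h P + dg h Q = 4"
      using dg_remove[OF h_in, of h] dg_Un_disjoint[OF PQ(2), of h] PQ(1) dg_h adj_irrefl by simp
    then have d: "dg h P = 2" "dg h Q = 2"
      using 1 2 cut_ge_2[OF sub(1) PQ(3) neV(1)] cut_ge_2[OF sub(2) PQ(4) neV(2)] by linarith+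
    have "X = (X \<inter> P) \<union> (X \<inter> Q)" using X_subset PQ(1) high_notin_X by blast
    then have "card X = card (X \<inter> P) + card (X \<inter> Q)"
      using fin PQ(2) by (metis card_Un_disjoint finite_Int inf.commute inf_assoc inf_bot_right inf_left_commute)
    moreover have "3 \<le> 2 + card (X \<inter> P)" "3 \<le> 2 + card (X \<inter> Q)"
      using cut_plus_card_ge_3[OF sub(1) PQ(3) neV(1)] cut_plus_card_ge_3[OF sub(2) PQ(4) neV(2)] 1 2 d
      by simp_all
    ultimately have "card (X \<inter> P) = 1 \<or> card (X \<inter> Q) = 1" using card_X_eq by linarith
    then show False
      using not_cut_vertex_high[OF PQ(1,2) 0 _ d] not_cut_vertex_high[of Q P] PQ QP d by blast
  qed
qed

text \<open>A neighbour of \<open>h\<close> in \<open>X\<close> would make \<open>h\<close> a cut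
  vertex. Otherwise \<open>h\<close>, its four neighbours and \<open>X\<close> already account for
  eight vertices, so they are all of \<open>V\<close>.\<close>

lemma no_high_vertex: False
proof (cases "\<exists>u\<in>X. adj u h")
  case True
  then obtain u where u: "u \<in> X" "adj u h" by blast
  have uV: "u \<in> V - {h}" using u X_subset high_notin_X by auto
  obtain R where R: "R \<subseteq> V - {u, h}" "R \<noteq> {}"
    "\<And>r k. r \<in> R \<Longrightarrow> k \<in> V - {h} - R \<Longrightarrow> \<not> adj r k"
    by (rule not_AT_del_high[OF u]) blast
  show False
    by (rule connD[OF conn_without_high, of R]) (use R uV in blast)+
next
  case False
  let ?N = "{w \<in> V. adj h w}"
  have cN: "card ?N = 4" using dg_h by (simp add: dg_def)
  have V: "insert h (X \<union> ?N) = V"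
  proof (rule card_seteq)
    have "X \<inter> ?N = {}" using False adj_sym by blast
    then have "card (X \<union> ?N) = 7"
      using card_X_eq cN finite_V X_subset finite_sub by (simp add: card_Un_disjoint)
    moreover have "h \<notin> X \<union> ?N" using high_notin_X adj_irrefl by auto
    moreover have "finite (X \<union> ?N)" using finite_V X_subset finite_sub by auto
    ultimately show "card V \<le> card (insert h (X \<union> ?N))" using card_V_le by simp
  qed (use finite_V X_subset h_in in auto)
  have "2 \<le> cut X" by (rule cut_ge_2[OF X_subset X_nonempty X_neq_V])
  then have "ee X (V - X) \<noteq> 0" by (simp add: cut_def)
  then obtain u v where uv: "u \<in> X" "v \<in> V" "v \<notin> X" "adj u v"
    using ee_eq_0_iff[OF finite_sub[OF X_subset]] by auto
  have vh: "v \<noteq> h" using False uv by auto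
  have hv: "adj h v" using V uv vh by blast
  obtain R K where RK: "R \<subseteq> V" "K \<subseteq> V" "K \<union> R = V - {v}" "K \<inter> R = {}" "u \<in> K" "h \<in> R" "dg h K = 1"
    "\<And>r k. r \<in> R \<Longrightarrow> r \<noteq> h \<Longrightarrow> k \<in> K \<Longrightarrow> \<not> adj r k" "1 \<le> dg v R" "1 \<le> dg v K" "dg v R + dg v K = 3"
    by (rule remainder[of u v]) (use uv vh high_notin_X in auto)
  have fin: "finite R" "finite K" using RK finite_sub by auto
  have dgV: "dg w V = dg w K + dg w R + (if adj w v then 1 else 0)" for w
    using dg_remove[OF uv(2), of w] dg_Un_disjoint[OF RK(4), of w] RK(3) by simp
  show False
  proof (cases "dg v K = 1")
    case True
    \<comment> \<open>Vertices of \<open>X\<close> have degree 2 and miss \<open>h\<close>, the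
      others in \<open>K\<close> have degree 3 and see \<open>h\<close>; either way two edges remain
      in \<open>K\<close> or go to \<open>v\<close>. With exactly one edge to \<open>v\<close>, the
      degree sum inside \<open>K\<close> is odd.\<close>
    have "dg w K + (if adj w v then 1 else 0) = 2" if w: "w \<in> K" for w
    proof -
      have wh: "w \<noteq> h" using w RK(4,6) by auto
      have "{r \<in> R. adj w r} = (if adj w h then {h} else {})"
        using RK(6) RK(8)[OF _ _ w] adj_sym[of w] by (auto split: if_splits)
      then have "dg w R = (if adj w h then 1 else 0)" by (simp add: dg_def)
      moreover have "w \<in> X \<longleftrightarrow> \<not> adj w h" using V w wh RK(2) False adj_sym by blast
      ultimately show ?thesis
        using dgV[of w] low[of w] w wh RK(2) by (auto simp: ind_def)
    qed
    then have "(\<Sum>w\<in>K. dg w K + (if adj w v then 1 else 0)) = (\<Sum>w\<in>K. 2)" by (intro sum.cong) auto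
    moreover have "(\<Sum>w\<in>K. if adj w v then 1 else 0) = dg v K"
      unfolding dg_eq_sum[OF fin(2)] by (rule sum.cong) (auto dest: adj_sym)
    ultimately have "ee K K + 1 = 2 * card K"
      using True by (simp add: sum.distrib ee_def)
    then show False using even_ee_self[OF fin(2)] by (metis even_mult_iff even_plus_one_iff even_two_times_div_two even_numeral)
  next
    \<comment> \<open>The only edge from \<open>v\<close> into \<open>R\<close> goes to
      \<open>h\<close>, so \<open>h\<close> separates the rest of \<open>R\<close>, against
      \<open>conn_without_high\<close>.\<close>
    case not1: False
    then have vR: "dg v R = 1" using RK(9-11) by linarith
    let ?R = "R - {h}"
    have "dg v R = dg v ?R + (if adj v h then 1 else 0)" by (rule dg_remove[OF RK(6)])
    then have "dg v ?R = 0" using vR adj_sym[OF hv] by simp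
    then have vR': "\<not> adj v r" if "r \<in> ?R" for r using that by (rule dg_eq_0D)
    have "dg h R = dg h ?R" using dg_remove[OF RK(6), of h] adj_irrefl[of h] by simp
    moreover have "dg h V = dg h K + dg h R + 1" using dgV[of h] hv by simp
    ultimately have "dg h ?R = 2" using dg_h RK(7) by linarith
    then have "?R \<noteq> {}" using dg_empty[of h] by force
    show False
    proof (rule connD[OF conn_without_high, of ?R])
      show "?R \<subseteq> V - {h}" "?R \<noteq> {}" using RK(1) \<open>?R \<noteq> {}\<close> by auto
      show "?R \<noteq> V - {h}" using uv(2) vh RK(3) by blast
      fix p q assume pq: "p \<in> ?R" "q \<in> V - {h}" "q \<notin> ?R" "adj p q"
      then have "q \<in> K \<or> q = v" using RK(3) by blast
      then show False using pq vR'[OF pq(1)] RK(8)[of p q] adj_sym[OF pq(4)] by blast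
    qed
  qed
qed

end

section \<open>From nonvanishing coefficients to orientations\<close>

lemma outdeg_eq_out_count:
  assumes "distinct es"
  shows "outdeg (set es) v = out_count es v"
proof -
  have "outdeg (set es) v = card {e \<in> set es. fst e = v}"
    unfolding outdeg_def
    by (rule bij_betw_same_card[of "Pair v"]) (auto simp: bij_betw_def inj_on_def image_iff)
  then show ?thesis
    using distinct_card[OF distinct_filter[OF assms], of "\<lambda>e. fst e = v"]
    by (simp add: out_count_def)
qed

lemma flip_same_edges:
  assumes "list_all2 (\<lambda>e e'. e' = e \<or> e' = prod.swap e) es es'"
  shows "e \<in> set es \<or> prod.swap e \<in> set es \<longleftrightarrow> e \<in> set es' \<or> prod.swap e \<in> set es'"
  using assms
proof (induction es es' rule: list_all2_induct)
  case (Cons f fs f' fs')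
  have "e = f \<or> prod.swap e = f \<longleftrightarrow> e = f' \<or> prod.swap e = f'"
    using Cons(1) by (metis swap_swap)
  then show ?case using Cons(3) by auto
qed simp

lemma flip_antisym:
  assumes "list_all2 (\<lambda>e e'. e' = e \<or> e' = prod.swap e) es es'"
    "distinct es" "\<And>e. e \<in> set es \<Longrightarrow> prod.swap e \<notin> set es"
  shows "distinct es' \<and> (\<forall>e\<in>set es'. prod.swap e \<notin> set es')"
  using assms
proof (induction es es' rule: list_all2_induct)
  case (Cons f fs f' fs')
  have f: "f \<notin> set fs" "prod.swap f \<notin> set fs" "prod.swap f \<noteq> f"
    using Cons.prems(1) Cons.prems(2)[of f] by auto
  have IH: "distinct fs'" "\<And>e. e \<in> set fs' \<Longrightarrow> prod.swap e \<notin> set fs'"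
    using Cons.IH Cons.prems by auto
  have "f' \<notin> set fs'" "prod.swap f' \<notin> set fs'"
    using flip_same_edges[OF Cons(2), of f] f(1,2) Cons(1) by (auto simp: swap_swap)
  moreover have "prod.swap f' \<noteq> f'" using Cons(1) f(3) by (metis swap_swap)
  ultimately show ?case using IH by (auto simp: swap_swap)
qed simp

text \<open>\<open>m\<close> may differ from the outdegrees of \<open>es\<close>; reorienting the
  edges turns it into an outdegree vector and changes the coefficient at most by a sign.\<close>

lemma (in sgraph) AT_imp_f_AT:
  assumes "AT V g" "finite V" and f: "\<And>v. v \<in> V \<Longrightarrow> f v + g v = 3"
    and E: "\<And>a b. {a, b} \<in> E \<longleftrightarrow> a \<in> V \<and> b \<in> V \<and> adj a b"
  shows "f_AT V E f"
proof -
  obtain es m where es: "edge_list V es" "gcoeff es m \<noteq> 0" "\<And>v. v \<in> V \<Longrightarrow> m v + g v \<le> 2"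
    using assms(1) unfolding AT_def by blast
  have el: "distinct es" "\<And>a b. (a, b) \<in> set es \<Longrightarrow> a \<in> V \<and> b \<in> V \<and> adj a b"
    "\<And>a b. a \<in> V \<Longrightarrow> b \<in> V \<Longrightarrow> adj a b \<Longrightarrow> (a, b) \<in> set es \<longleftrightarrow> (b, a) \<notin> set es"
    using es(1) unfolding edge_list_def by blast+
  obtain es' where es': "list_all2 (\<lambda>e e'. e' = e \<or> e' = prod.swap e) es es'" "m = out_count es'"
    using gcoeff_obtain_orientation[OF es(2)] by blast
  have "prod.swap e \<notin> set es" if "e \<in> set es" for e
    using el(2)[of "fst e" "snd e"] el(3)[of "fst e" "snd e"] that by (cases e) simp
  then have D: "distinct es'" "\<And>e. e \<in> set es' \<Longrightarrow> prod.swap e \<notin> set es'"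
    using flip_antisym[OF es'(1) el(1)] by blast+
  have edges: "(a, b) \<in> set es' \<or> (b, a) \<in> set es' \<longleftrightarrow> a \<in> V \<and> b \<in> V \<and> adj a b" for a b
    using flip_same_edges[OF es'(1), of "(a, b)"] el(2)[of a b] el(2)[of b a] el(3)[of a b] adj_sym[of b a]
    by auto
  have sub: "set es' \<subseteq> V \<times> V" using edges by auto
  have "diff V (set es') = gcoeff es' m"
    using diff_eq_gcoeff[OF D(1) sub assms(2)] es'(2) by simp
  also have "\<dots> \<noteq> 0" using gcoeff_flip[OF es'(1)] es(2) by auto
  finally have "diff V (set es') \<noteq> 0" .
  moreover have "orientation V E (set es')"
    unfolding orientation_def
  proof (intro conjI allI impI ballI)
    show "case e of (u, v) \<Rightarrow> {u, v} \<in> E" if "e \<in> set es'" for e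
      using edges that E by (cases e) auto
    show "(u, v) \<in> set es' \<longleftrightarrow> (v, u) \<notin> set es'" if "{u, v} \<in> E" for u v
      using edges[of u v] D(2)[of "(u, v)"] E[of u v] that by auto
  qed
  moreover have "int (outdeg (set es') v) \<le> int (f v) - 1" if "v \<in> V" for v
    using es(3)[OF that] f[OF that] outdeg_eq_out_count[OF D(1), of v] es'(2) by simp
  ultimately show ?thesis unfolding f_AT_def AT_orientation_def by blast
qed

lemma (in sgraph) sparse_AT:
  assumes "finite V" "\<And>S. S \<subseteq> V \<Longrightarrow> S \<noteq> {} \<Longrightarrow> 5 * ee S S < 14 * card S"
    "X \<subseteq> V" "card X \<le> 3" "card X = 3 \<Longrightarrow> unblocked V X"
  shows "AT V (ind X)"
  using assms
proof (induction V arbitrary: X rule: finite_psubset_induct)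
  case (psubset V)
  show ?case
  proof (rule ccontr)
    assume not: "\<not> AT V (ind X)"
    interpret minimal_counterexample adj V X
    proof
      show "AT W (ind Y)" if "W \<subset> V" "Y \<subseteq> W" "card Y \<le> 3" "card Y = 3 \<Longrightarrow> unblocked W Y" for W Y
        by (rule psubset.IH[OF that(1) _ that(2,3,4)]) (use psubset.prems(1) that(1) in auto)
    qed (use psubset not in auto)
    obtain h where h: "h \<in> V" "dg h V + ind X h = 4"
      "\<And>v. v \<in> V \<Longrightarrow> v \<noteq> h \<Longrightarrow> dg v V + ind X v = 3" "card X = 3" "card V \<le> 8"
      using exists_high by blast
    interpret high_vertex adj V X h
      by unfold_locales (use h in auto)
    show False by (rule no_high_vertex)
  qed
qed

section \<open>Simple graphs\<close>

lemma simple_graph_edge: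
  assumes "simple_graph V E" "{a, b} \<in> E"
  shows "a \<noteq> b" "a \<in> V" "b \<in> V"
proof -
  obtain u v where "{a, b} = {u, v}" "u \<noteq> v" "u \<in> V" "v \<in> V"
    using assms unfolding simple_graph_def by blast
  then show "a \<noteq> b" "a \<in> V" "b \<in> V" by (auto simp: doubleton_eq_iff)
qed

lemma sgraph_of_simple_graph:
  assumes "simple_graph V E"
  shows "sgraph (\<lambda>a b. {a, b} \<in> E)"
proof
  show "{b, a} \<in> E" if "{a, b} \<in> E" for a b using that by (simp add: insert_commute)
  show "{a, a} \<notin> E" for a using simple_graph_edge(1)[OF assms, of a a] by auto
  show "finite {w. {v, w} \<in> E}" for v
    by (rule finite_subset[of _ V])
      (use assms simple_graph_edge[OF assms] in \<open>auto simp: simple_graph_def\<close>)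
qed

lemma card_induced_edges:
  assumes G: "simple_graph V E" and "finite S"
  shows "2 * card {e \<in> E. e \<subseteq> S} = sgraph.ee (\<lambda>a b. {a, b} \<in> E) S S"
  using assms(2)
proof (induction S rule: finite_induct)
  case empty
  interpret sgraph "\<lambda>a b. {a, b} \<in> E" by (rule sgraph_of_simple_graph[OF G])
  have "{e \<in> E. e \<subseteq> {}} = {}" using G by (auto simp: simple_graph_def)
  then show ?case by simp
next
  case (insert v S)
  interpret sgraph "\<lambda>a b. {a, b} \<in> E" by (rule sgraph_of_simple_graph[OF G])
  let ?N = "{w \<in> S. {v, w} \<in> E}"
  have "{e \<in> E. e \<subseteq> insert v S} = {e \<in> E. e \<subseteq> S} \<union> (\<lambda>w. {v, w}) ` ?N"
  proof -
    have "e \<subseteq> S \<or> (\<exists>w\<in>?N. e = {v, w})" if "e \<in> E" "e \<subseteq> insert v S" for e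
    proof -
      from G[unfolded simple_graph_def, THEN conjunct2, rule_format, OF that(1)]
      obtain a b where ab: "e = {a, b}" "a \<noteq> b" by blast
      show ?thesis
      proof (cases "a = v")
        case True
        then have "b \<in> ?N" using ab that by auto
        then show ?thesis using ab(1) True by blast
      next
        case a: False
        show ?thesis
        proof (cases "b = v")
          case True
          then have e: "e = {v, a}" using ab(1) by blast
          then have "a \<in> ?N" using a that by auto
          then show ?thesis using e by blast
        next
          case False
          then show ?thesis using a ab(1) that(2) by auto
        qed
      qed
    qed
    then show ?thesis by auto
  qed
  moreover have "{e \<in> E. e \<subseteq> S} \<inter> (\<lambda>w. {v, w}) ` ?N = {}" using insert.hyps(2) by auto
  moreover have "card ((\<lambda>w. {v, w}) ` ?N) = dg v S"
    unfolding dg_def by (rule card_image) (auto simp: inj_on_def doubleton_eq_iff)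
  moreover have "finite {e \<in> E. e \<subseteq> S}"
    by (rule finite_subset[of _ "Pow S"]) (use insert.hyps(1) in auto)
  ultimately have "card {e \<in> E. e \<subseteq> insert v S} = card {e \<in> E. e \<subseteq> S} + dg v S"
    using insert.hyps(1) by (simp add: card_Un_disjoint)
  then show ?case using insert.IH ee_insert_self[OF insert.hyps] by simp
qed

lemma mad_ge:
  assumes G: "simple_graph V E" and S: "S \<subseteq> V" "S \<noteq> {}"
  shows "2 * real (card {e \<in> E. e \<subseteq> S}) / real (card S) \<le> mad V E"
  unfolding mad_def
proof (rule Max_ge)
  have "E \<subseteq> Pow V" using G by (auto simp: simple_graph_def)
  moreover have "finite V" using G by (simp add: simple_graph_def)
  \<comment> \<open>\<open>Max\<close> is only meaningful on finite sets; the quotients in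
    \<open>mad\<close> come from finitely many pairs \<open>(W, F)\<close>.\<close>
  ultimately have "finite (Pow V \<times> Pow E)" using finite_subset by blast
  then show "finite {2 * real (card F) / real (card W) |W F. subgraph W F V E \<and> W \<noteq> {}}"
    by (rule finite_surj[of _ _ "\<lambda>(W, F). 2 * real (card F) / real (card W)"])
      (auto simp: subgraph_def)
  have "subgraph S {e \<in> E. e \<subseteq> S} V E" using S by (auto simp: subgraph_def)
  then show "2 * real (card {e \<in> E. e \<subseteq> S}) / real (card S)
      \<in> {2 * real (card F) / real (card W) |W F. subgraph W F V E \<and> W \<noteq> {}}"
    using S(2) by blast
qed

theorem mainTheorem6:
  fixes V :: "'a set" and E :: "'a set set" and x y z :: 'a
  assumes "simple_graph V E"
    and "mad V E < 14 / 5"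
    and "x \<in> V" and "y \<in> V" and "z \<in> V"
    and "x \<noteq> y" and "x \<noteq> z" and "y \<noteq> z"
    and "\<not> blocked V E x y z"
  shows "AT_extendable V E [(x, 2), (y, 2), (z, 2)]"
proof -
  let ?X = "{x, y, z}" and ?adj = "\<lambda>a b. {a, b} \<in> E"
  interpret sgraph ?adj by (rule sgraph_of_simple_graph[OF assms(1)])
  have fin: "finite V" using assms(1) by (simp add: simple_graph_def)
  have sparse: "5 * ee S S < 14 * card S" if S: "S \<subseteq> V" "S \<noteq> {}" for S
  proof -
    have finS: "finite S" using S(1) fin finite_subset by blast
    then have "0 < card S" using S(2) by (simp add: card_gt_0_iff)
    moreover have "2 * real (card {e \<in> E. e \<subseteq> S}) / real (card S) < 14 / 5"
      using mad_ge[OF assms(1) S] assms(2) by linarith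
    ultimately have "10 * real (card {e \<in> E. e \<subseteq> S}) < 14 * real (card S)"
      by (simp add: field_simps)
    then have "10 * card {e \<in> E. e \<subseteq> S} < 14 * card S" by linarith
    then show ?thesis using card_induced_edges[OF assms(1) finS] by simp
  qed
  have "coloring V \<phi> \<longleftrightarrow> proper_3_coloring V E \<phi>" for \<phi>
    using simple_graph_edge[OF assms(1)] unfolding coloring_def proper_3_coloring_def by blast
  then have "unblocked V ?X"
    using assms(9) unfolding unblocked_def blocked_def by auto
  then have "AT V (ind ?X)"
    by (intro sparse_AT[OF fin sparse]) (use assms(3-8) in auto)
  \<comment> \<open>The list function is 2 on the triple and 3 by default, so adding
    \<open>ind ?X\<close> gives 3 on all of \<open>V\<close>.\<close>
  then have "f_AT V E (\<lambda>v. case map_of [(x, 2), (y, 2), (z, 2)] v of Some a \<Rightarrow> a | None \<Rightarrow> 3)"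
    by (rule AT_imp_f_AT[OF _ fin]) (use simple_graph_edge[OF assms(1)] in \<open>auto simp: ind_def\<close>)
  then show ?thesis
    using assms(3-8) by (simp add: AT_extendable_def)
qed

end
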